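(* (i) There exists a $6$-regular geometric triangulation of the hyperbolic plane $\mathbb{H}^2$ such that the diameters of its triangles are uniformly bounded (i.e. there is a finite constant $M$ such that every triangle has hyperbolic diameter at most $M$). (ii) For every integer $k\geq 7$ there exists a $k$-regular geometric triangulation of the Euclidean plane $\mathbb{E}^2$ such that the diameters of its triangles are uniformly bounded (i.e. there is a finite constant $M$ such that every triangle has Euclidean diameter at most $M$).
   Context: $\mathbb{E}^2$ is the Euclidean plane and $\mathbb{H}^2$ is the hyperbolic plane of constant curvature $-1$. A triangulation $T$ of a surface $S$ is a triangulation of the whole surface in the usual sense (a locally finite simplicial complex structure on $S$). It is $k$-regular if every vertex has degree $k$ (is incident to exactly $k$ edges), and it is geometric, with respect to a given Riemannian metric on $S$, if all its edges are embedded as geodesic arcs. For $\mathbb{E}^2$ and $\mathbb{H}^2$ the standard metrics are used. A uniform bound on the diameters of the triangles is equivalent to a uniform bound on the edge lengths. *)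

theory Defs
  imports "HOL-Analysis.Analysis"
begin

section \<open>Simplicial complexes and triangulations\<close>

definition simplicial_cplx :: "'v set set \<Rightarrow> bool" where
  "simplicial_cplx K \<longleftrightarrow>
     (\<forall>s\<in>K. finite s \<and> s \<noteq> {}) \<and> (\<forall>s\<in>K. \<forall>t. t \<subseteq> s \<and> t \<noteq> {} \<longrightarrow> t \<in> K)"

definition locally_finite_cplx :: "'v set set \<Rightarrow> bool" where
  "locally_finite_cplx K \<longleftrightarrow> (\<forall>v. finite {s\<in>K. v \<in> s})"

text \<open>The closed simplex spanned by \<open>s\<close>, in barycentric coordinates.\<close>

definition closed_cell :: "'v set \<Rightarrow> ('v \<Rightarrow> real) set" where
  "closed_cell s = {\<alpha>. (\<forall>v. 0 \<le> \<alpha> v) \<and> (\<forall>v. v \<notin> s \<longrightarrow> \<alpha> v = 0) \<and> (\<Sum>v\<in>s. \<alpha> v) = 1}"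

text \<open>The geometric realization inherits the product topology of the function type
  \<open>'v \<Rightarrow> real\<close>. For a locally finite complex (the only case used below) this agrees with
  the weak topology: near a point with \<open>\<alpha> v > 0\<close> all points are supported on the
  finitely many vertices of the closed star of \<open>v\<close>.\<close>

definition geom_realization :: "'v set set \<Rightarrow> ('v \<Rightarrow> real) set" where
  "geom_realization K = (\<Union>s\<in>K. closed_cell s)"

text \<open>A triangulation of the whole space \<open>'a\<close>. When \<open>'a\<close> is a surface, the existence of the
  homeomorphism forces every simplex to have at most three vertices and to lie in a triangle.\<close>

definition space_triangulation ::
    "'v set set \<Rightarrow> (('v \<Rightarrow> real) \<Rightarrow> 'a::topological_space) \<Rightarrow> bool" where
  "space_triangulation K h \<longleftrightarrow>
     simplicial_cplx K \<and> locally_finite_cplx K \<and>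
     (\<exists>g. homeomorphism (geom_realization K) UNIV h g)"

definition edges :: "'v set set \<Rightarrow> 'v set set" where
  "edges K = {e\<in>K. card e = 2}"

definition triangles :: "'v set set \<Rightarrow> 'v set set" where
  "triangles K = {t\<in>K. card t = 3}"

definition regular_cplx :: "nat \<Rightarrow> 'v set set \<Rightarrow> bool" where
  "regular_cplx k K \<longleftrightarrow>
     (\<forall>v\<in>\<Union>K. finite {e\<in>edges K. v \<in> e} \<and> card {e\<in>edges K. v \<in> e} = k)"

text \<open>Geodesics in the Riemannian sense: unit speed curves that are locally distance
  minimizing; an arc is moreover embedded and nondegenerate.\<close>

definition geodesic_arc :: "'a::metric_space set \<Rightarrow> bool" where
  "geodesic_arc A \<longleftrightarrow>
     (\<exists>L>0. \<exists>\<gamma>::real \<Rightarrow> 'a. inj_on \<gamma> {0..L} \<and> \<gamma> ` {0..L} = A \<and>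
        (\<forall>t\<in>{0..L}. \<exists>\<epsilon>>0. \<forall>r\<in>{0..L} \<inter> ball t \<epsilon>. \<forall>s\<in>{0..L} \<inter> ball t \<epsilon>.
           dist (\<gamma> r) (\<gamma> s) = \<bar>r - s\<bar>))"

definition geometric_triangulation ::
    "'v set set \<Rightarrow> (('v \<Rightarrow> real) \<Rightarrow> 'a::metric_space) \<Rightarrow> bool" where
  "geometric_triangulation K h \<longleftrightarrow>
     space_triangulation K h \<and> (\<forall>e\<in>edges K. geodesic_arc (h ` closed_cell e))"

text \<open>Every \<open>h ` closed_cell t\<close> is compact when \<open>h\<close> is a triangulation, so \<open>diameter\<close> is the
  actual supremum of distances.\<close>

definition bounded_triangles ::
    "'v set set \<Rightarrow> (('v \<Rightarrow> real) \<Rightarrow> 'a::metric_space) \<Rightarrow> bool" where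
  "bounded_triangles K h \<longleftrightarrow> (\<exists>M. \<forall>t\<in>triangles K. diameter (h ` closed_cell t) \<le> M)"

section \<open>The hyperbolic plane\<close>

text \<open>The Beltrami-Klein model: the open unit disc, with the metric of curvature \<open>-1\<close> given by
  \<open>cosh d(x,y) = (1 - x \<bullet> y) / (sqrt (1 - |x|^2) * sqrt (1 - |y|^2))\<close>.\<close>

definition klein_cosh :: "real^2 \<Rightarrow> real^2 \<Rightarrow> real" where
  "klein_cosh x y = (1 - x \<bullet> y) / (sqrt (1 - x \<bullet> x) * sqrt (1 - y \<bullet> y))"

typedef hyperbolic_plane = "ball (0::real^2) 1"
  morphisms klein_coords of_klein_coords
  by (rule exI[of _ 0]) simp

lemma klein_coords_pos: "0 < 1 - klein_coords p \<bullet> klein_coords p"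
proof -
  have "norm (klein_coords p) < 1"
    using klein_coords[of p] by simp
  then have "(norm (klein_coords p))\<^sup>2 < 1"
    by (simp add: power_less_one_iff)
  then show ?thesis
    by (simp add: power2_norm_eq_inner)
qed

lemma klein_form_expand:
  fixes x y z :: "real^2"
  shows "(1 - x \<bullet> y) * (1 - y \<bullet> z) - (1 - x \<bullet> z) * (1 - y \<bullet> y) =
     (1 - y \<bullet> y) * ((x - y) \<bullet> (z - y)) + ((x - y) \<bullet> y) * ((z - y) \<bullet> y)"
  by (simp add: inner_diff_left inner_diff_right inner_commute algebra_simps)

lemma klein_cosh_commute: "klein_cosh x y = klein_cosh y x"
  by (simp add: klein_cosh_def inner_commute mult.commute)

lemma klein_cosh_sq:
  assumes "0 < 1 - x \<bullet> x" "0 < 1 - y \<bullet> y"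
  shows "(klein_cosh x y)\<^sup>2 - 1 =
    ((1 - y \<bullet> y) * ((x - y) \<bullet> (x - y)) + ((x - y) \<bullet> y)\<^sup>2) / ((1 - x \<bullet> x) * (1 - y \<bullet> y))"
proof -
  have "(klein_cosh x y)\<^sup>2 = (1 - x \<bullet> y)\<^sup>2 / ((1 - x \<bullet> x) * (1 - y \<bullet> y))"
    using assms by (simp add: klein_cosh_def power_divide power_mult_distrib)
  then have "(klein_cosh x y)\<^sup>2 - 1 =
      ((1 - x \<bullet> y)\<^sup>2 - (1 - x \<bullet> x) * (1 - y \<bullet> y)) / ((1 - x \<bullet> x) * (1 - y \<bullet> y))"
    using assms by (simp add: diff_divide_distrib)
  then show ?thesis
    using klein_form_expand[of x y x] by (simp add: power2_eq_square inner_commute)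
qed

lemma klein_cosh_ge_1:
  assumes "0 < 1 - x \<bullet> x" "0 < 1 - y \<bullet> y"
  shows "1 \<le> klein_cosh x y"
proof -
  have "0 \<le> (klein_cosh x y)\<^sup>2 - 1"
    unfolding klein_cosh_sq[OF assms] using assms by (intro divide_nonneg_pos add_nonneg_nonneg) auto
  moreover have "0 \<le> klein_cosh x y"
  proof -
    have "x \<bullet> y \<le> norm x * norm y" by (rule norm_cauchy_schwarz)
    also have "\<dots> \<le> 1 * 1"
      using assms by (intro mult_mono) (auto simp: norm_eq_sqrt_inner)
    finally show ?thesis using assms by (simp add: klein_cosh_def)
  qed
  ultimately show ?thesis
    by (intro power2_le_imp_le[of 1]) simp_all
qed

lemma klein_cosh_eq_1_iff:
  assumes "0 < 1 - x \<bullet> x" "0 < 1 - y \<bullet> y"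
  shows "klein_cosh x y = 1 \<longleftrightarrow> x = y"
proof
  assume "klein_cosh x y = 1"
  then have "(1 - y \<bullet> y) * ((x - y) \<bullet> (x - y)) + ((x - y) \<bullet> y)\<^sup>2 = 0"
    using klein_cosh_sq[OF assms] assms by simp
  moreover have "0 \<le> (1 - y \<bullet> y) * ((x - y) \<bullet> (x - y))" "0 \<le> ((x - y) \<bullet> y)\<^sup>2"
    using assms by auto
  ultimately have "(1 - y \<bullet> y) * ((x - y) \<bullet> (x - y)) = 0"
    by linarith
  then show "x = y" using assms by simp
next
  assume "x = y"
  then show "klein_cosh x y = 1" using assms by (simp add: klein_cosh_def)
qed

lemma klein_cosh_triangle:
  assumes x: "0 < 1 - x \<bullet> x" and y: "0 < 1 - y \<bullet> y" and z: "0 < 1 - z \<bullet> z"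
  shows "klein_cosh x z \<le> klein_cosh x y * klein_cosh y z +
    sqrt ((klein_cosh x y)\<^sup>2 - 1) * sqrt ((klein_cosh y z)\<^sup>2 - 1)"
proof -
  define c where "c = 1 - y \<bullet> y"
  define U W where "U = (sqrt c *\<^sub>R (x - y), (x - y) \<bullet> y)" and "W = (sqrt c *\<^sub>R (z - y), (z - y) \<bullet> y)"
  define sx sz where "sx = sqrt (1 - x \<bullet> x)" and "sz = sqrt (1 - z \<bullet> z)"
  have pos: "0 < c" "0 < sx" "0 < sz" using assms by (auto simp: c_def sx_def sz_def)
  have nU: "norm U = sqrt (c * ((x - y) \<bullet> (x - y)) + ((x - y) \<bullet> y)\<^sup>2)"
    and nW: "norm W = sqrt (c * ((z - y) \<bullet> (z - y)) + ((z - y) \<bullet> y)\<^sup>2)"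
    using pos by (simp_all add: norm_eq_sqrt_inner U_def W_def power2_eq_square flip: mult.assoc)
  have "U \<bullet> W = c * ((x - y) \<bullet> (z - y)) + ((x - y) \<bullet> y) * ((z - y) \<bullet> y)"
    using pos by (simp add: U_def W_def flip: mult.assoc)
  also have "\<dots> = (1 - x \<bullet> y) * (1 - y \<bullet> z) - (1 - x \<bullet> z) * c"
    unfolding c_def klein_form_expand ..
  finally have UW: "(1 - x \<bullet> z) * c - (1 - x \<bullet> y) * (1 - y \<bullet> z) \<le> norm U * norm W"
    using Cauchy_Schwarz_ineq2[of U W] by linarith
  have sU: "sqrt ((klein_cosh x y)\<^sup>2 - 1) = norm U / (sx * sqrt c)"
    unfolding klein_cosh_sq[OF x y] nU by (simp add: real_sqrt_divide real_sqrt_mult sx_def c_def)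
  have sW: "sqrt ((klein_cosh y z)\<^sup>2 - 1) = norm W / (sqrt c * sz)"
    unfolding klein_cosh_commute[of y z] klein_cosh_sq[OF z y] nW
    by (simp add: real_sqrt_divide real_sqrt_mult sz_def c_def)
  have "klein_cosh x z = (1 - x \<bullet> z) * c / (sx * sz * c)"
    using pos by (simp add: klein_cosh_def sx_def sz_def)
  also have "\<dots> \<le> ((1 - x \<bullet> y) * (1 - y \<bullet> z) + norm U * norm W) / (sx * sz * c)"
    using UW pos by (intro divide_right_mono) auto
  also have "\<dots> = ((1 - x \<bullet> y) / (sx * sqrt c)) * ((1 - y \<bullet> z) / (sqrt c * sz))
      + (norm U / (sx * sqrt c)) * (norm W / (sqrt c * sz))"
  proof -
    have "sx * sz * c = (sx * sqrt c) * (sqrt c * sz)"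
      using pos by (simp add: mult_ac)
    then show ?thesis by (simp only: add_divide_distrib times_divide_times_eq)
  qed
  also have "\<dots> = klein_cosh x y * klein_cosh y z +
    sqrt ((klein_cosh x y)\<^sup>2 - 1) * sqrt ((klein_cosh y z)\<^sup>2 - 1)"
    unfolding sU sW by (simp add: klein_cosh_def sx_def sz_def c_def)
  finally show ?thesis .
qed

instantiation hyperbolic_plane :: metric_space
begin

definition dist_hyperbolic_plane :: "hyperbolic_plane \<Rightarrow> hyperbolic_plane \<Rightarrow> real" where
  "dist_hyperbolic_plane p q = arcosh (klein_cosh (klein_coords p) (klein_coords q))"

definition uniformity_hyperbolic_plane :: "(hyperbolic_plane \<times> hyperbolic_plane) filter" where
  "uniformity_hyperbolic_plane = (INF e\<in>{0<..}. principal {(x, y). dist x y < e})"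

definition open_hyperbolic_plane :: "hyperbolic_plane set \<Rightarrow> bool" where
  "open_hyperbolic_plane U \<longleftrightarrow> (\<forall>x\<in>U. eventually (\<lambda>(x', y). x' = x \<longrightarrow> y \<in> U) uniformity)"

instance
proof
  fix p q r :: hyperbolic_plane
  let ?C = "\<lambda>p q. klein_cosh (klein_coords p) (klein_coords q)"
  have ge1: "1 \<le> ?C p q" for p q
    by (intro klein_cosh_ge_1 klein_coords_pos)
  have nonneg: "0 \<le> dist p q" for p q :: hyperbolic_plane
    using ge1[of p q] by (simp add: dist_hyperbolic_plane_def arcosh_nonneg_real)
  have cosh_dist: "cosh (dist p q) = ?C p q" for p q :: hyperbolic_plane
    using ge1[of p q] by (simp add: dist_hyperbolic_plane_def cosh_arcosh_real)
  have sinh_dist: "sinh (dist p q) = sqrt ((?C p q)\<^sup>2 - 1)" for p q :: hyperbolic_plane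
    using nonneg[of p q] cosh_dist[of p q] by (simp add: sinh_square_eq[symmetric] flip: cosh_dist)
  have comm: "dist p q = dist q p" for p q :: hyperbolic_plane
    by (simp add: dist_hyperbolic_plane_def klein_cosh_commute)
  show "dist p q = 0 \<longleftrightarrow> p = q"
  proof -
    have "dist p q = 0 \<longleftrightarrow> ?C p q = 1"
      using cosh_dist[of p q] by (metis arcosh_1 cosh_0 dist_hyperbolic_plane_def)
    then show ?thesis
      by (simp add: klein_cosh_eq_1_iff[OF klein_coords_pos klein_coords_pos] klein_coords_inject)
  qed
  have "cosh (dist p q) \<le> cosh (dist p r + dist r q)"
    unfolding cosh_add cosh_dist sinh_dist by (intro klein_cosh_triangle klein_coords_pos)
  then show "dist p q \<le> dist p r + dist q r"
    using nonneg[of p q] nonneg[of p r] nonneg[of r q]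
    by (simp add: cosh_real_nonneg_le_iff comm[of q r])
qed (simp_all add: uniformity_hyperbolic_plane_def open_hyperbolic_plane_def)

end

end

theory Submission
  imports Defs "HOL-Library.Discrete_Functions" "HOL-Real_Asymp.Real_Asymp"
begin

text \<open>Geodesics of the Klein disc are straight segments, so in both planes it suffices to find a
  straight-line triangulation of the disc or the plane. Put a vertex at the centre and rings of vertices
  on concentric circles, so that the directions occurring in one ring all occur in the next one. A triangle
  between two rings then either has two vertices on one ray, or it is a chord of the inner ring together
  with a vertex of the outer ring lying beyond that chord. Hence no further condition on the radii
  is needed, and the vertex degrees depend on the combinatorics alone.

  For \<open>k \<ge> 7\<close> one takes the rings of the \<open>k\<close>-regular triangulation around a vertex. The angular gaps halve
  from ring to ring, while the radii grow linearly. For degree six, ring \<open>n\<close> of the triangular lattice has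
  only six vertices more than its predecessor. In each of six sectors one gap is halved per step, going
  through all gaps in turn, so the gaps are of order \<open>1 / n\<close>. The edges stay bounded when the Klein radius
  satisfies \<open>1 - r\<^sup>2 = 1 / (n + 2)\<^sup>2\<close>, that is, when the hyperbolic radius grows like \<open>ln n\<close>.\<close>

section \<open>Piecewise affine triangulations\<close>

text \<open>The degree does not fit the curvature, but bounded triangles need only an upper bound on
  edge lengths, so edges may shrink far from the centre. In the Euclidean case there are too many
  vertices: exponentially many on circles of linearly growing length. In the hyperbolic case there
  are too few, linearly many, so the circles may only grow linearly in length. This forces radial
  steps that shrink but still sum to infinity. Nested directions cut the region between consecutive
  rings along rays into sectors, one for each gap of the inner ring. Triangles of different layers
  are separated by the chord of the gap below the outer one, triangles of different sectors by a
  ray, triangles of one sector by a spoke from an end of its gap. All these facts are signs of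
  signed areas, which is why the radii only have to increase. Indexing a ring periodically by all
  integers makes \<open>i - 1\<close> and \<open>i + 1\<close> neighbours without
  wraparound.\<close>

definition generated_cplx :: "'v set set \<Rightarrow> 'v set set" where
  "generated_cplx T = {s. s \<noteq> {} \<and> (\<exists>t\<in>T. s \<subseteq> t)}"

text \<open>Summing over the support, rather than over a chosen simplex, gives one formula on the
  whole realization, so the maps on different simplices agree on common faces by
  construction.\<close>

definition affine_extension :: "('v \<Rightarrow> 'a::real_vector) \<Rightarrow> ('v \<Rightarrow> real) \<Rightarrow> 'a" where
  "affine_extension pos \<alpha> = (\<Sum>v | \<alpha> v \<noteq> 0. \<alpha> v *\<^sub>R pos v)"

lemma affine_extension_eq_sum:
  assumes "finite W" "\<And>v. v \<notin> W \<Longrightarrow> \<alpha> v = 0"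
  shows "affine_extension pos \<alpha> = (\<Sum>v\<in>W. \<alpha> v *\<^sub>R pos v)"
  unfolding affine_extension_def
  by (rule sum.mono_neutral_left) (use assms in auto)

lemma closed_cell_mono:
  assumes "finite t" "s \<subseteq> t"
  shows "closed_cell s \<subseteq> closed_cell t"
proof
  fix \<alpha> assume a: "\<alpha> \<in> closed_cell s"
  have "sum \<alpha> t = sum \<alpha> s"
    by (rule sum.mono_neutral_right) (use assms a in \<open>auto simp: closed_cell_def\<close>)
  then show "\<alpha> \<in> closed_cell t"
    using a assms by (auto simp: closed_cell_def)
qed

lemma affine_extension_closed_cell:
  assumes "finite s" "inj_on pos s"
  shows "affine_extension pos ` closed_cell s = convex hull (pos ` s)"
proof
  show "affine_extension pos ` closed_cell s \<subseteq> convex hull (pos ` s)"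
  proof
    fix y assume "y \<in> affine_extension pos ` closed_cell s"
    then obtain \<alpha> where a: "\<alpha> \<in> closed_cell s" "y = affine_extension pos \<alpha>" by auto
    have y: "y = (\<Sum>v\<in>s. \<alpha> v *\<^sub>R pos v)"
      using a affine_extension_eq_sum[OF assms(1)] by (auto simp: closed_cell_def)
    have "(\<Sum>v\<in>s. \<alpha> v *\<^sub>R pos v) \<in> convex hull (pos ` s)"
      by (rule convex_sum) (use a assms in \<open>auto simp: closed_cell_def intro: hull_inc\<close>)
    with y show "y \<in> convex hull (pos ` s)" by simp
  qed
  show "convex hull (pos ` s) \<subseteq> affine_extension pos ` closed_cell s"
  proof
    fix y assume "y \<in> convex hull (pos ` s)"
    then obtain u where u: "\<forall>x\<in>pos ` s. 0 \<le> u x" "sum u (pos ` s) = 1"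
        "(\<Sum>x\<in>pos ` s. u x *\<^sub>R x) = y"
      using assms by (auto simp: convex_hull_finite)
    \<comment> \<open>Injectivity of \<open>pos\<close> lets weights on points be read as weights on
      vertices.\<close>
    define \<alpha> where "\<alpha> v = (if v \<in> s then u (pos v) else 0)" for v
    have "\<alpha> \<in> closed_cell s"
      using u assms by (auto simp: closed_cell_def \<alpha>_def sum.reindex)
    moreover have "affine_extension pos \<alpha> = y"
      using affine_extension_eq_sum[OF assms(1), of \<alpha> pos] u assms
      by (simp add: \<alpha>_def sum.reindex)
    ultimately show "y \<in> affine_extension pos ` closed_cell s" by blast
  qed
qed

text \<open>Two coordinate vectors with the same image differ by coefficients of total zero that
  annihilate the points; affine independence forces these to vanish.\<close>

lemma affine_extension_inj_on_closed_cell: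
  assumes "finite s" "inj_on pos s" "\<not> affine_dependent (pos ` s)"
  shows "inj_on (affine_extension pos) (closed_cell s)"
proof
  fix \<alpha> \<beta> assume a: "\<alpha> \<in> closed_cell s" and b: "\<beta> \<in> closed_cell s"
    and eq: "affine_extension pos \<alpha> = affine_extension pos \<beta>"
  have eq': "(\<Sum>v\<in>s. \<alpha> v *\<^sub>R pos v) = (\<Sum>v\<in>s. \<beta> v *\<^sub>R pos v)"
    using eq affine_extension_eq_sum[OF assms(1), of \<alpha> pos] affine_extension_eq_sum[OF assms(1), of \<beta> pos] a b
    by (auto simp: closed_cell_def)
  define u where "u x = \<alpha> (inv_into s pos x) - \<beta> (inv_into s pos x)" for x
  have u: "u (pos v) = \<alpha> v - \<beta> v" if "v \<in> s" for v
    using that assms by (simp add: u_def)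
  have "sum u (pos ` s) = 0"
    using a b assms by (simp add: sum.reindex u sum_subtractf closed_cell_def)
  moreover have "(\<Sum>x\<in>pos ` s. u x *\<^sub>R x) = 0"
    using eq' assms by (simp add: sum.reindex u scaleR_left_diff_distrib sum_subtractf)
  ultimately have "\<forall>v\<in>pos ` s. u v = 0"
    using assms(3) affine_dependent_explicit_finite[of "pos ` s"] assms(1) by blast
  then have "\<alpha> v = \<beta> v" if "v \<in> s" for v
    using u[OF that] that by auto
  moreover have "\<alpha> v = \<beta> v" if "v \<notin> s" for v
    using a b that by (simp add: closed_cell_def)
  ultimately show "\<alpha> = \<beta>" by blast
qed

text \<open>The vertex type may be infinite, so the cell is treated as a closed slice of a product
  of compact sets, and Tychonoff's theorem applies.\<close>

lemma compact_closed_cell: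
  assumes "finite s"
  shows "compact (closed_cell s)"
proof -
  let ?B = "PiE UNIV (\<lambda>v. if v \<in> s then {0..1::real} else {0})"
  have "compactin (product_topology (\<lambda>i. euclidean) UNIV) ?B"
    unfolding compactin_PiE by auto
  then have "compact ?B"
    by (simp add: euclidean_product_topology)
  moreover have "closed {\<alpha>::'a \<Rightarrow> real. (\<Sum>v\<in>s. \<alpha> v) = 1}"
    by (intro closed_Collect_eq continuous_intros) auto
  moreover have "closed_cell s = ?B \<inter> {\<alpha>. (\<Sum>v\<in>s. \<alpha> v) = 1}"
  proof (intro set_eqI iffI)
    fix \<alpha> assume a: "\<alpha> \<in> closed_cell s"
    have "\<alpha> v \<le> 1" if "v \<in> s" for v
      using member_le_sum[of v s \<alpha>] a assms that by (auto simp: closed_cell_def)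
    with a show "\<alpha> \<in> ?B \<inter> {\<alpha>. (\<Sum>v\<in>s. \<alpha> v) = 1}"
      by (auto simp: closed_cell_def PiE_def)
  next
    fix \<alpha> assume a: "\<alpha> \<in> ?B \<inter> {\<alpha>. (\<Sum>v\<in>s. \<alpha> v) = 1}"
    then have *: "\<alpha> v \<in> (if v \<in> s then {0..1} else {0})" for v
      by (auto simp: PiE_def Pi_def)
    have "0 \<le> \<alpha> v" "v \<notin> s \<Longrightarrow> \<alpha> v = 0" for v
      using *[of v] by (auto split: if_splits)
    with a show "\<alpha> \<in> closed_cell s" by (auto simp: closed_cell_def)
  qed
  ultimately show ?thesis by (simp add: compact_Int_closed)
qed

lemma continuous_on_local:
  assumes "\<And>x. x \<in> S \<Longrightarrow> \<exists>U. open U \<and> x \<in> U \<and> continuous_on (S \<inter> U) f"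
  shows "continuous_on S f"
  unfolding continuous_on_def
proof
  fix x assume "x \<in> S"
  with assms obtain U where U: "open U" "x \<in> U" "continuous_on (S \<inter> U) f" by blast
  have "(f \<longlongrightarrow> f x) (at x within S \<inter> U)"
    using U \<open>x \<in> S\<close> by (auto simp: continuous_on_def)
  moreover have "at x within S \<inter> U = at x within S"
    by (rule at_within_nhd[OF U(2,1)]) auto
  ultimately show "(f \<longlongrightarrow> f x) (at x within S)" by simp
qed

text \<open>The two finiteness conditions serve opposite directions: \<open>finite_star\<close>
  makes the map out of the realization continuous, \<open>cells_locally_finite\<close> its inverse.
  The latter is asked only at points of \<open>\<Omega>\<close>, since cells may accumulate at its
  boundary.\<close>

locale affine_triangles =
  fixes pos :: "'v \<Rightarrow> 'a::euclidean_space" and T :: "'v set set" and \<Omega> :: "'a set"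
  assumes pos_inj: "inj_on pos (\<Union>T)"
    and finite_cell: "t \<in> T \<Longrightarrow> finite t"
    and cell_independent: "t \<in> T \<Longrightarrow> \<not> affine_dependent (pos ` t)"
    and cells_Int: "s \<in> T \<Longrightarrow> t \<in> T \<Longrightarrow>
      convex hull (pos ` s) \<inter> convex hull (pos ` t) \<subseteq> convex hull (pos ` (s \<inter> t))"
    and finite_star: "finite {t\<in>T. v \<in> t}"
    and cells_cover: "(\<Union>t\<in>T. convex hull (pos ` t)) = \<Omega>"
    and cells_locally_finite: "x \<in> \<Omega> \<Longrightarrow> \<exists>U. open U \<and> x \<in> U \<and> finite {t\<in>T. convex hull (pos ` t) \<inter> U \<noteq> {}}"
begin

abbreviation "cplx \<equiv> generated_cplx T"

lemma pos_inj_cell: "t \<in> T \<Longrightarrow> inj_on pos t"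
  using pos_inj by (rule inj_on_subset) auto

lemma simplicial_cplx: "simplicial_cplx cplx"
  unfolding simplicial_cplx_def
proof (intro conjI ballI allI impI)
  fix s assume "s \<in> cplx"
  then obtain t where "t \<in> T" "s \<subseteq> t" by (auto simp: generated_cplx_def)
  then show "finite s" using finite_cell finite_subset by metis
next
  fix s u assume "s \<in> cplx" and u: "u \<subseteq> s \<and> u \<noteq> {}"
  then obtain t where "t \<in> T" "s \<subseteq> t" by (auto simp: generated_cplx_def)
  then have "t \<in> T" "u \<subseteq> t" using u by (auto intro: subset_trans)
  then show "u \<in> cplx" using u unfolding generated_cplx_def by blast
qed (simp add: generated_cplx_def)

lemma locally_finite_cplx: "locally_finite_cplx cplx"
  unfolding locally_finite_cplx_def
proof
  fix v
  have "{s\<in>cplx. v \<in> s} \<subseteq> (\<Union>t\<in>{t\<in>T. v \<in> t}. Pow t)"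
    by (auto simp: generated_cplx_def)
  moreover have "finite \<dots>"
    using finite_star finite_cell by auto
  ultimately show "finite {s\<in>cplx. v \<in> s}"
    by (rule finite_subset)
qed

lemma geom_realization_cplx: "geom_realization cplx = (\<Union>t\<in>T. closed_cell t)"
proof
  have "closed_cell s \<subseteq> (\<Union>t\<in>T. closed_cell t)" if s: "s \<in> generated_cplx T" for s
  proof -
    obtain t where "t \<in> T" "s \<subseteq> t" using s by (auto simp: generated_cplx_def)
    then show ?thesis using closed_cell_mono[OF finite_cell, of t s] by blast
  qed
  then show "geom_realization cplx \<subseteq> (\<Union>t\<in>T. closed_cell t)"
    unfolding geom_realization_def by (rule UN_least)
  have "closed_cell t \<subseteq> geom_realization cplx" if "t \<in> T" for t
  proof (cases "t = {}")
    case True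
    then show ?thesis by (simp add: closed_cell_def)
  next
    case False
    then have "t \<in> cplx" using that by (auto simp: generated_cplx_def)
    then show ?thesis unfolding geom_realization_def by blast
  qed
  then show "(\<Union>t\<in>T. closed_cell t) \<subseteq> geom_realization cplx"
    by (rule UN_least)
qed

lemma image_cell: "t \<in> T \<Longrightarrow> affine_extension pos ` closed_cell t = convex hull (pos ` t)"
  by (rule affine_extension_closed_cell[OF finite_cell pos_inj_cell])

lemma image_face:
  assumes "s \<in> cplx"
  shows "affine_extension pos ` closed_cell s = convex hull (pos ` s)"
proof -
  obtain t where "t \<in> T" "s \<subseteq> t" using assms by (auto simp: generated_cplx_def)
  then show ?thesis
    using affine_extension_closed_cell finite_cell finite_subset inj_on_subset pos_inj_cell by metis
qed

text \<open>A point in two cells lies in the hull of their common vertices. Coordinates supported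
  there are its coordinates in both cells, by uniqueness in each.\<close>

lemma inj_on_realization: "inj_on (affine_extension pos) (geom_realization cplx)"
proof
  fix \<alpha> \<beta> assume "\<alpha> \<in> geom_realization cplx" "\<beta> \<in> geom_realization cplx"
    and eq: "affine_extension pos \<alpha> = affine_extension pos \<beta>"
  then obtain s t where st: "s \<in> T" "t \<in> T" "\<alpha> \<in> closed_cell s" "\<beta> \<in> closed_cell t"
    by (auto simp: geom_realization_cplx)
  let ?x = "affine_extension pos \<alpha>"
  have "?x \<in> convex hull (pos ` s)" "?x \<in> convex hull (pos ` t)"
    using image_cell[OF st(1)] image_cell[OF st(2)] st(3,4) eq by (metis imageI)+
  then have "?x \<in> convex hull (pos ` (s \<inter> t))"
    using cells_Int st by auto
  also have "\<dots> = affine_extension pos ` closed_cell (s \<inter> t)"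
    using affine_extension_closed_cell[of "s \<inter> t" pos] finite_cell pos_inj_cell st
    by (metis finite_Int inf_le1 inj_on_subset)
  finally obtain \<gamma> where g: "\<gamma> \<in> closed_cell (s \<inter> t)" "?x = affine_extension pos \<gamma>" by auto
  have "\<gamma> \<in> closed_cell s" "\<gamma> \<in> closed_cell t"
    using g closed_cell_mono[of s "s \<inter> t"] closed_cell_mono[of t "s \<inter> t"] finite_cell st by auto
  then have "\<alpha> = \<gamma>" "\<beta> = \<gamma>"
    using affine_extension_inj_on_closed_cell[OF finite_cell pos_inj_cell cell_independent] st g eq
    by (metis inj_onD)+
  then show "\<alpha> = \<beta>" by simp
qed

lemma image_realization: "affine_extension pos ` geom_realization cplx = \<Omega>"
  unfolding geom_realization_cplx image_UN cells_cover[symmetric]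
  by (rule SUP_cong) (simp_all add: image_cell)

text \<open>Positivity of one coordinate \<open>v\<close> is an open condition that confines the
  support to the finitely many vertices sharing a cell with \<open>v\<close>. There the map is a
  finite sum of coordinate functions.\<close>

lemma continuous_on_realization: "continuous_on (geom_realization cplx) (affine_extension pos)"
proof (rule continuous_on_local)
  fix \<alpha> assume "\<alpha> \<in> geom_realization cplx"
  then obtain t where "t \<in> T" "\<alpha> \<in> closed_cell t"
    by (auto simp: geom_realization_cplx)
  then have "(\<Sum>v\<in>t. \<alpha> v) = 1" "\<forall>v. 0 \<le> \<alpha> v" by (auto simp: closed_cell_def)
  then obtain v where v: "0 < \<alpha> v"
    by (metis less_eq_real_def sum.neutral zero_neq_one)
  define U where "U = {\<beta> :: 'v \<Rightarrow> real. 0 < \<beta> v}"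
  define W where "W = \<Union>{t\<in>T. v \<in> t}"
  have finW: "finite W"
    using finite_star finite_cell by (auto simp: W_def)
  have "open U"
    unfolding U_def by (intro open_Collect_less continuous_intros) auto
  moreover have "continuous_on (geom_realization cplx \<inter> U) (affine_extension pos)"
  proof (rule continuous_on_eq)
    show "continuous_on (geom_realization cplx \<inter> U) (\<lambda>\<beta>. \<Sum>v\<in>W. \<beta> v *\<^sub>R pos v)"
      by (intro continuous_intros continuous_on_subset[OF continuous_on_product_coordinates]) auto
  next
    fix \<beta> assume b: "\<beta> \<in> geom_realization cplx \<inter> U"
    then obtain t where "t \<in> T" "\<beta> \<in> closed_cell t"
      by (auto simp: geom_realization_cplx)
    moreover from this b have "v \<in> t" by (auto simp: closed_cell_def U_def)
    ultimately have "\<beta> w = 0" if "w \<notin> W" for w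
      using that by (auto simp: closed_cell_def W_def)
    then show "(\<Sum>v\<in>W. \<beta> v *\<^sub>R pos v) = affine_extension pos \<beta>"
      using affine_extension_eq_sum[OF finW] by metis
  qed
  ultimately show "\<exists>U. open U \<and> \<alpha> \<in> U \<and> continuous_on (geom_realization cplx \<inter> U) (affine_extension pos)"
    using v by (auto simp: U_def)
qed

text \<open>On one cell the map is a continuous injection of a compact space, so its inverse is
  continuous; near a point of \<Omega> only finitely many closed cells have to be pasted.\<close>

lemma continuous_on_inverse:
  "continuous_on \<Omega> (inv_into (geom_realization cplx) (affine_extension pos))" (is "continuous_on \<Omega> ?g")
proof (rule continuous_on_local)
  fix x assume "x \<in> \<Omega>"
  from cells_locally_finite[OF this] obtain U where U: "open U" "x \<in> U"
      "finite {t\<in>T. convex hull (pos ` t) \<inter> U \<noteq> {}}" by blast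
  let ?F = "{t\<in>T. convex hull (pos ` t) \<inter> U \<noteq> {}}"
  have "continuous_on (\<Union>t\<in>?F. convex hull (pos ` t)) ?g"
  proof (rule continuous_on_closed_Union[OF U(3)])
    fix t assume t: "t \<in> ?F"
    then have sub: "closed_cell t \<subseteq> geom_realization cplx" by (auto simp: geom_realization_cplx)
    show "closed (convex hull (pos ` t))"
      using t finite_cell by (intro compact_imp_closed finite_imp_compact_convex_hull) auto
    have "continuous_on (affine_extension pos ` closed_cell t) ?g"
    proof (rule continuous_on_inv)
      show "continuous_on (closed_cell t) (affine_extension pos)"
        using continuous_on_realization sub by (rule continuous_on_subset)
      show "\<forall>\<alpha>\<in>closed_cell t. ?g (affine_extension pos \<alpha>) = \<alpha>"
        using inj_on_realization sub by (auto intro: inv_into_f_f)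
    qed (use compact_closed_cell finite_cell t in auto)
    then show "continuous_on (convex hull (pos ` t)) ?g"
      using image_cell t by simp
  qed
  then have "continuous_on (\<Omega> \<inter> U) ?g"
    by (rule continuous_on_subset) (use cells_cover in auto)
  with U show "\<exists>U. open U \<and> x \<in> U \<and> continuous_on (\<Omega> \<inter> U) ?g" by blast
qed

lemma homeomorphism_realization:
  "homeomorphism (geom_realization cplx) \<Omega> (affine_extension pos)
     (inv_into (geom_realization cplx) (affine_extension pos))"
proof (rule homeomorphismI)
  let ?R = "geom_realization cplx" and ?f = "affine_extension pos"
  show "continuous_on ?R ?f" "continuous_on \<Omega> (inv_into ?R ?f)"
    by (fact continuous_on_realization continuous_on_inverse)+
  show "?f ` ?R \<subseteq> \<Omega>"
    by (simp add: image_realization)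
  have inv: "inv_into ?R ?f y \<in> ?R" "?f (inv_into ?R ?f y) = y" if "y \<in> \<Omega>" for y
    using that inv_into_into[of y ?f ?R] f_inv_into_f[of y ?f ?R] unfolding image_realization by blast+
  show "inv_into ?R ?f ` \<Omega> \<subseteq> ?R"
    using inv(1) by (rule image_subsetI)
  show "?f (inv_into ?R ?f y) = y" if "y \<in> \<Omega>" for y
    using that by (rule inv(2))
  show "inv_into ?R ?f (?f \<alpha>) = \<alpha>" if "\<alpha> \<in> ?R" for \<alpha>
    using inj_on_realization that by (rule inv_into_f_f)
qed

end

section \<open>Orientation and polar coordinates in the plane\<close>

definition cross2 :: "real^2 \<Rightarrow> real^2 \<Rightarrow> real" where
  "cross2 u v = u $ 1 * v $ 2 - u $ 2 * v $ 1"

definition orient :: "real^2 \<Rightarrow> real^2 \<Rightarrow> real^2 \<Rightarrow> real" where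
  "orient p q x = cross2 (q - p) (x - p)"

definition polar :: "real \<Rightarrow> real \<Rightarrow> real^2" where
  "polar r t = vector [r * cos t, r * sin t]"

section \<open>Affine functionals and separation of convex hulls\<close>

definition affine_functional :: "('a::real_inner \<Rightarrow> real) \<Rightarrow> bool" where
  "affine_functional f \<longleftrightarrow> (\<exists>a b. \<forall>x. f x = a \<bullet> x + b)"

lemma affine_functional_uminus:
  "affine_functional f \<Longrightarrow> affine_functional (\<lambda>x. - f x)"
  unfolding affine_functional_def by (metis inner_minus_left minus_add_distrib)

lemma affine_functional_sum:
  assumes "affine_functional f" "finite S" "sum u S = 1"
  shows "f (\<Sum>x\<in>S. u x *\<^sub>R x) = (\<Sum>x\<in>S. u x * f x)"
proof -
  obtain a b where f: "\<And>x. f x = a \<bullet> x + b" using assms(1) by (auto simp: affine_functional_def)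
  have "(\<Sum>x\<in>S. u x * f x) = (\<Sum>x\<in>S. u x * (a \<bullet> x)) + sum u S * b"
    by (simp add: f distrib_left sum.distrib sum_distrib_right)
  then show ?thesis using assms(3) by (simp add: f inner_sum_right)
qed

lemma affine_functional_hull_nonneg:
  assumes "affine_functional f" "finite S" "\<And>y. y \<in> S \<Longrightarrow> 0 \<le> f y" "x \<in> convex hull S"
  shows "0 \<le> f x"
proof -
  obtain u where u: "\<forall>x\<in>S. 0 \<le> u x" "sum u S = 1" "(\<Sum>x\<in>S. u x *\<^sub>R x) = x"
    using assms by (auto simp: convex_hull_finite)
  have "f x = (\<Sum>x\<in>S. u x * f x)"
    using affine_functional_sum[OF assms(1,2) u(2)] u(3) by simp
  then show ?thesis using u(1) assms(3) by (simp add: sum_nonneg)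
qed

text \<open>If a nonnegative functional averages to zero, every point of positive weight is itself a
  zero.\<close>

lemma affine_functional_hull_zero:
  assumes "affine_functional f" "finite S" "\<And>y. y \<in> S \<Longrightarrow> 0 \<le> f y" "x \<in> convex hull S" "f x = 0"
  shows "x \<in> convex hull {y\<in>S. f y = 0}"
proof -
  obtain u where u: "\<forall>x\<in>S. 0 \<le> u x" "sum u S = 1" "(\<Sum>x\<in>S. u x *\<^sub>R x) = x"
    using assms by (auto simp: convex_hull_finite)
  have "(\<Sum>x\<in>S. u x * f x) = 0"
    using affine_functional_sum[OF assms(1,2) u(2)] u(3) assms(5) by simp
  then have "\<forall>x\<in>S. u x * f x = 0"
    using sum_nonneg_eq_0_iff[OF assms(2), of "\<lambda>x. u x * f x"] u(1) assms(3) by simp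
  then have z: "\<forall>x\<in>S - {y\<in>S. f y = 0}. u x = 0" by auto
  let ?S = "{y\<in>S. f y = 0}"
  have "sum u ?S = 1" "(\<Sum>x\<in>?S. u x *\<^sub>R x) = x"
    using u z sum.mono_neutral_left[OF assms(2), of ?S u]
      sum.mono_neutral_left[OF assms(2), of ?S "\<lambda>x. u x *\<^sub>R x"] by auto
  then show ?thesis using u(1) assms(2) by (auto simp: convex_hull_finite)
qed

lemma hull_Int_of_pair:
  assumes "S \<subseteq> {p, q}" "S' \<subseteq> {p, q}"
  shows "convex hull S \<inter> convex hull S' \<subseteq> convex hull (S \<inter> S')"
proof -
  have "S \<subseteq> S' \<or> S' \<subseteq> S \<or> (S = {p} \<and> S' = {q} \<and> p \<noteq> q) \<or> (S = {q} \<and> S' = {p} \<and> p \<noteq> q)"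
    using assms by blast
  then consider "S \<subseteq> S'" | "S' \<subseteq> S" | "S = {p}" "S' = {q}" "p \<noteq> q" | "S = {q}" "S' = {p}" "p \<noteq> q"
    by blast
  then show ?thesis by cases (auto simp: Int_absorb1 Int_absorb2)
qed

text \<open>This is the general test for two cells to meet in a face. A common point lies on the
  zero line of \<open>f\<close>, so it is a combination of vertices on that line, and these are
  among \<open>p\<close> and \<open>q\<close>. For subsets of a pair the intersection of hulls is
  clear.\<close>

lemma hull_Int_separated:
  assumes f: "affine_functional f" and fin: "finite S" "finite S'"
    and sign: "\<And>y. y \<in> S \<Longrightarrow> f y \<le> 0" "\<And>y. y \<in> S' \<Longrightarrow> 0 \<le> f y"
    and zero: "\<And>y. y \<in> S \<union> S' \<Longrightarrow> f y = 0 \<Longrightarrow> y = p \<or> y = q"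
  shows "convex hull S \<inter> convex hull S' \<subseteq> convex hull (S \<inter> S')"
proof
  fix x assume x: "x \<in> convex hull S \<inter> convex hull S'"
  have "0 \<le> - f x"
    by (rule affine_functional_hull_nonneg[OF affine_functional_uminus[OF f] fin(1)]) (use sign x in auto)
  moreover have "0 \<le> f x"
    by (rule affine_functional_hull_nonneg[OF f fin(2)]) (use sign x in auto)
  ultimately have fx: "f x = 0" by simp
  have x1: "x \<in> convex hull {y\<in>S. - f y = 0}"
    by (rule affine_functional_hull_zero[OF affine_functional_uminus[OF f] fin(1)]) (use sign x fx in auto)
  have x2: "x \<in> convex hull {y\<in>S'. f y = 0}"
    by (rule affine_functional_hull_zero[OF f fin(2)]) (use sign x fx in auto)
  have sub: "{y\<in>S. - f y = 0} \<subseteq> {p, q}" "{y\<in>S'. f y = 0} \<subseteq> {p, q}"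
    using zero by auto
  from x1 x2 have "x \<in> convex hull {y\<in>S. - f y = 0} \<inter> convex hull {y\<in>S'. f y = 0}" ..
  then have "x \<in> convex hull ({y\<in>S. - f y = 0} \<inter> {y\<in>S'. f y = 0})"
    by (rule subsetD[OF hull_Int_of_pair[OF sub]])
  moreover have "convex hull ({y\<in>S. - f y = 0} \<inter> {y\<in>S'. f y = 0}) \<subseteq> convex hull (S \<inter> S')"
    by (rule hull_mono) auto
  ultimately show "x \<in> convex hull (S \<inter> S')" by (rule rev_subsetD)
qed

lemma affine_functional_orient: "affine_functional (orient p q)"
  unfolding affine_functional_def
  by (rule exI[of _ "vector [- (q - p) $ 2, (q - p) $ 1]"], rule exI[of _ "- cross2 (q - p) p"])
    (simp add: orient_def cross2_def inner_vec_def sum_2 algebra_simps)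

lemma affine_functional_cross2: "affine_functional (cross2 u)"
  unfolding affine_functional_def
  by (rule exI[of _ "vector [- u $ 2, u $ 1]"], rule exI[of _ 0])
    (simp add: cross2_def inner_vec_def sum_2 algebra_simps)

lemma orient_rotate: "orient p q r = orient q r p"
  by (simp add: orient_def cross2_def algebra_simps)

lemma orient_swap: "orient q p r = - orient p q r"
  by (simp add: orient_def cross2_def algebra_simps)

lemma orient_same [simp]: "orient p q p = 0" "orient p q q = 0" "orient p p q = 0"
  by (simp_all add: orient_def cross2_def)

lemma orient_pos_distinct:
  assumes "orient p q r \<noteq> 0"
  shows "p \<noteq> q" "q \<noteq> r" "p \<noteq> r"
  using assms by auto

text \<open>The signed areas of the three triangles that \<open>x\<close> spans with the sides,
  divided by the whole area, are the barycentric coordinates.\<close>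

lemma in_triangle_if_orient:
  assumes "0 < orient p q r" "0 \<le> orient p q x" "0 \<le> orient q r x" "0 \<le> orient r p x"
  shows "x \<in> convex hull {p, q, r}"
proof -
  define d a b c where "d = orient p q r" and "a = orient q r x / d" and "b = orient r p x / d"
    and "c = orient p q x / d"
  have d: "0 < d" using assms d_def by simp
  have sum: "orient q r x + orient r p x + orient p q x = d"
    by (simp add: d_def orient_def cross2_def algebra_simps)
  have abc: "0 \<le> a" "0 \<le> b" "0 \<le> c" "a + b + c = 1"
    using assms d sum by (simp_all add: a_def b_def c_def flip: add_divide_distrib)
  have "d * x $ i = orient q r x * p $ i + orient r p x * q $ i + orient p q x * r $ i" for i
    using exhaust_2[of i] by (auto simp: d_def orient_def cross2_def algebra_simps)
  then have "x $ i = a * p $ i + b * q $ i + c * r $ i" for i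
    using d by (simp add: a_def b_def c_def field_simps)
  then have "x = a *\<^sub>R p + b *\<^sub>R q + c *\<^sub>R r"
    by (simp add: vec_eq_iff)
  with abc show ?thesis by (auto simp: convex_hull_3)
qed

lemma not_affine_dependent_if_orient:
  assumes "orient p q r \<noteq> 0"
  shows "\<not> affine_dependent {p, q, r}"
proof
  have *: "orient a b c = 0" if "c \<in> affine hull {a, b}" for a b c
  proof -
    from that obtain u v where uv: "c = u *\<^sub>R a + v *\<^sub>R b" "u + v = 1" by (auto simp: affine_hull_2)
    then have u: "u = 1 - v" by simp
    show ?thesis unfolding uv(1) u by (simp add: orient_def cross2_def algebra_simps)
  qed
  assume "affine_dependent {p, q, r}"
  then have "p \<in> affine hull ({p, q, r} - {p}) \<or> q \<in> affine hull ({p, q, r} - {q}) \<or>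
      r \<in> affine hull ({p, q, r} - {r})"
    unfolding affine_dependent_def by blast
  moreover have "{p, q, r} - {p} = {q, r}" "{p, q, r} - {q} = {r, p}" "{p, q, r} - {r} = {p, q}"
    using orient_pos_distinct[OF assms] by auto
  ultimately have "orient q r p = 0 \<or> orient r p q = 0 \<or> orient p q r = 0"
    using * by metis
  then show False using assms orient_rotate by metis
qed

section \<open>Polar coordinates and chords of circles\<close>

lemma polar_nth [simp]: "polar r t $ 1 = r * cos t" "polar r t $ 2 = r * sin t"
  by (simp_all add: polar_def)

lemma norm_polar [simp]: "norm (polar r t) = \<bar>r\<bar>"
proof -
  have "(norm (polar r t))\<^sup>2 = (r * cos t)\<^sup>2 + (r * sin t)\<^sup>2"
    unfolding power2_norm_eq_inner by (simp add: inner_vec_def sum_2 power2_eq_square)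
  also have "\<dots> = r\<^sup>2 * ((cos t)\<^sup>2 + (sin t)\<^sup>2)"
    by (simp only: power_mult_distrib distrib_left)
  finally have "(norm (polar r t))\<^sup>2 = \<bar>r\<bar>\<^sup>2" by simp
  then show ?thesis by (rule power2_eq_imp_eq) auto
qed

lemma inner_polar: "polar r a \<bullet> polar s b = r * s * cos (b - a)"
  by (simp add: inner_vec_def sum_2 cos_diff algebra_simps)

lemma cross2_polar: "cross2 (polar r a) (polar s b) = r * s * sin (b - a)"
  by (simp add: cross2_def sin_diff algebra_simps)

lemma orient_polar:
  "orient (polar r a) (polar s b) (polar t c) =
     r * s * sin (b - a) + s * t * sin (c - b) + t * r * sin (a - c)"
  by (simp add: orient_def cross2_def sin_diff algebra_simps)

lemma polar_periodic [simp]: "polar r (t + 2 * pi) = polar r t"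
  by (simp add: polar_def)

lemma polar_periodic_int [simp]: "polar r (t + of_int k * (2 * pi)) = polar r t"
  using sin_add[of t "of_int k * (2 * pi)"] cos_add[of t "of_int k * (2 * pi)"]
    sin_integer_2pi[of "of_int k"] cos_integer_2pi[of "of_int k"]
  by (simp add: polar_def mult_ac)

lemma polar_eq_iff:
  assumes "0 < r" "0 \<le> s"
  shows "polar r a = polar s b \<longleftrightarrow> r = s \<and> (\<exists>k::int. a = b + of_int k * (2 * pi))"
proof
  assume eq: "polar r a = polar s b"
  then have "norm (polar r a) = norm (polar s b)" by simp
  then have rs: "r = s" using assms by simp
  have "cos a = cos b" "sin a = sin b"
    using eq assms rs by (metis polar_nth mult_cancel_left less_irrefl)+
  then have "\<exists>k::int. a = b + 2 * pi * of_int k"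
    using sin_cos_eq_iff by metis
  with rs show "r = s \<and> (\<exists>k::int. a = b + of_int k * (2 * pi))" by (simp add: mult.commute)
qed auto

lemma polar_exists: "\<exists>t. a \<le> t \<and> t < a + 2 * pi \<and> x = polar (norm x) t"
proof (cases "x = 0")
  case True
  then show ?thesis
    by (intro exI[of _ a]) (simp add: polar_def vec_eq_iff forall_2)
next
  case False
  define n where "n = norm x"
  have n: "0 < n" "n\<^sup>2 = (x $ 1)\<^sup>2 + (x $ 2)\<^sup>2"
    using False unfolding n_def power2_norm_eq_inner
    by (simp_all add: inner_vec_def sum_2 power2_eq_square)
  have "(x $ 1 / n)\<^sup>2 + (x $ 2 / n)\<^sup>2 = 1"
    using n by (simp add: power_divide n(2)[symmetric] flip: add_divide_distrib)
  then obtain t where t: "x $ 1 / n = cos t" "x $ 2 / n = sin t"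
    using sincos_total_2pi by metis
  \<comment> \<open>The number of full turns to remove so that the angle falls into the window
    starting at \<open>a\<close>.\<close>
  define k where "k = \<lfloor>(t - a) / (2 * pi)\<rfloor>"
  define s where "s = t + of_int (- k) * (2 * pi)"
  have "of_int k \<le> (t - a) / (2 * pi)" "(t - a) / (2 * pi) < of_int k + 1"
    unfolding k_def by linarith+
  then have "a \<le> s" "s < a + 2 * pi"
    by (simp_all add: s_def field_simps)
  moreover have "x = polar n s"
    unfolding s_def polar_periodic_int using t n by (simp add: vec_eq_iff forall_2 field_simps)
  ultimately show ?thesis unfolding n_def by blast
qed

lemma sin_add_le:
  assumes "0 \<le> x" "0 \<le> y" "x + y \<le> pi"
  shows "sin (x + y) \<le> sin x + sin (y::real)"
proof -
  have "0 \<le> sin x" "0 \<le> sin y" using assms by (auto intro: sin_ge_zero)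
  then have "sin x * cos y \<le> sin x * 1" "cos x * sin y \<le> 1 * sin y"
    by (intro mult_left_mono mult_right_mono; simp)+
  then show ?thesis by (simp add: sin_add)
qed

text \<open>In a fixed direction the signed area is affine in \<open>r\<close>. At the centre it
  belongs to an isosceles triangle, at \<open>r = R\<close> to an inscribed one, where it is a
  product of sines of half arcs. Both values are nonnegative when \<open>a\<close> lies on the
  complementary arc.\<close>

lemma orient_chord_disc:
  assumes "0 < R" "0 \<le> r" "r \<le> R" "b < c" "c - b < pi" "c \<le> a" "a \<le> b + 2 * pi"
  shows "0 \<le> orient (polar R b) (polar R c) (polar r a)"
    and "r < R \<or> (c < a \<and> a < b + 2 * pi) \<Longrightarrow> 0 < orient (polar R b) (polar R c) (polar r a)"
proof -
  let ?p = "(c - b) / 2" and ?q = "(a - c) / 2"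
  define D where "D = 4 * sin ?p * sin ?q * sin (?p + ?q)"
  have "sin (2 * ?p) + sin (2 * ?q) - sin (2 * (?p + ?q)) = 4 * sin ?p * sin ?q * sin (?p + ?q)" (is "?L = ?R")
  proof -
    have "?L = 2 * sin ?p * cos ?p + 2 * sin ?q * cos ?q - 2 * sin (?p + ?q) * cos (?p + ?q)"
      by (simp only: sin_double)
    also have "\<dots> = 2 * sin ?p * cos ?p * (1 - (cos ?q)\<^sup>2 + (sin ?q)\<^sup>2) + 2 * sin ?q * cos ?q * (1 - (cos ?p)\<^sup>2 + (sin ?p)\<^sup>2)"
      by (simp add: sin_add cos_add algebra_simps power2_eq_square)
    also have "\<dots> = 4 * sin ?p * sin ?q * (sin ?p * cos ?q + cos ?p * sin ?q)"
      unfolding cos_squared_eq by (simp add: algebra_simps power2_eq_square)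
    also have "\<dots> = ?R" by (simp add: sin_add)
    finally show ?thesis .
  qed
  moreover have "2 * ?p = c - b" "2 * ?q = a - c" "2 * (?p + ?q) = a - b" by (simp_all add: field_simps)
  ultimately have D: "sin (c - b) + sin (a - c) - sin (a - b) = D" by (simp only: D_def)
  have "orient (polar R b) (polar R c) (polar r a) = R * R * sin (c - b) + R * r * (sin (a - c) - sin (a - b))"
    using sin_minus[of "a - b"] by (simp add: orient_polar algebra_simps)
  also have "\<dots> = R * ((R - r) * sin (c - b) + r * D)"
    unfolding D[symmetric] by (simp add: algebra_simps)
  finally have eq: "orient (polar R b) (polar R c) (polar r a) = R * ((R - r) * sin (c - b) + r * D)" .
  have s: "0 < sin (c - b)" using assms by (intro sin_gt_zero) auto
  have pq: "?p + ?q = (a - b) / 2" by (simp add: field_simps)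
  have p: "0 < sin ?p" using assms by (intro sin_gt_zero) auto
  have "0 \<le> sin ?q" using assms pi_gt_zero by (intro sin_ge_zero) auto
  moreover have "0 \<le> sin (?p + ?q)" unfolding pq using assms by (intro sin_ge_zero) auto
  ultimately have D0: "0 \<le> D" using p by (simp add: D_def)
  show "0 \<le> orient (polar R b) (polar R c) (polar r a)"
    unfolding eq using assms s D0 by simp
  assume "r < R \<or> (c < a \<and> a < b + 2 * pi)"
  then show "0 < orient (polar R b) (polar R c) (polar r a)"
  proof
    assume "r < R"
    then have "0 < (R - r) * sin (c - b) + r * D" using s D0 assms by (intro add_pos_nonneg) auto
    then show ?thesis unfolding eq using assms by simp
  next
    assume a: "c < a \<and> a < b + 2 * pi"
    have "0 < sin ?q" using a assms by (intro sin_gt_zero) auto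
    moreover have "0 < sin (?p + ?q)" unfolding pq using a assms by (intro sin_gt_zero) auto
    ultimately have "0 < D" using p by (simp add: D_def)
    then have "0 < (R - r) * sin (c - b) + r * D"
      using assms s by (cases "r = R") (auto intro: add_pos_nonneg)
    then show ?thesis unfolding eq using assms by simp
  qed
qed

text \<open>The chord meets the ray in direction \<open>c\<close> at radius at most
  \<open>r\<close>; in terms of sines this is the subadditivity of \<open>sin\<close> on
  \<open>[0, pi]\<close>.\<close>

lemma orient_chord_beyond:
  assumes "0 < r" "r < R" "a < b" "b - a < pi" "a \<le> c" "c \<le> b"
  shows "orient (polar r a) (polar r b) (polar R c) < 0"
proof -
  have s: "0 < sin (b - a)" using assms by (intro sin_gt_zero) auto
  have "sin ((b - c) + (c - a)) \<le> sin (b - c) + sin (c - a)"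
    using assms by (intro sin_add_le) auto
  then have le: "sin (b - a) \<le> sin (b - c) + sin (c - a)" by simp
  have eq: "orient (polar r a) (polar r b) (polar R c) = r * (r * sin (b - a) - R * (sin (b - c) + sin (c - a)))"
    using sin_minus[of "b - c"] sin_minus[of "c - a"] by (simp add: orient_polar algebra_simps)
  have "r * sin (b - a) < R * sin (b - a)" using assms s by simp
  moreover have "R * sin (b - a) \<le> R * (sin (b - c) + sin (c - a))"
    using le assms by (intro mult_left_mono) auto
  ultimately have "r * sin (b - a) - R * (sin (b - c) + sin (c - a)) < 0" by linarith
  with eq show ?thesis using assms by (simp only: mult_pos_neg)
qed

text \<open>A sector of opening less than \<open>pi\<close> is an intersection of two half-planes,
  and the two functionals that define them are nonnegative on \<open>S\<close>.\<close>

lemma hull_in_sector: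
  assumes "finite S" "a < b" "b - a < pi"
    and S: "\<And>y. y \<in> S \<Longrightarrow> \<exists>r t. 0 \<le> r \<and> a \<le> t \<and> t \<le> b \<and> y = polar r t"
    and x: "x \<in> convex hull S"
  shows "\<exists>t. a \<le> t \<and> t \<le> b \<and> x = polar (norm x) t"
proof (cases "x = 0")
  case True
  then show ?thesis using assms(2)
    by (intro exI[of _ a]) (simp add: polar_def vec_eq_iff forall_2)
next
  case False
  have "0 \<le> cross2 (polar 1 a) x"
  proof (rule affine_functional_hull_nonneg[OF affine_functional_cross2 assms(1) _ x])
    fix y assume "y \<in> S"
    then obtain r t where "0 \<le> r" "a \<le> t" "t \<le> b" "y = polar r t" using S by blast
    then show "0 \<le> cross2 (polar 1 a) y"
      using assms by (auto simp: cross2_polar intro!: mult_nonneg_nonneg sin_ge_zero)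
  qed
  moreover have "0 \<le> - cross2 (polar 1 b) x"
  proof (rule affine_functional_hull_nonneg[OF affine_functional_uminus[OF affine_functional_cross2] assms(1) _ x])
    fix y assume "y \<in> S"
    then obtain r t where "0 \<le> r" "a \<le> t" "t \<le> b" "y = polar r t" using S by blast
    moreover from this have "0 \<le> sin (b - t)" using assms by (intro sin_ge_zero) auto
    ultimately show "0 \<le> - cross2 (polar 1 b) y"
      using sin_minus[of "b - t"] by (simp add: cross2_polar)
  qed
  moreover obtain t where t: "a \<le> t" "t < a + 2 * pi" "x = polar (norm x) t"
    using polar_exists by blast
  moreover have n: "0 < norm x" using False by simp
  ultimately have s: "0 \<le> sin (t - a)" "sin (t - b) \<le> 0"
    by (metis cross2_polar mult_1 zero_le_mult_iff not_le,
        metis cross2_polar mult_1 neg_0_le_iff_le mult_le_0_iff not_le)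
  have "t - a \<le> pi"
  proof (rule ccontr)
    assume "\<not> t - a \<le> pi"
    then have "sin (t - a) < 0" using t by (intro sin_lt_zero) auto
    with s show False by simp
  qed
  have "t \<le> b"
  proof (rule ccontr)
    assume "\<not> t \<le> b"
    then have "0 < sin (t - b)" using \<open>t - a \<le> pi\<close> assms by (intro sin_gt_zero) auto
    with s show False by simp
  qed
  with t show ?thesis by blast
qed

section \<open>Concentric rings\<close>

lemma strict_mono_intI:
  fixes f :: "int \<Rightarrow> 'a::order"
  assumes "\<And>i. f i < f (i + 1)"
  shows "strict_mono f"
proof (rule strict_monoI)
  fix i j :: int assume "i < j"
  then have "i + 1 \<le> j" by simp
  then show "f i < f j"
  proof (induction j rule: int_ge_induct)
    case base
    show ?case by (rule assms)
  next
    case (step j)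
    then show ?case using assms[of j] by (metis less_trans)
  qed
qed

lemma int_bracket:
  fixes f :: "int \<Rightarrow> 'a::linorder"
  assumes "f a \<le> x" "x < f b" "strict_mono f"
  obtains i where "f i \<le> x" "x < f (i + 1)"
proof -
  have "\<exists>i. f i \<le> x \<and> x < f (i + 1)"
  proof (rule ccontr)
    assume "\<nexists>i. f i \<le> x \<and> x < f (i + 1)"
    then have step: "f i \<le> x \<Longrightarrow> f (i + 1) \<le> x" for i by (meson not_le)
    have "a < b" using assms by (meson le_less_trans strict_mono_less)
    then have "a \<le> b" by simp
    then have "f b \<le> x"
      by (induction b rule: int_ge_induct) (use assms(1) step in auto)
    with assms(2) show False by simp
  qed
  with that show thesis by blast
qed

text \<open>The vertices of ring \<open>n\<close> are indexed by all integers with period \<open>N n\<close>. Vertex \<open>\<tau> n i\<close> of ring \<open>n + 1\<close> is the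
  one joined to both ends \<open>i\<close> and \<open>i + 1\<close> of a gap of ring \<open>n\<close>, so vertex \<open>i\<close> is joined to the
  vertices \<open>\<tau> n (i - 1), \<dots>, \<tau> n i\<close>.\<close>

locale radial_rings =
  fixes pos :: "'v \<Rightarrow> real^2" and center :: 'v and V :: "nat \<Rightarrow> int \<Rightarrow> 'v"
    and N :: "nat \<Rightarrow> int" and \<tau> :: "nat \<Rightarrow> int \<Rightarrow> int"
    and \<theta> :: "nat \<Rightarrow> int \<Rightarrow> real" and R :: "nat \<Rightarrow> real"
  assumes inj_pos: "inj pos"
    and pos_center: "pos center = 0"
    and pos_V: "pos (V n i) = polar (R n) (\<theta> n i)"
    and R_pos: "0 < R n"
    and R_mono: "strict_mono R"
    and theta_step: "\<theta> n i < \<theta> n (i + 1)"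
    and gap_small: "\<theta> n (i + 1) - \<theta> n i < pi / 2"
    and theta_period: "\<theta> n (i + N n) = \<theta> n i + 2 * pi"
    and tau_step: "\<tau> n i < \<tau> n (i + 1)"
    and tau_period: "\<tau> n (i + N n) = \<tau> n i + N (Suc n)"
    and tau_between: "\<theta> n i \<le> \<theta> (Suc n) (\<tau> n i)" "\<theta> (Suc n) (\<tau> n i) \<le> \<theta> n (i + 1)"
    and theta_nested: "\<exists>j. \<theta> (Suc n) j = \<theta> n i"
    and R_exhaust: "\<forall>\<^sub>F n in sequentially. \<forall>i. R m \<le> R n * cos (\<theta> n (i + 1) - \<theta> n i)"
begin

abbreviation "P n i \<equiv> polar (R n) (\<theta> n i)"

lemma gap_less_pi: "\<theta> n (i + 1) - \<theta> n i < pi"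
  using gap_small[of n i] pi_gt_zero by linarith

lemma theta_strict_mono: "strict_mono (\<theta> n)"
  by (rule strict_mono_intI) (rule theta_step)

lemma theta_less_iff [simp]: "\<theta> n i < \<theta> n j \<longleftrightarrow> i < j"
  by (rule strict_mono_less[OF theta_strict_mono])

lemma theta_le_iff [simp]: "\<theta> n i \<le> \<theta> n j \<longleftrightarrow> i \<le> j"
  by (rule strict_mono_less_eq[OF theta_strict_mono])

lemma theta_eq_iff [simp]: "\<theta> n i = \<theta> n j \<longleftrightarrow> i = j"
  by (rule strict_mono_eq[OF theta_strict_mono])

lemma tau_strict_mono: "strict_mono (\<tau> n)"
  by (rule strict_mono_intI) (rule tau_step)

lemma tau_less_iff [simp]: "\<tau> n i < \<tau> n j \<longleftrightarrow> i < j"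
  by (rule strict_mono_less[OF tau_strict_mono])

lemma tau_le_iff [simp]: "\<tau> n i \<le> \<tau> n j \<longleftrightarrow> i \<le> j"
  by (rule strict_mono_less_eq[OF tau_strict_mono])

lemma R_less_iff [simp]: "R m < R n \<longleftrightarrow> m < n"
  by (rule strict_mono_less[OF R_mono])

lemma R_le_iff [simp]: "R m \<le> R n \<longleftrightarrow> m \<le> n"
  by (rule strict_mono_less_eq[OF R_mono])

lemma R_eq_iff [simp]: "R m = R n \<longleftrightarrow> m = n"
  by (rule strict_mono_eq[OF R_mono])

lemma N_pos: "0 < N n"
proof -
  have "\<theta> n 0 < \<theta> n (0 + N n)" unfolding theta_period by simp
  then show ?thesis by simp
qed

lemma int_period:
  fixes f :: "int \<Rightarrow> 'b::comm_ring_1"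
  assumes "\<And>i. f (i + M) = f i + d"
  shows "f (i + l * M) = f i + of_int l * d"
proof (induction l rule: int_induct[where k = 0])
  case base
  show ?case by simp
next
  case (step1 l)
  have "f (i + (l + 1) * M) = f (i + l * M) + d"
    using assms[of "i + l * M"] by (simp add: algebra_simps)
  with step1 show ?case by (simp add: algebra_simps)
next
  case (step2 l)
  have "f (i + l * M) = f (i + (l - 1) * M) + d"
    using assms[of "i + (l - 1) * M"] by (simp add: algebra_simps)
  with step2 show ?case by (simp add: algebra_simps)
qed

lemma theta_periods: "\<theta> n (i + l * N n) = \<theta> n i + of_int l * (2 * pi)"
  by (rule int_period) (rule theta_period)

lemma tau_periods: "\<tau> n (i + l * N n) = \<tau> n i + l * N (Suc n)"
  using int_period[of "\<tau> n" "N n" "N (Suc n)" i l] tau_period by simp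

lemma P_periods: "P n (i + l * N n) = P n i"
  by (simp only: theta_periods polar_periodic_int)

lemma V_periods: "V n (i + l * N n) = V n i"
  using inj_pos by (rule injD) (simp only: pos_V P_periods)

lemma P_eq_iff: "P m i = P n j \<longleftrightarrow> m = n \<and> (\<exists>l. i = j + l * N n)"
proof
  assume "P m i = P n j"
  then obtain l where "R m = R n" "\<theta> m i = \<theta> n j + of_int l * (2 * pi)"
    using polar_eq_iff[OF R_pos less_imp_le[OF R_pos]] by blast
  then have "m = n" "\<theta> n i = \<theta> n (j + l * N n)"
    by (simp_all add: theta_periods)
  then show "m = n \<and> (\<exists>l. i = j + l * N n)" by auto
qed (auto simp only: P_periods)

lemma V_eq_iff: "V m i = V n j \<longleftrightarrow> m = n \<and> (\<exists>l. i = j + l * N n)"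
  using inj_eq[OF inj_pos, of "V m i" "V n j"] by (simp add: pos_V P_eq_iff)

text \<open>Indices name vertices only up to whole periods, and a period is a full turn. Distinct
  vertices are told apart by this test below.\<close>

lemma V_near_eq: "V n i = V n j \<Longrightarrow> \<bar>\<theta> n i - \<theta> n j\<bar> < 2 * pi \<Longrightarrow> i = j"
proof -
  assume "V n i = V n j" and d: "\<bar>\<theta> n i - \<theta> n j\<bar> < 2 * pi"
  then obtain l where l: "i = j + l * N n" by (auto simp: V_eq_iff)
  have "\<bar>of_int l * (2 * pi)\<bar> < 2 * pi" using d unfolding l theta_periods by simp
  then have "\<bar>of_int l\<bar> * (2 * pi) < 1 * (2 * pi)" by (simp add: abs_mult)
  then have "\<bar>of_int l :: real\<bar> < 1" by (rule mult_right_less_imp_less) simp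
  then have "l = 0" by linarith
  with l show ?thesis by simp
qed

lemma center_neq_V [simp]: "center \<noteq> V n i" "V n i \<noteq> center"
proof -
  have "norm (pos center) \<noteq> norm (pos (V n i))"
    using R_pos[of n] by (simp add: pos_center pos_V)
  then show "center \<noteq> V n i" "V n i \<noteq> center" by auto
qed

lemma theta_bracket: obtains i where "\<theta> n i \<le> x" "x < \<theta> n (i + 1)"
proof -
  define a where "a = \<lfloor>(x - \<theta> n 0) / (2 * pi)\<rfloor>"
  have "of_int a \<le> (x - \<theta> n 0) / (2 * pi)" "(x - \<theta> n 0) / (2 * pi) < of_int (a + 1)"
    unfolding a_def by linarith+
  then have "\<theta> n (0 + a * N n) \<le> x" "x < \<theta> n (0 + (a + 1) * N n)"
    unfolding theta_periods by (simp_all add: field_simps)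
  then show thesis using int_bracket[OF _ _ theta_strict_mono] that by blast
qed

lemma index_shift: obtains l where "i \<le> j + l * N n" "j + l * N n < i + N n"
proof
  define l where "l = - ((j - i) div N n)"
  have "j + l * N n = i + (j - i) mod N n"
    using div_mult_mod_eq[of "j - i" "N n"] by (simp add: l_def algebra_simps)
  then show "i \<le> j + l * N n" "j + l * N n < i + N n"
    using pos_mod_bound[OF N_pos, of "j - i"] pos_mod_sign[OF N_pos, of "j - i"] by auto
qed

lemma theta_nested_le: "m \<le> n \<Longrightarrow> \<exists>l. \<theta> n l = \<theta> m j"
proof (induction n rule: dec_induct)
  case base
  show ?case by blast
next
  case (step n)
  then show ?case using theta_nested by metis
qed

text \<open>By nesting, the direction of an older vertex also occurs in ring \<open>n\<close>. No
  direction of ring \<open>n\<close> falls strictly inside a gap, so it lies on the complementary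
  arc, where \<open>orient_chord_disc\<close> applies.\<close>

lemma chord_inner:
  assumes "m \<le> n"
  shows "0 \<le> orient (P n i) (P n (i + 1)) (P m j)"
    and "P m j \<noteq> P n i \<Longrightarrow> P m j \<noteq> P n (i + 1) \<Longrightarrow> 0 < orient (P n i) (P n (i + 1)) (P m j)"
proof -
  obtain l where l: "\<theta> n l = \<theta> m j" using theta_nested_le[OF assms] by blast
  \<comment> \<open>Whole turns move the direction to an index from \<open>i + 1\<close> to
    \<open>i + N n\<close>, the closed complementary arc.\<close>
  obtain q where q: "i + 1 \<le> l + q * N n" "l + q * N n < i + 1 + N n"
    by (rule index_shift)
  define a where "a = l + q * N n"
  have a: "i + 1 \<le> a" "a \<le> i + N n" using q by (auto simp: a_def)
  have Pa: "P m j = polar (R m) (\<theta> n a)"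
    unfolding a_def theta_periods polar_periodic_int l ..
  have gap: "\<theta> n (i + 1) - \<theta> n i < pi" by (rule gap_less_pi)
  have ub: "\<theta> n a \<le> \<theta> n i + 2 * pi" using a by (simp flip: theta_period)
  note disc = orient_chord_disc[OF R_pos less_imp_le[OF R_pos] _ theta_step gap _ ub, of m]
  show "0 \<le> orient (P n i) (P n (i + 1)) (P m j)"
    unfolding Pa using disc(1) assms a by simp
  assume neq: "P m j \<noteq> P n i" "P m j \<noteq> P n (i + 1)"
  have "R m < R n \<or> (\<theta> n (i + 1) < \<theta> n a \<and> \<theta> n a < \<theta> n i + 2 * pi)"
  proof (cases "m = n")
    case True
    then have "a \<noteq> i + 1" "a \<noteq> i + N n"
      using neq Pa P_periods[of n i 1] by auto
    then show ?thesis using a by (simp flip: theta_period)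
  qed (use assms in simp)
  then show "0 < orient (P n i) (P n (i + 1)) (P m j)"
    unfolding Pa using disc(2) assms a by simp
qed

lemma chord_center: "0 < orient (P n i) (P n (i + 1)) 0"
proof -
  have "0 < sin (\<theta> n (i + 1) - \<theta> n i)"
    by (rule sin_gt_zero) (use theta_step[of n i] gap_less_pi[of n i] in auto)
  moreover have "orient (P n i) (P n (i + 1)) 0 = R n * R n * sin (\<theta> n (i + 1) - \<theta> n i)"
    by (simp add: orient_def cross2_def sin_diff algebra_simps)
  ultimately show ?thesis using R_pos[of n] by simp
qed

section \<open>Triangles between consecutive rings\<close>

definition central :: "int \<Rightarrow> 'v set" where
  "central i = {center, V 0 i, V 0 (i + 1)}"

definition base_on :: "nat \<Rightarrow> int \<Rightarrow> 'v set" where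
  "base_on n i = {V n i, V n (i + 1), V (Suc n) (\<tau> n i)}"

definition tip_on :: "nat \<Rightarrow> int \<Rightarrow> int \<Rightarrow> 'v set" where
  "tip_on n i j = {V n i, V (Suc n) j, V (Suc n) (j + 1)}"

text \<open>The triangles between the rings \<open>n\<close> and \<open>n + 1\<close> in the sector of the \<open>i\<close>-th gap of ring \<open>n\<close>.\<close>

definition cell :: "nat \<Rightarrow> int \<Rightarrow> 'v set set" where
  "cell n i = insert (base_on n i)
     ({tip_on n i j | j. \<theta> n i \<le> \<theta> (Suc n) j \<and> j < \<tau> n i} \<union>
      {tip_on n (i + 1) j | j. \<tau> n i \<le> j \<and> \<theta> (Suc n) (j + 1) \<le> \<theta> n (i + 1)})"

definition T :: "'v set set" where
  "T = range central \<union> (\<Union>n. \<Union>i. cell n i)"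

lemma cell_cases [consumes 1, case_names base left right]:
  assumes "t \<in> cell n i"
  obtains "t = base_on n i"
  | j where "t = tip_on n i j" "\<theta> n i \<le> \<theta> (Suc n) j" "j < \<tau> n i"
  | j where "t = tip_on n (i + 1) j" "\<tau> n i \<le> j" "\<theta> (Suc n) (j + 1) \<le> \<theta> n (i + 1)"
  using assms unfolding cell_def by blast

lemma cell_vertex:
  assumes "t \<in> cell n i" "v \<in> t"
  shows "v = V n i \<or> v = V n (i + 1) \<or> (\<exists>j. v = V (Suc n) j \<and> \<theta> n i \<le> \<theta> (Suc n) j \<and> \<theta> (Suc n) j \<le> \<theta> n (i + 1))"
  using assms(1)
proof (cases rule: cell_cases)
  case base
  then show ?thesis using assms(2) tau_between by (auto simp: base_on_def)
next
  case (left j)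
  have "\<theta> (Suc n) (j + 1) \<le> \<theta> (Suc n) (\<tau> n i)" "\<theta> (Suc n) j \<le> \<theta> (Suc n) (\<tau> n i)"
      "\<theta> (Suc n) j \<le> \<theta> (Suc n) (j + 1)"
    using left by simp_all
  then have "\<theta> (Suc n) (j + 1) \<le> \<theta> n (i + 1)" "\<theta> (Suc n) j \<le> \<theta> n (i + 1)" "\<theta> n i \<le> \<theta> (Suc n) (j + 1)"
    using tau_between(2)[of n i] left by linarith+
  then show ?thesis using assms(2) left by (auto simp: tip_on_def)
next
  case (right j)
  have "\<theta> (Suc n) (\<tau> n i) \<le> \<theta> (Suc n) j" "\<theta> (Suc n) j \<le> \<theta> (Suc n) (j + 1)"
    using right by simp_all
  then have "\<theta> n i \<le> \<theta> (Suc n) j" "\<theta> n i \<le> \<theta> (Suc n) (j + 1)" "\<theta> (Suc n) j \<le> \<theta> n (i + 1)"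
    using tau_between(1)[of n i] right by linarith+
  then show ?thesis using assms(2) right by (auto simp: tip_on_def)
qed

lemma cell_point:
  assumes "t \<in> cell n i" "y \<in> pos ` t"
  shows "y = P n i \<or> y = P n (i + 1) \<or> (\<exists>j. y = P (Suc n) j \<and> \<theta> n i \<le> \<theta> (Suc n) j \<and> \<theta> (Suc n) j \<le> \<theta> n (i + 1))"
  using assms cell_vertex pos_V by (metis (no_types, lifting) imageE)

lemma cell_finite: "t \<in> cell n i \<Longrightarrow> finite t"
  by (cases rule: cell_cases) (auto simp: base_on_def tip_on_def)

lemma cell_periods:
  assumes "t \<in> cell n i"
  shows "t \<in> cell n (i + l * N n)"
proof -
  have V1: "V n (i + l * N n + 1) = V n (i + 1)" and th1: "\<theta> n (i + l * N n + 1) = \<theta> n (i + 1) + of_int l * (2 * pi)"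
    using V_periods[of n "i + 1" l] theta_periods[of n "i + 1" l] by (simp_all add: algebra_simps)
  have V2: "V (Suc n) (j + l * N (Suc n) + 1) = V (Suc n) (j + 1)"
    and th2: "\<theta> (Suc n) (j + l * N (Suc n) + 1) = \<theta> (Suc n) (j + 1) + of_int l * (2 * pi)" for j
    using V_periods[of "Suc n" "j + 1" l] theta_periods[of "Suc n" "j + 1" l] by (simp_all add: algebra_simps)
  have tip: "tip_on n (i + l * N n) (j + l * N (Suc n)) = tip_on n i j"
      "tip_on n (i + l * N n + 1) (j + l * N (Suc n)) = tip_on n (i + 1) j" for j
    by (simp_all only: tip_on_def V1 V2 V_periods)
  from assms show ?thesis
  proof (cases rule: cell_cases)
    case base
    have "base_on n (i + l * N n) = base_on n i"
      by (simp only: base_on_def V_periods V1 tau_periods)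
    then show ?thesis unfolding base cell_def by auto
  next
    case (left j)
    have "\<theta> n (i + l * N n) \<le> \<theta> (Suc n) (j + l * N (Suc n))" "j + l * N (Suc n) < \<tau> n (i + l * N n)"
      using left unfolding theta_periods tau_periods by simp_all
    then show ?thesis unfolding left(1) cell_def tip(1)[symmetric] by blast
  next
    case (right j)
    have "\<theta> (Suc n) (j + l * N (Suc n) + 1) \<le> \<theta> n (i + l * N n + 1)" "\<tau> n (i + l * N n) \<le> j + l * N (Suc n)"
      using right unfolding th1 th2 tau_periods by simp_all
    then show ?thesis unfolding right(1) cell_def tip(2)[symmetric] by blast
  qed
qed

text \<open>Apart from the two ends of the chord, the vertices of a cell lie on the next circle
  within the sector of the gap, hence strictly beyond the chord.\<close>

lemma chord_outer:
  assumes "t \<in> cell n i" "y \<in> pos ` t"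
  shows "orient (P n i) (P n (i + 1)) y \<le> 0"
    and "orient (P n i) (P n (i + 1)) y = 0 \<Longrightarrow> y = P n i \<or> y = P n (i + 1)"
proof -
  have "y = P n i \<or> y = P n (i + 1) \<or> orient (P n i) (P n (i + 1)) y < 0"
    using cell_point[OF assms]
  proof (elim disjE exE conjE)
    fix j assume "y = P (Suc n) j" "\<theta> n i \<le> \<theta> (Suc n) j" "\<theta> (Suc n) j \<le> \<theta> n (i + 1)"
    moreover have "\<theta> n (i + 1) - \<theta> n i < pi" by (rule gap_less_pi)
    ultimately have "orient (P n i) (P n (i + 1)) y < 0"
      using orient_chord_beyond[of "R n" "R (Suc n)" "\<theta> n i" "\<theta> n (i + 1)" "\<theta> (Suc n) j"] R_pos by simp
    then show ?thesis by blast
  qed auto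
  then show "orient (P n i) (P n (i + 1)) y \<le> 0"
    and "orient (P n i) (P n (i + 1)) y = 0 \<Longrightarrow> y = P n i \<or> y = P n (i + 1)"
    by auto
qed

lemma fan_orient:
  assumes "\<theta> n i \<le> \<theta> (Suc n) l" "l < l'" "\<theta> (Suc n) l' \<le> \<theta> n (i + 1)"
  shows "0 < orient (P n i) (P (Suc n) l) (P (Suc n) l')"
    and "0 < orient (P n (i + 1)) (P (Suc n) l) (P (Suc n) l')"
proof -
  have gap: "\<theta> n (i + 1) - \<theta> n i < pi" by (rule gap_less_pi)
  have ll: "\<theta> (Suc n) l < \<theta> (Suc n) l'" using assms by simp
  have *: "\<theta> (Suc n) l' - \<theta> (Suc n) l < pi" using assms gap by linarith
  \<comment> \<open>A full turn is added because \<open>orient_chord_disc\<close> expects the third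
    angle after the end of the chord.\<close>
  have "\<theta> (Suc n) l' \<le> \<theta> n i + 2 * pi" using assms gap pi_gt_zero by linarith
  with assms have "0 < orient (P (Suc n) l) (P (Suc n) l') (polar (R n) (\<theta> n i + 2 * pi))"
    by (intro orient_chord_disc(2)[OF R_pos less_imp_le[OF R_pos] _ ll *]) auto
  then show "0 < orient (P n i) (P (Suc n) l) (P (Suc n) l')"
    by (simp add: orient_rotate[of "P n i"])
  have "\<theta> n (i + 1) \<le> \<theta> (Suc n) l + 2 * pi" using assms gap pi_gt_zero by linarith
  with assms have "0 < orient (P (Suc n) l) (P (Suc n) l') (polar (R n) (\<theta> n (i + 1)))"
    by (intro orient_chord_disc(2)[OF R_pos less_imp_le[OF R_pos] _ ll *]) auto
  then show "0 < orient (P n (i + 1)) (P (Suc n) l) (P (Suc n) l')"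
    by (simp add: orient_rotate[of "P n (i + 1)"])
qed

lemma base_orient:
  assumes "\<theta> n i \<le> \<theta> (Suc n) l" "\<theta> (Suc n) l \<le> \<theta> n (i + 1)"
  shows "0 < orient (P n i) (P (Suc n) l) (P n (i + 1))"
    and "orient (P n (i + 1)) (P (Suc n) l) (P n i) < 0"
proof -
  have "\<theta> n (i + 1) - \<theta> n i < pi" by (rule gap_less_pi)
  then have "orient (P n i) (P n (i + 1)) (P (Suc n) l) < 0"
    using orient_chord_beyond[of "R n" "R (Suc n)" "\<theta> n i" "\<theta> n (i + 1)" "\<theta> (Suc n) l"] R_pos assms by simp
  then show "orient (P n (i + 1)) (P (Suc n) l) (P n i) < 0"
    by (simp add: orient_rotate[of "P n i" "P n (i + 1)"])
  then show "0 < orient (P n i) (P (Suc n) l) (P n (i + 1))"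
    using orient_swap[of "P n (i + 1)" "P n i" "P (Suc n) l"] orient_rotate by (metis neg_less_0_iff_less minus_minus)
qed

lemma pos_base_on: "pos ` base_on n i = {P n i, P n (i + 1), P (Suc n) (\<tau> n i)}"
  by (simp add: base_on_def pos_V)

lemma pos_tip_on: "pos ` tip_on n i j = {P n i, P (Suc n) j, P (Suc n) (j + 1)}"
  by (simp add: tip_on_def pos_V)

lemma pos_central: "pos ` central i = {0, P 0 i, P 0 (i + 1)}"
  by (simp add: central_def pos_V pos_center)

section \<open>Triangles meet in common faces\<close>

definition meet_properly :: "(real^2) set \<Rightarrow> (real^2) set \<Rightarrow> bool" where
  "meet_properly S S' \<longleftrightarrow> convex hull S \<inter> convex hull S' \<subseteq> convex hull (S \<inter> S')"

lemma meet_properly_sym: "meet_properly S S' \<Longrightarrow> meet_properly S' S"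
  by (simp add: meet_properly_def Int_commute)

lemma meet_properly_refl: "meet_properly S S"
  by (simp add: meet_properly_def)

lemma meet_properly_orient:
  assumes "finite S" "finite S'" "\<And>y. y \<in> S \<Longrightarrow> y = p \<or> y = q \<or> orient p q y < 0"
    "\<And>y. y \<in> S' \<Longrightarrow> y = p \<or> y = q \<or> 0 < orient p q y"
  shows "meet_properly S S'"
  unfolding meet_properly_def
proof (rule hull_Int_separated[OF affine_functional_orient[of p q] assms(1,2), of p q])
  show "orient p q y \<le> 0" if "y \<in> S" for y using assms(3)[OF that] by auto
  show "0 \<le> orient p q y" if "y \<in> S'" for y using assms(4)[OF that] by auto
  show "y = p \<or> y = q" if "y \<in> S \<union> S'" "orient p q y = 0" for y
    using assms(3,4)[of y] that by auto
qed

text \<open>The chord of the gap separates a cell from everything spanned by the centre and the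
  rings up to \<open>n\<close>, so triangles of different layers need no closer comparison.\<close>

lemma meet_outer_inner:
  assumes t: "t \<in> cell n i" and "finite S"
    and S: "\<And>y. y \<in> S \<Longrightarrow> y = 0 \<or> (\<exists>m\<le>n. \<exists>j. y = P m j)"
  shows "meet_properly (pos ` t) S"
proof (rule meet_properly_orient)
  show "finite (pos ` t)" using cell_finite[OF t] by simp
  show "y = P n i \<or> y = P n (i + 1) \<or> orient (P n i) (P n (i + 1)) y < 0" if "y \<in> pos ` t" for y
    using chord_outer[OF t that] by force
  show "y = P n i \<or> y = P n (i + 1) \<or> 0 < orient (P n i) (P n (i + 1)) y" if "y \<in> S" for y
    using S[OF that] chord_center[of n i] chord_inner(2)[of _ n _ i] by metis
qed fact

text \<open>Across a gap the triangles follow each other in this order: the fan at the end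
  \<open>?A\<close>, the base triangle, the fan at the end \<open>?B\<close>. Any two are separated
  by the line of a spoke from \<open>?A\<close> or \<open>?B\<close>; the five facts
  \<open>LL\<close> to \<open>LR\<close> treat the possible pairs.\<close>

lemma meet_same_gap:
  assumes "s \<in> cell n i" "t \<in> cell n i"
  shows "meet_properly (pos ` s) (pos ` t)"
proof -
  let ?C = "P (Suc n)" and ?A = "P n i" and ?B = "P n (i + 1)" and ?q = "\<tau> n i"
  have fin: "finite (pos ` base_on n i)" "finite (pos ` tip_on n j l)" for j l
    by (simp_all add: pos_base_on pos_tip_on)
  have up: "\<theta> (Suc n) j \<le> \<theta> n (i + 1)" if "j \<le> ?q" for j
    using that tau_between(2)[of n i] theta_le_iff[of "Suc n" j ?q] by linarith
  have low: "\<theta> n i \<le> \<theta> (Suc n) j" if "?q \<le> j" for j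
    using that tau_between(1)[of n i] theta_le_iff[of "Suc n" ?q j] by linarith
  have left: "0 < orient ?A (?C j) (?C j')" "0 < orient ?B (?C j) (?C j')"
      "orient ?A (?C j') (?C j) < 0" "orient ?B (?C j') (?C j) < 0"
    if "\<theta> n i \<le> \<theta> (Suc n) j" "j < j'" "\<theta> (Suc n) j' \<le> \<theta> n (i + 1)" for j j'
    using fan_orient[OF that] orient_swap orient_rotate by (metis neg_less_0_iff_less)+
  \<comment> \<open>The separating spoke is the first side of the later triangle.\<close>
  have LL: "meet_properly (pos ` tip_on n i j) (pos ` tip_on n i j')"
    if j: "\<theta> n i \<le> \<theta> (Suc n) j" "j < j'" "j' < ?q" for j j'
  proof (rule meet_properly_orient[OF fin(2) fin(2), where p = ?A and q = "?C j'"])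
    have j1: "\<theta> n i \<le> \<theta> (Suc n) (j + 1)" "\<theta> n i \<le> \<theta> (Suc n) j'"
      using j theta_le_iff[of "Suc n" j "j + 1"] theta_le_iff[of "Suc n" j j'] by linarith+
    fix y
    show "y = ?A \<or> y = ?C j' \<or> orient ?A (?C j') y < 0" if "y \<in> pos ` tip_on n i j"
      using that left(3)[of j j'] left(3)[of "j + 1" j'] up[of j'] j j1
      by (cases "j + 1 = j'") (auto simp: pos_tip_on)
    show "y = ?A \<or> y = ?C j' \<or> 0 < orient ?A (?C j') y" if "y \<in> pos ` tip_on n i j'"
      using that left(1)[of j' "j' + 1"] up[of "j' + 1"] j j1 by (auto simp: pos_tip_on)
  qed
  have RR: "meet_properly (pos ` tip_on n (i + 1) j) (pos ` tip_on n (i + 1) j')"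
    if j: "?q \<le> j" "j < j'" "\<theta> (Suc n) (j' + 1) \<le> \<theta> n (i + 1)" for j j'
  proof (rule meet_properly_orient[OF fin(2) fin(2), where p = ?B and q = "?C j'"])
    have j1: "\<theta> (Suc n) j' \<le> \<theta> n (i + 1)"
      using j theta_le_iff[of "Suc n" j' "j' + 1"] by linarith
    fix y
    show "y = ?B \<or> y = ?C j' \<or> orient ?B (?C j') y < 0" if "y \<in> pos ` tip_on n (i + 1) j"
      using that left(4)[of j j'] left(4)[of "j + 1" j'] low[of j] low[of "j + 1"] j j1
      by (cases "j + 1 = j'") (auto simp: pos_tip_on)
    show "y = ?B \<or> y = ?C j' \<or> 0 < orient ?B (?C j') y" if "y \<in> pos ` tip_on n (i + 1) j'"
      using that left(2)[of j' "j' + 1"] low[of j'] j j1 by (auto simp: pos_tip_on)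
  qed
  have BR: "meet_properly (pos ` base_on n i) (pos ` tip_on n (i + 1) j)"
    if j: "?q \<le> j" "\<theta> (Suc n) (j + 1) \<le> \<theta> n (i + 1)" for j
  proof (rule meet_properly_orient[OF fin(1) fin(2), where p = ?B and q = "?C ?q"])
    have j1: "\<theta> (Suc n) j \<le> \<theta> n (i + 1)"
      using j theta_le_iff[of "Suc n" j "j + 1"] by linarith
    fix y
    show "y = ?B \<or> y = ?C ?q \<or> orient ?B (?C ?q) y < 0" if "y \<in> pos ` base_on n i"
      using that base_orient(2)[OF tau_between] by (auto simp: pos_base_on)
    show "y = ?B \<or> y = ?C ?q \<or> 0 < orient ?B (?C ?q) y" if "y \<in> pos ` tip_on n (i + 1) j"
      using that left(2)[of ?q j] left(2)[of ?q "j + 1"] low[of ?q] j j1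
      by (cases "?q = j") (auto simp: pos_tip_on)
  qed
  have LB: "meet_properly (pos ` tip_on n i j) (pos ` base_on n i)"
    if j: "\<theta> n i \<le> \<theta> (Suc n) j" "j < ?q" for j
  proof (rule meet_properly_orient[OF fin(2) fin(1), where p = ?A and q = "?C ?q"])
    have j1: "\<theta> n i \<le> \<theta> (Suc n) (j + 1)"
      using j theta_le_iff[of "Suc n" j "j + 1"] by linarith
    fix y
    show "y = ?A \<or> y = ?C ?q \<or> orient ?A (?C ?q) y < 0" if "y \<in> pos ` tip_on n i j"
      using that left(3)[of j ?q] left(3)[of "j + 1" ?q] up[of ?q] j j1
      by (cases "j + 1 = ?q") (auto simp: pos_tip_on)
    show "y = ?A \<or> y = ?C ?q \<or> 0 < orient ?A (?C ?q) y" if "y \<in> pos ` base_on n i"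
      using that base_orient(1)[OF tau_between] by (auto simp: pos_base_on)
  qed
  \<comment> \<open>The spoke from \<open>?A\<close> to the child of the gap separates the fans:
    \<open>?B\<close> is on its positive side by \<open>base_orient\<close>, the later outer
    vertices by \<open>fan_orient\<close>.\<close>
  have LR: "meet_properly (pos ` tip_on n i j) (pos ` tip_on n (i + 1) j')"
    if j: "\<theta> n i \<le> \<theta> (Suc n) j" "j < ?q" "?q \<le> j'" "\<theta> (Suc n) (j' + 1) \<le> \<theta> n (i + 1)" for j j'
  proof (rule meet_properly_orient[OF fin(2) fin(2), where p = ?A and q = "?C ?q"])
    have j1: "\<theta> n i \<le> \<theta> (Suc n) (j + 1)" "\<theta> (Suc n) j' \<le> \<theta> n (i + 1)"
      using j theta_le_iff[of "Suc n" j "j + 1"] theta_le_iff[of "Suc n" j' "j' + 1"] by linarith+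
    fix y
    show "y = ?A \<or> y = ?C ?q \<or> orient ?A (?C ?q) y < 0" if "y \<in> pos ` tip_on n i j"
      using that left(3)[of j ?q] left(3)[of "j + 1" ?q] up[of ?q] j j1
      by (cases "j + 1 = ?q") (auto simp: pos_tip_on)
    show "y = ?A \<or> y = ?C ?q \<or> 0 < orient ?A (?C ?q) y" if "y \<in> pos ` tip_on n (i + 1) j'"
      using that left(1)[of ?q j'] left(1)[of ?q "j' + 1"] base_orient(1)[OF tau_between, of n i] low[of ?q] j j1
      by (cases "?q = j'") (auto simp: pos_tip_on)
  qed
  from assms(1) show ?thesis
  proof (cases rule: cell_cases)
    case s: base
    from assms(2) show ?thesis
      by (cases rule: cell_cases) (auto simp: s intro: meet_properly_refl BR meet_properly_sym[OF LB])
  next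
    case s: (left j)
    from assms(2) show ?thesis
    proof (cases rule: cell_cases)
      case (left j')
      then show ?thesis using s LL[of j j'] meet_properly_sym[OF LL[of j' j]] meet_properly_refl
        by (cases j j' rule: linorder_cases) auto
    qed (auto simp: s(1) intro: LB LR s(2,3))
  next
    case s: (right j)
    from assms(2) show ?thesis
    proof (cases rule: cell_cases)
      case (right j')
      then show ?thesis using s RR[of j j'] meet_properly_sym[OF RR[of j' j]] meet_properly_refl
        by (cases j j' rule: linorder_cases) auto
    qed (auto simp: s(1) intro: meet_properly_sym[OF BR] meet_properly_sym[OF LR] s(2,3))
  qed
qed

lemma ray_face:
  assumes "finite S" "x \<in> convex hull S" "x = polar \<rho> \<phi>" "hi - lo < pi" "\<phi> = lo \<or> \<phi> = hi" "0 \<le> a" "0 < b"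
    and S: "\<And>y. y \<in> S \<Longrightarrow> \<exists>r t. y = polar r t \<and> lo \<le> t \<and> t \<le> hi \<and> r \<in> {a, b}"
  shows "x \<in> convex hull (S \<inter> {polar a \<phi>, polar b \<phi>})"
proof -
  \<comment> \<open>The sign makes the functional nonnegative on the sector for either boundary
    ray.\<close>
  define \<sigma> where "\<sigma> = (if \<phi> = lo then 1 else - 1 :: real)"
  define f where "f = cross2 (polar \<sigma> \<phi>)"
  have "x \<in> convex hull {y \<in> S. f y = 0}"
  proof (rule affine_functional_hull_zero)
    show "affine_functional f" by (simp add: f_def affine_functional_cross2)
    show "f x = 0" by (simp add: f_def assms(3) cross2_polar)
    fix y assume "y \<in> S"
    then obtain r t where y: "y = polar r t" "lo \<le> t" "t \<le> hi" "r \<in> {a, b}" using S by blast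
    then have "0 \<le> \<sigma> * sin (t - \<phi>)"
      using assms(4,5) sin_ge_zero[of "t - \<phi>"] sin_ge_zero[of "\<phi> - t"] sin_minus[of "\<phi> - t"]
      by (auto simp: \<sigma>_def)
    moreover have "0 \<le> r" using y assms by auto
    ultimately have "0 \<le> r * (\<sigma> * sin (t - \<phi>))" by simp
    then show "0 \<le> f y" by (simp add: f_def y cross2_polar mult_ac)
  qed (use assms in auto)
  moreover have "{y \<in> S. f y = 0} \<subseteq> S \<inter> {polar a \<phi>, polar b \<phi>}"
  proof
    fix y assume "y \<in> {y \<in> S. f y = 0}"
    then have yS: "y \<in> S" and fy: "f y = 0" by auto
    then obtain r t where y: "y = polar r t" "lo \<le> t" "t \<le> hi" "r \<in> {a, b}" using S by blast
    have "r = 0 \<or> sin (t - \<phi>) = 0"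
      using fy by (simp add: f_def y(1) cross2_polar \<sigma>_def split: if_splits)
    then have "y = polar r \<phi>"
    proof
      assume "r = 0" then show ?thesis by (simp add: y polar_def)
    next
      assume z: "sin (t - \<phi>) = 0"
      have "\<bar>t - \<phi>\<bar> < pi" using y assms by auto
      then have "t - \<phi> = 0" using z sin_zero_iff_int2[of "t - \<phi>"] sin_gt_zero[of "t - \<phi>"] sin_gt_zero[of "\<phi> - t"]
          sin_minus[of "t - \<phi>"] by (cases "t - \<phi>" "0::real" rule: linorder_cases) auto
      then show ?thesis by (simp add: y)
    qed
    then show "y \<in> S \<inter> {polar a \<phi>, polar b \<phi>}" using yS y by auto
  qed
  ultimately show ?thesis using hull_mono by (metis subsetD)
qed

text \<open>A point common to two different sectors of ring \<open>n\<close> lies on their common boundary ray.\<close>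

lemma meet_sectors:
  assumes ii: "i < i'" "i' < i + N n"
    and fin: "finite S" "finite S'"
    and S: "\<And>y. y \<in> S \<Longrightarrow> \<exists>r t. y = polar r t \<and> \<theta> n i \<le> t \<and> t \<le> \<theta> n (i + 1) \<and> r \<in> {a, b}"
    and S': "\<And>y. y \<in> S' \<Longrightarrow> \<exists>r t. y = polar r t \<and> \<theta> n i' \<le> t \<and> t \<le> \<theta> n (i' + 1) \<and> r \<in> {a, b}"
    and ab: "0 \<le> a" "0 < b" and zero: "0 \<in> S \<inter> S' \<or> 0 \<notin> convex hull S"
  shows "meet_properly S S'"
  unfolding meet_properly_def
proof
  fix x assume x: "x \<in> convex hull S \<inter> convex hull S'"
  show "x \<in> convex hull (S \<inter> S')"
  proof (cases "x = 0")
    case True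
    then show ?thesis using zero x by (auto intro: hull_inc)
  next
    case False
    have rs: "\<exists>r t. 0 \<le> r \<and> \<theta> n i \<le> t \<and> t \<le> \<theta> n (i + 1) \<and> y = polar r t" if "y \<in> S" for y
      using S[OF that] ab less_imp_le by auto
    have rs': "\<exists>r t. 0 \<le> r \<and> \<theta> n i' \<le> t \<and> t \<le> \<theta> n (i' + 1) \<and> y = polar r t" if "y \<in> S'" for y
      using S'[OF that] ab less_imp_le by auto
    obtain \<phi> where p: "\<theta> n i \<le> \<phi>" "\<phi> \<le> \<theta> n (i + 1)" "x = polar (norm x) \<phi>"
      using hull_in_sector[OF fin(1) theta_step gap_less_pi rs, of x] x by blast
    obtain \<phi>' where p': "\<theta> n i' \<le> \<phi>'" "\<phi>' \<le> \<theta> n (i' + 1)" "x = polar (norm x) \<phi>'"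
      using hull_in_sector[OF fin(2) theta_step gap_less_pi rs', of x] x by blast
    have "polar (norm x) \<phi>' = polar (norm x) \<phi>" using p(3) p'(3) by simp
    then obtain k :: int where k: "\<phi>' = \<phi> + of_int k * (2 * pi)"
      using polar_eq_iff[of "norm x" "norm x"] False by auto
    have ord: "\<theta> n (i + 1) \<le> \<theta> n i'" "\<theta> n (i' + 1) \<le> \<theta> n i + 2 * pi"
      using ii by (simp_all flip: theta_period)
    \<comment> \<open>The second sector lies between the end of the first and its start one turn
      later, so the two angles of \<open>x\<close> differ by no turn or by one. Each case pins both
      angles to ends of their sectors.\<close>
    have "0 * (2 * pi) \<le> of_int k * (2 * pi)" "of_int k * (2 * pi) \<le> 1 * (2 * pi)"
      using k p(1,2) p'(1,2) ord by linarith+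
    then have "0 \<le> k" "k \<le> 1"
      unfolding mult_le_cancel_right using pi_gt_zero by linarith+
    then consider "k = 0" | "k = 1" by linarith
    then have "(\<phi> = \<theta> n i \<or> \<phi> = \<theta> n (i + 1)) \<and> (\<phi>' = \<theta> n i' \<or> \<phi>' = \<theta> n (i' + 1))"
    proof cases
      case 1
      then have "\<phi>' = \<phi>" using k by simp
      then have "\<phi> = \<theta> n (i + 1)" "\<phi>' = \<theta> n i'" using p(1,2) p'(1,2) ord by linarith+
      then show ?thesis by blast
    next
      case 2
      then have "\<phi>' = \<phi> + 2 * pi" using k by simp
      then have "\<phi> = \<theta> n i" "\<phi>' = \<theta> n (i' + 1)" using p(1,2) p'(1,2) ord by linarith+
      then show ?thesis by blast
    qed
    then have ends: "\<phi> = \<theta> n i \<or> \<phi> = \<theta> n (i + 1)" "\<phi>' = \<theta> n i' \<or> \<phi>' = \<theta> n (i' + 1)"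
      by blast+
    have same: "polar r \<phi>' = polar r \<phi>" for r unfolding k by simp
    have "x \<in> convex hull (S \<inter> {polar a \<phi>, polar b \<phi>})"
      by (rule ray_face[OF fin(1) _ p(3) gap_less_pi ends(1) ab S]) (use x in blast)
    moreover have "x \<in> convex hull (S' \<inter> {polar a \<phi>', polar b \<phi>'})"
      by (rule ray_face[OF fin(2) _ p'(3) gap_less_pi ends(2) ab S']) (use x in blast)
    ultimately have "x \<in> convex hull (S \<inter> {polar a \<phi>, polar b \<phi>}) \<inter> convex hull (S' \<inter> {polar a \<phi>, polar b \<phi>})"
      unfolding same by (rule IntI)
    then have "x \<in> convex hull ((S \<inter> {polar a \<phi>, polar b \<phi>}) \<inter> (S' \<inter> {polar a \<phi>, polar b \<phi>}))"
      by (rule subsetD[OF hull_Int_of_pair[OF Int_lower2 Int_lower2]])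
    moreover have "convex hull ((S \<inter> {polar a \<phi>, polar b \<phi>}) \<inter> (S' \<inter> {polar a \<phi>, polar b \<phi>})) \<subseteq>
        convex hull (S \<inter> S')"
      by (rule hull_mono) auto
    ultimately show ?thesis by (rule rev_subsetD)
  qed
qed

lemma zero_notin_cell: "t \<in> cell n i \<Longrightarrow> 0 \<notin> convex hull (pos ` t)"
proof
  assume t: "t \<in> cell n i" and z: "0 \<in> convex hull (pos ` t)"
  have "finite (pos ` t)" using cell_finite[OF t] by simp
  moreover have "0 \<le> - orient (P n i) (P n (i + 1)) y" if "y \<in> pos ` t" for y
    using chord_outer(1)[OF t that] by simp
  ultimately have "0 \<le> - orient (P n i) (P n (i + 1)) 0"
    using z by (rule affine_functional_hull_nonneg[OF affine_functional_uminus[OF affine_functional_orient]])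
  then show False using chord_center[of n i] by linarith
qed

lemma cell_point_inner: "t \<in> cell n i \<Longrightarrow> y \<in> pos ` t \<Longrightarrow> \<exists>m\<le>Suc n. \<exists>j. y = P m j"
  using cell_point by (metis le_SucI order_refl)

lemma cell_point_sector:
  assumes "t \<in> cell n i" "y \<in> pos ` t"
  shows "\<exists>r t. y = polar r t \<and> \<theta> n i \<le> t \<and> t \<le> \<theta> n (i + 1) \<and> r \<in> {R n, R (Suc n)}"
proof -
  have "\<theta> n i \<le> \<theta> n (i + 1)" by simp
  then show ?thesis using cell_point[OF assms] by blast
qed

lemma central_periods: "central (i + l * N 0) = central i"
  using V_periods[of 0 i l] V_periods[of 0 "i + 1" l] by (simp add: central_def algebra_simps)

lemma central_point: "y \<in> pos ` central i \<Longrightarrow> y = 0 \<or> (\<exists>j. y = P 0 j)"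
  by (auto simp: pos_central)

text \<open>The centre counts as a point of radius 0 on any ray, which brings the central triangles
  under \<open>meet_sectors\<close>.\<close>

lemma central_point_sector:
  assumes "y \<in> pos ` central i"
  shows "\<exists>r t. y = polar r t \<and> \<theta> 0 i \<le> t \<and> t \<le> \<theta> 0 (i + 1) \<and> r \<in> {0, R 0}"
proof -
  have "0 = polar 0 (\<theta> 0 i)" by (simp add: polar_def vec_eq_iff forall_2)
  moreover have "\<theta> 0 i \<le> \<theta> 0 (i + 1)" by simp
  ultimately show ?thesis using assms unfolding pos_central by blast
qed

lemma meet_cells_less:
  assumes s: "s \<in> cell m i" and t: "t \<in> cell n j" and "m < n"
  shows "meet_properly (pos ` t) (pos ` s)"
proof (rule meet_outer_inner[OF t])
  show "finite (pos ` s)" using cell_finite[OF s] by simp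
  fix y assume "y \<in> pos ` s"
  then obtain m' j where "m' \<le> Suc m" "y = P m' j" using cell_point_inner[OF s] by blast
  moreover from this have "m' \<le> n" using \<open>m < n\<close> by simp
  ultimately show "y = 0 \<or> (\<exists>m\<le>n. \<exists>j. y = P m j)" by blast
qed

lemma meet_cells_same:
  assumes s: "s \<in> cell n i" and t: "t \<in> cell n j"
  shows "meet_properly (pos ` s) (pos ` t)"
proof -
  obtain l where l: "i \<le> j + l * N n" "j + l * N n < i + N n" by (rule index_shift)
  have t': "t \<in> cell n (j + l * N n)" using t by (rule cell_periods)
  show ?thesis
  proof (cases "i = j + l * N n")
    case True
    then show ?thesis using s t' by (auto intro: meet_same_gap)
  next
    case False
    with l(1) have "i < j + l * N n" by simp
    then show ?thesis
      by (rule meet_sectors[OF _ l(2) _ _ cell_point_sector[OF s] cell_point_sector[OF t']])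
        (use cell_finite[OF s] cell_finite[OF t] zero_notin_cell[OF s] R_pos less_imp_le[OF R_pos] in auto)
  qed
qed

lemma meet_cells:
  assumes "s \<in> cell m i" and "t \<in> cell n j"
  shows "meet_properly (pos ` s) (pos ` t)"
  using meet_cells_less[OF assms] meet_cells_same[of s n i t j] meet_properly_sym[OF meet_cells_less[OF assms(2,1)]] assms
  by (cases m n rule: linorder_cases) (auto intro: meet_properly_sym)

lemma meet_cell_central:
  assumes "t \<in> cell n i"
  shows "meet_properly (pos ` t) (pos ` central j)"
proof (rule meet_outer_inner[OF assms])
  show "finite (pos ` central j)" by (simp add: central_def)
  show "y = 0 \<or> (\<exists>m\<le>n. \<exists>j. y = P m j)" if "y \<in> pos ` central j" for y
    using central_point[OF that] by blast
qed

lemma meet_central: "meet_properly (pos ` central i) (pos ` central j)"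
proof -
  obtain l where l: "i \<le> j + l * N 0" "j + l * N 0 < i + N 0" by (rule index_shift)
  have fin: "finite (pos ` central i)" for i by (simp add: central_def)
  have "meet_properly (pos ` central i) (pos ` central (j + l * N 0))"
  proof (cases "i = j + l * N 0")
    case True
    then show ?thesis by (simp add: meet_properly_refl)
  next
    case False
    with l have "i < j + l * N 0" by simp
    moreover have "0 \<in> pos ` central i \<inter> pos ` central (j + l * N 0)" by (simp add: pos_central)
    ultimately show ?thesis
      using R_pos by (intro meet_sectors[OF _ l(2) fin fin central_point_sector central_point_sector]) auto
  qed
  then show ?thesis by (simp only: central_periods)
qed

lemma meet_T:
  assumes "s \<in> T" "t \<in> T"
  shows "meet_properly (pos ` s) (pos ` t)"
proof -
  have "(\<exists>i. s = central i) \<or> (\<exists>n i. s \<in> cell n i)" "(\<exists>i. t = central i) \<or> (\<exists>n i. t \<in> cell n i)"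
    using assms by (auto simp: T_def)
  then show ?thesis
    using meet_cells meet_cell_central meet_central meet_properly_sym by metis
qed

end

section \<open>The triangles cover the disc\<close>

lemma int_sign_change:
  fixes a b :: int
  assumes "a \<le> b" "Q a" "\<not> Q b"
  obtains l where "a \<le> l" "l < b" "Q l" "\<not> Q (l + 1)"
proof -
  have "\<exists>l. a \<le> l \<and> l < b \<and> Q l \<and> \<not> Q (l + 1)"
  proof (rule ccontr)
    assume H: "\<nexists>l. a \<le> l \<and> l < b \<and> Q l \<and> \<not> Q (l + 1)"
    have "c \<le> b \<longrightarrow> Q c" if "a \<le> c" for c
      using that by (induction c rule: int_ge_induct) (use H assms(2) in auto)
    then show False using assms by blast
  qed
  with that show thesis by blast
qed

lemma orient_zero: "orient p q 0 = cross2 p q"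
  by (simp add: orient_def cross2_def algebra_simps)

context radial_rings
begin

definition \<Omega> :: "(real^2) set" where
  "\<Omega> = {x. \<exists>m. norm x < R m}"

lemma finite_ring: "finite (range (V n))"
proof -
  have "range (V n) \<subseteq> V n ` {0..<N n}"
  proof
    fix v assume "v \<in> range (V n)"
    then obtain i where i: "v = V n i" by auto
    obtain l where "0 \<le> i + l * N n" "i + l * N n < 0 + N n" by (rule index_shift)
    moreover have "v = V n (i + l * N n)" by (simp only: V_periods i)
    ultimately show "v \<in> V n ` {0..<N n}" by simp
  qed
  then show ?thesis by (rule finite_subset) simp
qed

lemma cell_rings: "t \<in> cell n i \<Longrightarrow> t \<subseteq> range (V n) \<union> range (V (Suc n))"
  using cell_vertex by blast

lemma finite_low_triangles: "finite (range central \<union> (\<Union>n<m. \<Union>i. cell n i))"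
proof (rule finite_subset)
  show "range central \<union> (\<Union>n<m. \<Union>i. cell n i) \<subseteq> Pow (insert center (\<Union>n\<le>m. range (V n)))"
  proof
    fix t assume "t \<in> range central \<union> (\<Union>n<m. \<Union>i. cell n i)"
    then consider i where "t = central i" | n i where "n < m" "t \<in> cell n i" by blast
    then show "t \<in> Pow (insert center (\<Union>n\<le>m. range (V n)))"
    proof cases
      case 1 then show ?thesis by (auto simp: central_def)
    next
      case 2
      then have "n \<in> {..m}" "Suc n \<in> {..m}" by auto
      then show ?thesis using cell_rings[OF 2(2)] by blast
    qed
  qed
  show "finite (Pow (insert center (\<Union>n\<le>m. range (V n))))" using finite_ring by simp
qed

lemma T_cases [consumes 1, case_names central cell]:
  assumes "t \<in> T"
  obtains i where "t = central i" | n i where "t \<in> cell n i"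
  using assms by (auto simp: T_def)

lemma finite_triangles_at: "finite {t\<in>T. v \<in> t}"
proof (cases "\<exists>n i. v = V n i")
  case True
  then obtain n i where v: "v = V n i" by blast
  have "{t\<in>T. v \<in> t} \<subseteq> range central \<union> (\<Union>m<Suc n. \<Union>i. cell m i)"
  proof
    fix t assume t: "t \<in> {t\<in>T. v \<in> t}"
    then have "t \<in> T" by simp
    then show "t \<in> range central \<union> (\<Union>m<Suc n. \<Union>i. cell m i)"
    proof (cases rule: T_cases)
      case (cell m j)
      with t v have "V n i \<in> range (V m) \<union> range (V (Suc m))" using cell_rings by blast
      then have "n = m \<or> n = Suc m" by (auto simp: V_eq_iff)
      then have "m \<in> {..<Suc n}" by auto
      with cell show ?thesis by blast
    qed auto
  qed
  then show ?thesis using finite_low_triangles by (rule finite_subset)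
next
  case False
  have "{t\<in>T. v \<in> t} \<subseteq> range central \<union> (\<Union>m<0. \<Union>i. cell m i)"
  proof
    fix t assume t: "t \<in> {t\<in>T. v \<in> t}"
    then have "t \<in> T" by simp
    then show "t \<in> range central \<union> (\<Union>m<0. \<Union>i. cell m i)"
    proof (cases rule: T_cases)
      case (cell m j)
      with t have "v \<in> range (V m) \<union> range (V (Suc m))" using cell_rings by blast
      with False show ?thesis by blast
    qed auto
  qed
  then show ?thesis using finite_low_triangles by (rule finite_subset)
qed

text \<open>Along the direction of vertex \<open>i\<close>, every vertex of the cell has component
  at least \<open>R n\<close> times the cosine of the gap, hence so has every point of the hull. By
  \<open>R_exhaust\<close>, only finitely many layers then meet a disc of radius
  \<open>R m\<close>.\<close>

lemma cell_far:
  assumes t: "t \<in> cell n i" and x: "x \<in> convex hull (pos ` t)"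
  shows "R n * cos (\<theta> n (i + 1) - \<theta> n i) \<le> norm x"
proof -
  define e where "e = polar 1 (\<theta> n i)"
  define c where "c = R n * cos (\<theta> n (i + 1) - \<theta> n i)"
  have cos0: "0 \<le> cos (\<theta> n (i + 1) - \<theta> n i)"
    by (rule cos_ge_zero) (use gap_small[of n i] theta_step[of n i] pi_gt_zero in linarith)+
  have "0 \<le> e \<bullet> x + - c"
  proof (rule affine_functional_hull_nonneg[where f = "\<lambda>y. e \<bullet> y + - c", OF _ _ _ x])
    show "affine_functional (\<lambda>y. e \<bullet> y + - c)" unfolding affine_functional_def by blast
    show "finite (pos ` t)" using cell_finite[OF t] by simp
    fix y assume "y \<in> pos ` t"
    then obtain r s where y: "y = polar r s" "\<theta> n i \<le> s" "s \<le> \<theta> n (i + 1)" "r \<in> {R n, R (Suc n)}"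
      using cell_point_sector[OF t] by blast
    have "cos (\<theta> n (i + 1) - \<theta> n i) \<le> cos (s - \<theta> n i)"
      using y gap_less_pi[of n i] by (intro cos_monotone_0_pi_le) auto
    moreover have "R n \<le> r" using y by auto
    ultimately have "c \<le> r * cos (s - \<theta> n i)"
      unfolding c_def using cos0 R_pos[of n] by (intro mult_mono) auto
    then show "0 \<le> e \<bullet> y + - c" by (simp add: e_def y inner_polar)
  qed
  moreover have "e \<bullet> x \<le> norm e * norm x" by (rule norm_cauchy_schwarz)
  ultimately show ?thesis by (simp add: e_def c_def)
qed

lemma locally_finite:
  assumes "x \<in> \<Omega>"
  shows "\<exists>U. open U \<and> x \<in> U \<and> finite {t\<in>T. convex hull (pos ` t) \<inter> U \<noteq> {}}"
proof -
  obtain m where m: "norm x < R m" using assms by (auto simp: \<Omega>_def)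
  obtain n0 where n0: "\<And>n i. n0 \<le> n \<Longrightarrow> R m \<le> R n * cos (\<theta> n (i + 1) - \<theta> n i)"
    using R_exhaust[of m] by (auto simp: eventually_sequentially)
  have "{t\<in>T. convex hull (pos ` t) \<inter> ball 0 (R m) \<noteq> {}} \<subseteq> range central \<union> (\<Union>n<n0. \<Union>i. cell n i)"
  proof
    fix t assume t: "t \<in> {t\<in>T. convex hull (pos ` t) \<inter> ball 0 (R m) \<noteq> {}}"
    then obtain y where y: "y \<in> convex hull (pos ` t)" "norm y < R m" by auto
    from t have "t \<in> T" by simp
    then show "t \<in> range central \<union> (\<Union>n<n0. \<Union>i. cell n i)"
    proof (cases rule: T_cases)
      case (cell n i)
      have "\<not> n0 \<le> n"
        using cell_far[OF cell y(1)] y(2) n0[of n i] by auto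
      then have "n \<in> {..<n0}" by simp
      with cell show ?thesis by blast
    qed auto
  qed
  then have "finite {t\<in>T. convex hull (pos ` t) \<inter> ball 0 (R m) \<noteq> {}}"
    using finite_low_triangles by (rule finite_subset)
  then show ?thesis using m by (intro exI[of _ "ball 0 (R m)"]) auto
qed

text \<open>The exact distance of the chord from the centre involves the cosine of half the gap. The
  weaker bound with the full gap is the quantity controlled by \<open>R_exhaust\<close>, as in
  \<open>cell_far\<close>.\<close>

lemma inside_chord:
  assumes "0 \<le> r" "r \<le> R n * cos (\<theta> n (i + 1) - \<theta> n i)" "\<theta> n i \<le> \<phi>" "\<phi> \<le> \<theta> n (i + 1)"
  shows "0 \<le> orient (P n i) (P n (i + 1)) (polar r \<phi>)"
proof -
  let ?g = "\<theta> n (i + 1) - \<theta> n i"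
  define u v where "u = \<phi> - \<theta> n i" and "v = \<theta> n (i + 1) - \<phi>"
  have uv: "0 \<le> u" "0 \<le> v" "?g = u + v" using assms by (simp_all add: u_def v_def)
  have g: "u + v < pi" using gap_less_pi[of n i] uv by simp
  have "cos ?g \<le> cos v" "cos ?g \<le> cos u"
    unfolding uv(3) using uv g by (intro cos_monotone_0_pi_le; simp)+
  moreover have s: "0 \<le> sin u" "0 \<le> sin v" using uv g by (intro sin_ge_zero; simp)+
  ultimately have "cos ?g * sin u \<le> cos v * sin u" "cos ?g * sin v \<le> cos u * sin v"
    by (intro mult_right_mono; simp)+
  then have le: "cos ?g * (sin u + sin v) \<le> sin (u + v)"
    by (simp add: sin_add algebra_simps)
  have "r * (sin u + sin v) \<le> R n * cos ?g * (sin u + sin v)"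
    using assms s by (intro mult_right_mono) auto
  also have "\<dots> \<le> R n * sin (u + v)"
    using mult_left_mono[OF le, of "R n"] R_pos[of n] by (simp add: mult.assoc)
  finally have "0 \<le> R n * (R n * sin ?g - r * (sin u + sin v))"
    using R_pos[of n] uv by simp
  also have "\<dots> = orient (P n i) (P n (i + 1)) (polar r \<phi>)"
    using sin_minus[of u] sin_minus[of v] by (simp add: orient_polar u_def v_def algebra_simps)
  finally show ?thesis .
qed

lemma sector_triangle:
  assumes x: "x = polar r \<phi>" "0 \<le> r" and \<phi>: "\<theta> n i \<le> \<phi>" "\<phi> \<le> \<theta> n (i + 1)"
    and inside: "0 \<le> orient (P n i) (P n (i + 1)) x"
  shows "x \<in> convex hull {0, P n i, P n (i + 1)}"
proof -
  have "0 \<le> sin (\<phi> - \<theta> n i)" "0 \<le> sin (\<theta> n (i + 1) - \<phi>)"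
    using \<phi> gap_less_pi[of n i] by (intro sin_ge_zero; simp)+
  then have "0 \<le> cross2 (P n i) x" "0 \<le> cross2 x (P n (i + 1))"
    unfolding x cross2_polar using R_pos[of n] x(2) by simp_all
  moreover have "orient 0 (P n i) x = cross2 (P n i) x" "orient (P n (i + 1)) 0 x = cross2 x (P n (i + 1))"
    by (simp_all add: orient_def cross2_def algebra_simps)
  moreover have "0 < orient 0 (P n i) (P n (i + 1))"
    using chord_center[of n i] by (simp add: orient_rotate[of 0])
  ultimately show ?thesis using inside by (intro in_triangle_if_orient) simp_all
qed

lemma orient_hull3_nonneg:
  assumes "x \<in> convex hull {a, b, c}" "0 \<le> orient p q a" "0 \<le> orient p q b" "0 \<le> orient p q c"
  shows "0 \<le> orient p q x"
  by (rule affine_functional_hull_nonneg[OF affine_functional_orient _ _ assms(1)]) (use assms in auto)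

lemma cross2_P_nonneg:
  assumes "\<theta> n i \<le> \<theta> m j" "\<theta> m j \<le> \<theta> n i + pi"
  shows "0 \<le> cross2 (P n i) (P m j)"
  using assms R_pos[of n] R_pos[of m] by (auto simp: cross2_polar intro!: mult_nonneg_nonneg sin_ge_zero)

text \<open>The outer gap \<open>j\<close> that contains the direction of \<open>x\<close> decides
  from which end of the inner gap to search. If \<open>j < ?q\<close>, then \<open>x\<close> is on
  the nonnegative side of the spoke from \<open>?A\<close> to \<open>?C j\<close>. Either the same
  holds for the spoke to \<open>?C ?q\<close> and \<open>x\<close> is in the base triangle, or a
  sign change between consecutive spokes locates the triangle. The other case is the mirror image,
  with spokes from \<open>?B\<close>.\<close>

lemma annulus_cover:
  assumes x: "x = polar r \<phi>" "0 \<le> r"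
    and i: "\<theta> n i \<le> \<phi>" "\<phi> < \<theta> n (i + 1)" "orient (P n i) (P n (i + 1)) x < 0"
    and j: "\<theta> (Suc n) j \<le> \<phi>" "\<phi> < \<theta> (Suc n) (j + 1)" "0 \<le> orient (P (Suc n) j) (P (Suc n) (j + 1)) x"
  shows "\<exists>t\<in>cell n i. x \<in> convex hull (pos ` t)"
proof -
  let ?C = "P (Suc n)" and ?A = "P n i" and ?B = "P n (i + 1)" and ?q = "\<tau> n i"
  obtain a b where ab: "\<theta> (Suc n) a = \<theta> n i" "\<theta> (Suc n) b = \<theta> n (i + 1)" using theta_nested by blast
  have "\<theta> (Suc n) a < \<theta> (Suc n) (j + 1)" "\<theta> (Suc n) j < \<theta> (Suc n) b" using ab i j by linarith+
  then have aj: "a \<le> j" "j + 1 \<le> b" by simp_all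
  have qa: "a \<le> ?q" "?q \<le> b"
    using tau_between[of n i] unfolding ab[symmetric] by simp_all
  have lowC: "\<theta> n i \<le> \<theta> (Suc n) l" if "a \<le> l" for l using that by (simp flip: ab)
  have upC: "\<theta> (Suc n) l \<le> \<theta> n (i + 1)" if "l \<le> b" for l using that by (simp flip: ab)
  have xtri: "x \<in> convex hull {0, ?C j, ?C (j + 1)}"
    using sector_triangle[OF x] j by simp
  have A: "0 \<le> orient ?A (?C l) (?C l')" if "a \<le> l" "l \<le> l'" "l' \<le> b" for l l'
    using that fan_orient(1)[OF lowC, of l l'] upC[of l'] by (cases "l = l'") auto
  have B: "0 \<le> orient ?B (?C l) (?C l')" if "a \<le> l" "l \<le> l'" "l' \<le> b" for l l'
    using that fan_orient(2)[OF lowC, of l l'] upC[of l'] by (cases "l = l'") auto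
  have A0: "0 \<le> orient ?A (?C l) 0" and B0: "0 \<le> orient (?C l) ?B 0" if "a \<le> l" "l \<le> b" for l
  proof -
    have "\<theta> n i \<le> \<theta> (Suc n) l" "\<theta> (Suc n) l \<le> \<theta> n (i + 1)" using lowC upC that by simp_all
    moreover from this have "\<theta> (Suc n) l \<le> \<theta> n i + pi" "\<theta> n (i + 1) \<le> \<theta> (Suc n) l + pi"
      using gap_less_pi[of n i] by linarith+
    ultimately show "0 \<le> orient ?A (?C l) 0" "0 \<le> orient (?C l) ?B 0"
      unfolding orient_zero by (intro cross2_P_nonneg; simp)+
  qed
  \<comment> \<open>This is needed for every outer chord, since the sign change may occur at an
    index other than \<open>j\<close>.\<close>
  have rim: "0 \<le> orient (?C l) (?C (l + 1)) x" for l
    by (rule orient_hull3_nonneg[OF xtri])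
      (use chord_center[of "Suc n" l] chord_inner(1)[of "Suc n" "Suc n" l] in auto)
  have base: "x \<in> convex hull (pos ` base_on n i)" if "0 \<le> orient ?A (?C ?q) x" "0 \<le> orient (?C ?q) ?B x"
  proof -
    have "x \<in> convex hull {?A, ?C ?q, ?B}"
      using base_orient(1)[OF tau_between, of n i] that i(3) orient_swap[of ?A ?B x]
      by (intro in_triangle_if_orient) simp_all
    then show ?thesis by (simp add: pos_base_on insert_commute)
  qed
  show ?thesis
  proof (cases "j < ?q")
    case True
    define g where "g l = orient ?A (?C l) x" for l
    have "0 \<le> g j"
      unfolding g_def by (rule orient_hull3_nonneg[OF xtri]) (use A0[of j] A[of j "j + 1"] aj in auto)
    show ?thesis
    proof (cases "0 \<le> g ?q")
      case g: True
      have "0 \<le> orient (?C ?q) ?B (?C l)" if "a \<le> l" "l \<le> ?q" for l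
        using B[OF that qa(2)] orient_rotate by metis
      then have "0 \<le> orient (?C ?q) ?B x"
        using True aj qa by (intro orient_hull3_nonneg[OF xtri] B0) auto
      then show ?thesis using base g by (auto simp: g_def cell_def)
    next
      case False
      then obtain l where l: "j \<le> l" "l < ?q" "0 \<le> g l" "\<not> 0 \<le> g (l + 1)"
        using int_sign_change[of j ?q "\<lambda>l. 0 \<le> g l"] True \<open>0 \<le> g j\<close> by auto
      have "0 < orient ?A (?C l) (?C (l + 1))"
        using fan_orient(1)[OF lowC, of l "l + 1"] upC[of "l + 1"] l aj qa by simp
      then have "x \<in> convex hull {?A, ?C l, ?C (l + 1)}"
        using l(3,4) rim[of l] orient_swap[of ?A "?C (l + 1)" x]
        by (intro in_triangle_if_orient) (simp_all add: g_def)
      moreover have "tip_on n i l \<in> cell n i"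
        unfolding cell_def using lowC[of l] l aj by auto
      ultimately show ?thesis unfolding pos_tip_on[symmetric] by blast
    qed
  next
    case False
    define g where "g l = orient (?C l) ?B x" for l
    have "0 \<le> orient (?C (j + 1)) ?B (?C j)"
      using B[of j "j + 1"] aj orient_rotate by (metis zle_add1_eq_le less_add_one less_imp_le)
    then have "0 \<le> g (j + 1)"
      unfolding g_def using B0[of "j + 1"] aj by (intro orient_hull3_nonneg[OF xtri]) auto
    show ?thesis
    proof (cases "0 \<le> g ?q")
      case g: True
      have "0 \<le> orient ?A (?C ?q) x"
        using False aj qa A0[of ?q] A[of ?q j] A[of ?q "j + 1"] by (intro orient_hull3_nonneg[OF xtri]) auto
      then show ?thesis using base g by (auto simp: g_def cell_def)
    next
      case g: False
      then obtain l where l: "?q \<le> l" "l < j + 1" "\<not> 0 \<le> g l" "0 \<le> g (l + 1)"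
        using int_sign_change[of ?q "j + 1" "\<lambda>l. \<not> 0 \<le> g l"] False \<open>0 \<le> g (j + 1)\<close> by auto
      have "0 < orient ?B (?C l) (?C (l + 1))"
        using fan_orient(2)[OF lowC, of l "l + 1"] upC[of "l + 1"] l aj qa by simp
      then have "x \<in> convex hull {?B, ?C l, ?C (l + 1)}"
        using l(3,4) rim[of l] orient_swap[of ?B "?C l" x]
        by (intro in_triangle_if_orient) (simp_all add: g_def)
      moreover have "tip_on n (i + 1) l \<in> cell n i"
        unfolding cell_def using upC[of "l + 1"] l aj by auto
      ultimately show ?thesis unfolding pos_tip_on[symmetric] by blast
    qed
  qed
qed

text \<open>Some ring polygon contains \<open>x\<close> by \<open>R_exhaust\<close>; take the first.
  Then \<open>x\<close> is in a central triangle, or between this polygon and the preceding one,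
  where \<open>annulus_cover\<close> applies.\<close>

lemma cover: "(\<Union>t\<in>T. convex hull (pos ` t)) = \<Omega>"
proof
  have ball: "norm y < R m" if "\<And>z. z \<in> S \<Longrightarrow> norm z < R m" "y \<in> convex hull S" for S :: "(real^2) set" and y m
  proof -
    have "convex hull S \<subseteq> ball 0 (R m)" by (rule hull_minimal) (use that in auto)
    then show ?thesis using that by auto
  qed
  show "(\<Union>t\<in>T. convex hull (pos ` t)) \<subseteq> \<Omega>"
  proof (rule UN_least)
    fix t assume "t \<in> T"
    then show "convex hull (pos ` t) \<subseteq> \<Omega>"
    proof (cases rule: T_cases)
      case (central i)
      have "norm y < R 1" if "y \<in> convex hull (pos ` t)" for y
      proof (rule ball[OF _ that])
        fix z assume "z \<in> pos ` t"
        then have "norm z \<le> R 0" using R_pos[of 0] unfolding central pos_central by auto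
        also have "R 0 < R 1" by simp
        finally show "norm z < R 1" .
      qed
      then show ?thesis by (auto simp: \<Omega>_def)
    next
      case (cell n i)
      have "norm y < R (Suc (Suc n))" if "y \<in> convex hull (pos ` t)" for y
      proof (rule ball[OF _ that])
        fix z assume "z \<in> pos ` t"
        then obtain m j where z: "m \<le> Suc n" "z = P m j" using cell_point_inner[OF cell] by blast
        then show "norm z < R (Suc (Suc n))" using R_pos[of m] by simp
      qed
      then show ?thesis by (auto simp: \<Omega>_def)
    qed
  qed
  show "\<Omega> \<subseteq> (\<Union>t\<in>T. convex hull (pos ` t))"
  proof
    fix x assume "x \<in> \<Omega>"
    then obtain m where m: "norm x < R m" by (auto simp: \<Omega>_def)
    obtain \<phi> where x: "x = polar (norm x) \<phi>" using polar_exists by blast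
    define In where "In n \<longleftrightarrow> (\<forall>i. \<theta> n i \<le> \<phi> \<longrightarrow> \<phi> < \<theta> n (i + 1) \<longrightarrow> 0 \<le> orient (P n i) (P n (i + 1)) x)" for n
    obtain n0 where n0: "\<And>i. R m \<le> R n0 * cos (\<theta> n0 (i + 1) - \<theta> n0 i)"
      using R_exhaust[of m] by (auto simp: eventually_sequentially)
    have "In n0"
      unfolding In_def
    proof (intro allI impI)
      fix i assume i: "\<theta> n0 i \<le> \<phi>" "\<phi> < \<theta> n0 (i + 1)"
      have "norm x \<le> R n0 * cos (\<theta> n0 (i + 1) - \<theta> n0 i)" using m n0[of i] by linarith
      then have "0 \<le> orient (P n0 i) (P n0 (i + 1)) (polar (norm x) \<phi>)"
        using i by (intro inside_chord) simp_all
      then show "0 \<le> orient (P n0 i) (P n0 (i + 1)) x" using x by simp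
    qed
    define n where "n = (LEAST n. In n)"
    have n: "In n" unfolding n_def using \<open>In n0\<close> by (rule LeastI)
    show "x \<in> (\<Union>t\<in>T. convex hull (pos ` t))"
    proof (cases n)
      case 0
      obtain i where i: "\<theta> 0 i \<le> \<phi>" "\<phi> < \<theta> 0 (i + 1)" by (rule theta_bracket)
      then have "0 \<le> orient (P 0 i) (P 0 (i + 1)) x" using n 0 by (simp add: In_def)
      then have "x \<in> convex hull (pos ` central i)"
        unfolding pos_central using sector_triangle[OF x] i by simp
      then show ?thesis by (auto simp: T_def)
    next
      case (Suc n')
      then have "\<not> In n'" unfolding n_def by (metis lessI not_less_Least)
      then obtain i where i: "\<theta> n' i \<le> \<phi>" "\<phi> < \<theta> n' (i + 1)" "orient (P n' i) (P n' (i + 1)) x < 0"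
        by (auto simp: In_def not_le)
      obtain j where j: "\<theta> (Suc n') j \<le> \<phi>" "\<phi> < \<theta> (Suc n') (j + 1)" by (rule theta_bracket)
      then have "0 \<le> orient (P (Suc n') j) (P (Suc n') (j + 1)) x" using n Suc by (simp add: In_def)
      then obtain t where "t \<in> cell n' i" "x \<in> convex hull (pos ` t)"
        using annulus_cover[OF x norm_ge_zero i j] by blast
      then show ?thesis unfolding T_def by blast
    qed
  qed
qed

lemma cell_affine_independent:
  assumes "t \<in> cell n i"
  shows "\<not> affine_dependent (pos ` t)"
  using assms
proof (cases rule: cell_cases)
  case base
  then show ?thesis using base_orient(1)[OF tau_between, of n i] unfolding base pos_base_on
    by (subst insert_commute, intro not_affine_dependent_if_orient) (simp add: orient_rotate[of "P n (i + 1)"])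
next
  case (left j)
  have "\<theta> (Suc n) (j + 1) \<le> \<theta> (Suc n) (\<tau> n i)" using left by simp
  then have "\<theta> (Suc n) (j + 1) \<le> \<theta> n (i + 1)" using tau_between(2)[of n i] by linarith
  then show ?thesis unfolding left pos_tip_on
    using fan_orient(1)[OF left(2), of "j + 1"] by (intro not_affine_dependent_if_orient) simp
next
  case (right j)
  have "\<theta> (Suc n) (\<tau> n i) \<le> \<theta> (Suc n) j" using right by simp
  then have "\<theta> n i \<le> \<theta> (Suc n) j" using tau_between(1)[of n i] by linarith
  then show ?thesis unfolding right(1) pos_tip_on
    using fan_orient(2)[of n i j "j + 1"] right(3) by (intro not_affine_dependent_if_orient) simp
qed

sublocale affine_triangles pos T \<Omega>
proof
  show "inj_on pos (\<Union> T)" using inj_pos by (rule inj_on_subset) simp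
  show "finite t" if "t \<in> T" for t
    using that by (cases rule: T_cases) (auto simp: central_def cell_finite)
  show "\<not> affine_dependent (pos ` t)" if "t \<in> T" for t
    using that
  proof (cases rule: T_cases)
    case (central i)
    then show ?thesis unfolding central pos_central
      using chord_center[of 0 i] by (intro not_affine_dependent_if_orient) (simp add: orient_rotate[of 0])
  qed (rule cell_affine_independent)
  show "convex hull pos ` s \<inter> convex hull pos ` t \<subseteq> convex hull pos ` (s \<inter> t)" if "s \<in> T" "t \<in> T" for s t
    using meet_T[OF that] unfolding meet_properly_def image_Int[OF inj_pos] .
qed (use finite_triangles_at cover locally_finite in auto)

end

section \<open>Vertex degrees\<close>

lemma card_edges_at:
  assumes "\<And>t. t \<in> S \<Longrightarrow> finite t" and Nb: "Nb = {w. w \<noteq> v \<and> (\<exists>t\<in>S. v \<in> t \<and> w \<in> t)}"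
  shows "card {e \<in> edges (generated_cplx S). v \<in> e} = card Nb"
    and "finite {e \<in> edges (generated_cplx S). v \<in> e} \<longleftrightarrow> finite Nb"
proof -
  have eq: "{e \<in> edges (generated_cplx S). v \<in> e} = (\<lambda>w. {v, w}) ` Nb"
  proof (intro set_eqI iffI)
    fix e assume "e \<in> {e \<in> edges (generated_cplx S). v \<in> e}"
    then obtain t where e: "v \<in> e" "card e = 2" and t: "t \<in> S" "e \<subseteq> t"
      by (auto simp: edges_def generated_cplx_def)
    then obtain w where "e = {v, w}" "w \<noteq> v" by (auto simp: card_2_iff)
    then show "e \<in> (\<lambda>w. {v, w}) ` Nb" using t Nb by blast
  qed (auto simp: Nb edges_def generated_cplx_def card_2_iff)
  have inj: "inj_on (\<lambda>w. {v, w}) Nb"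
    by (auto simp: inj_on_def doubleton_eq_iff)
  show "card {e \<in> edges (generated_cplx S). v \<in> e} = card Nb"
    unfolding eq using inj by (rule card_image)
  show "finite {e \<in> edges (generated_cplx S). v \<in> e} \<longleftrightarrow> finite Nb"
    unfolding eq using inj by (rule finite_image_iff)
qed

section \<open>Counting the neighbours of a vertex in the ring complex\<close>

context radial_rings
begin

text \<open>The ray of vertex \<open>i\<close> cuts the fan over its children into the end of one
  cell and the start of the next. An outer vertex lies on this ray, so no triangle of the fan
  straddles it. Together with \<open>T_triangle_cases\<close> this describes \<open>T\<close> by
  \<tau> alone, without angles.\<close>

lemma tip_in_T:
  assumes "\<tau> n (i - 1) \<le> j" "j < \<tau> n i"
  shows "tip_on n i j \<in> T"
proof -
  obtain a where a: "\<theta> (Suc n) a = \<theta> n i" using theta_nested by blast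
  show ?thesis
  proof (cases "a \<le> j")
    case True
    then have "\<theta> n i \<le> \<theta> (Suc n) j" by (simp flip: a)
    then have "tip_on n i j \<in> cell n i" using assms by (auto simp: cell_def)
    then show ?thesis by (auto simp: T_def)
  next
    case False
    then have "\<theta> (Suc n) (j + 1) \<le> \<theta> n (i - 1 + 1)" by (simp flip: a)
    then have "tip_on n (i - 1 + 1) j \<in> cell n (i - 1)" using assms unfolding cell_def by blast
    then show ?thesis by (auto simp: T_def)
  qed
qed

lemma T_triangle_cases [consumes 1, case_names central base tip]:
  assumes "t \<in> T"
  obtains i where "t = central i" | n i where "t = base_on n i"
  | n i j where "t = tip_on n i j" "\<tau> n (i - 1) \<le> j" "j < \<tau> n i"
  using assms
proof (cases rule: T_cases)
  case (cell n i)
  then show ?thesis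
  proof (cases rule: cell_cases)
    case (left j)
    have "\<theta> (Suc n) (\<tau> n (i - 1)) \<le> \<theta> n (i - 1 + 1)" by (rule tau_between(2))
    also have "\<dots> \<le> \<theta> (Suc n) j" using left by simp
    finally show ?thesis using that(3) left by simp
  next
    case (right j)
    have "\<theta> (Suc n) (j + 1) \<le> \<theta> n (i + 1)" by (rule right)
    also have "\<dots> \<le> \<theta> (Suc n) (\<tau> n (i + 1))" by (rule tau_between(1))
    finally show ?thesis using that(3)[of n "i + 1" j] right by simp
  qed (use that in blast)
qed (use that in blast)

lemma base_in_T: "base_on n i \<in> T"
  by (auto simp: T_def cell_def)

lemma central_in_T: "central i \<in> T"
  by (auto simp: T_def)

lemma base_shift: "base_on n (i + l * N n) = base_on n i"
  using V_periods[of n "i + 1" l] V_periods[of n i l] V_periods[of "Suc n" "\<tau> n i" l]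
  by (simp add: base_on_def tau_periods algebra_simps)

lemma tip_shift: "tip_on n (i + l * N n) (j + l * N (Suc n)) = tip_on n i j"
  using V_periods[of n i l] V_periods[of "Suc n" j l] V_periods[of "Suc n" "j + 1" l]
  by (simp add: tip_on_def algebra_simps)

lemma tip_bounds_shift:
  "\<tau> n (i + l * N n - 1) \<le> j + l * N (Suc n) \<longleftrightarrow> \<tau> n (i - 1) \<le> j"
  "j + l * N (Suc n) < \<tau> n (i + l * N n) \<longleftrightarrow> j < \<tau> n i"
  using tau_periods[of n "i - 1" l] tau_periods[of n i l] by (simp_all add: algebra_simps)

definition parents :: "nat \<Rightarrow> int \<Rightarrow> int set" where
  "parents n j = {i. \<tau> n (i - 1) \<le> j \<and> j \<le> \<tau> n i}"

definition lower :: "nat \<Rightarrow> int \<Rightarrow> 'v set" where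
  "lower n i = (case n of 0 \<Rightarrow> {center} | Suc m \<Rightarrow> V m ` parents m i)"

definition nbs :: "nat \<Rightarrow> int \<Rightarrow> 'v set" where
  "nbs n i = {V n (i - 1), V n (i + 1)} \<union> V (Suc n) ` {\<tau> n (i - 1)..\<tau> n i} \<union> lower n i"

text \<open>A triangle comes with arbitrary representatives of its indices. The shift lemmas move
  them so that the given vertex has index exactly \<open>i\<close>, and the other two vertices can
  be read off.\<close>

lemma V_in_T_nbs:
  assumes "t \<in> T" "V n i \<in> t" "w \<in> t" "w \<noteq> V n i"
  shows "w \<in> nbs n i"
  using assms(1)
proof (cases rule: T_triangle_cases)
  case (central j)
  then consider "V n i = V 0 j" | "V n i = V 0 (j + 1)" using assms(2) by (auto simp: central_def)
  then show ?thesis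
  proof cases
    case 1
    then obtain l where "n = 0" "i = j + l * N 0" by (auto simp: V_eq_iff)
    moreover from this have "t = central i" using central central_periods by simp
    ultimately show ?thesis using assms by (auto simp: central_def nbs_def lower_def)
  next
    case 2
    then obtain l where l: "n = 0" "i = j + 1 + l * N 0" by (auto simp: V_eq_iff)
    then have "t = central (i - 1)"
      using central central_periods[of j l] by (simp add: algebra_simps)
    with l(1) assms show ?thesis by (auto simp: central_def nbs_def lower_def)
  qed
next
  case (base m j)
  then consider "V n i = V m j" | "V n i = V m (j + 1)" | "V n i = V (Suc m) (\<tau> m j)"
    using assms(2) by (auto simp: base_on_def)
  then show ?thesis
  proof cases
    case 1
    then obtain l where l: "n = m" "i = j + l * N m" by (auto simp: V_eq_iff)
    then have "t = base_on n i" using base base_shift by simp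
    moreover have "\<tau> n (i - 1) \<le> \<tau> n i" by simp
    ultimately show ?thesis using assms by (auto simp: base_on_def nbs_def)
  next
    case 2
    then obtain l where l: "n = m" "i = j + 1 + l * N m" by (auto simp: V_eq_iff)
    then have "t = base_on n (i - 1)" using base base_shift[of n j l] by (simp add: algebra_simps)
    moreover have "\<tau> n (i - 1) \<le> \<tau> n i" by simp
    ultimately show ?thesis using assms by (auto simp: base_on_def nbs_def)
  next
    case 3
    then obtain l where l: "n = Suc m" "i = \<tau> m j + l * N (Suc m)" by (auto simp: V_eq_iff)
    define j' where "j' = j + l * N m"
    have j': "i = \<tau> m j'" "t = base_on m j'" using l base base_shift by (simp_all add: j'_def tau_periods)
    have "j' \<in> parents m i" "j' + 1 \<in> parents m i" by (simp_all add: parents_def j')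
    then have "V m j' \<in> lower n i" "V m (j' + 1) \<in> lower n i" by (auto simp: lower_def l)
    moreover have "w = V m j' \<or> w = V m (j' + 1)"
      using assms(3,4) l(1) j' by (auto simp: base_on_def)
    ultimately show ?thesis by (auto simp: nbs_def)
  qed
next
  case (tip m p j)
  then consider "V n i = V m p" | "V n i = V (Suc m) j" | "V n i = V (Suc m) (j + 1)"
    using assms(2) by (auto simp: tip_on_def)
  then show ?thesis
  proof cases
    case 1
    then obtain l where l: "n = m" "i = p + l * N m" by (auto simp: V_eq_iff)
    define j' where "j' = j + l * N (Suc n)"
    have "t = tip_on n i j'" "\<tau> n (i - 1) \<le> j'" "j' < \<tau> n i"
      using tip l tip_shift[of n p l j] tip_bounds_shift[where n = n and i = p and l = l and j = j] by (simp_all add: j'_def)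
    then show ?thesis using assms(3,4) by (auto simp: tip_on_def nbs_def)
  next
    case 2
    then obtain l where l: "n = Suc m" "i = j + l * N (Suc m)" by (auto simp: V_eq_iff)
    define p' where "p' = p + l * N m"
    have t: "t = tip_on m p' i" "\<tau> m (p' - 1) \<le> i" "i < \<tau> m p'"
      using tip l tip_shift[of m p l j] tip_bounds_shift[where n = m and i = p and l = l and j = j] by (simp_all add: p'_def)
    then have "V m p' \<in> lower n i" by (auto simp: lower_def l parents_def)
    then show ?thesis using assms(3,4) t(1) l(1) by (auto simp: tip_on_def nbs_def)
  next
    case 3
    then obtain l where l: "n = Suc m" "i = j + 1 + l * N (Suc m)" by (auto simp: V_eq_iff)
    define p' where "p' = p + l * N m"
    have t: "t = tip_on m p' (i - 1)" "\<tau> m (p' - 1) \<le> i - 1" "i - 1 < \<tau> m p'"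
      using tip l tip_shift[of m p l j] tip_bounds_shift[where n = m and i = p and l = l and j = j] by (simp_all add: p'_def algebra_simps)
    then have "V m p' \<in> lower n i" by (auto simp: lower_def l parents_def)
    then show ?thesis using assms(3,4) t(1) l(1) by (auto simp: tip_on_def nbs_def)
  qed
qed

lemma child_in_T:
  assumes "\<tau> n (i - 1) \<le> j" "j \<le> \<tau> n i"
  shows "\<exists>t\<in>T. V n i \<in> t \<and> V (Suc n) j \<in> t"
proof (cases "j = \<tau> n i")
  case True
  then show ?thesis using base_in_T[of n i] by (intro bexI[of _ "base_on n i"]) (auto simp: base_on_def)
next
  case False
  then show ?thesis using tip_in_T[of n i j] assms by (intro bexI[of _ "tip_on n i j"]) (auto simp: tip_on_def)
qed

lemma nbs_in_T:
  assumes "w \<in> nbs n i"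
  shows "\<exists>t\<in>T. V n i \<in> t \<and> w \<in> t"
proof -
  consider "w = V n (i - 1)" | "w = V n (i + 1)" | j where "\<tau> n (i - 1) \<le> j" "j \<le> \<tau> n i" "w = V (Suc n) j"
    | "n = 0" "w = center" | m j where "n = Suc m" "j \<in> parents m i" "w = V m j"
    using assms by (auto simp: nbs_def lower_def split: nat.splits)
  then show ?thesis
  proof cases
    case 1
    then show ?thesis by (intro bexI[of _ "base_on n (i - 1)"] base_in_T) (auto simp: base_on_def)
  next
    case 2
    then show ?thesis by (intro bexI[of _ "base_on n i"] base_in_T) (auto simp: base_on_def)
  next
    case 3
    then show ?thesis using child_in_T by blast
  next
    case 4
    then show ?thesis by (intro bexI[of _ "central i"] central_in_T) (auto simp: central_def)
  next
    case 5
    then show ?thesis using child_in_T[of m j i] by (auto simp: parents_def)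
  qed
qed

lemma ring_neq: "m \<noteq> n \<Longrightarrow> V m i \<noteq> V n j"
  by (simp add: V_eq_iff)

text \<open>Two consecutive gaps stay below \<open>pi\<close> together, by \<open>gap_small\<close>.
  In particular the two neighbours of a vertex on its ring are different.\<close>

lemma neighbour_near: "V n i = V n j \<Longrightarrow> i = j" if "\<bar>i - j\<bar> \<le> 2"
proof (rule V_near_eq)
  have "\<theta> n j \<le> \<theta> n (i + 2)" "\<theta> n i \<le> \<theta> n (j + 2)" using that by auto
  moreover have "\<theta> n (i + 2) - \<theta> n i < pi" for i
    using gap_small[of n i] gap_small[of n "i + 1"] by (simp add: field_simps)
  ultimately show "\<bar>\<theta> n i - \<theta> n j\<bar> < 2 * pi" using pi_gt_zero by (smt (verit))
qed

lemma nbs_eq: "{w. w \<noteq> V n i \<and> (\<exists>t\<in>T. V n i \<in> t \<and> w \<in> t)} = nbs n i"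
proof (intro set_eqI iffI)
  fix w assume w: "w \<in> nbs n i"
  have "V n i \<notin> nbs n i"
    using neighbour_near[of i "i - 1" n] neighbour_near[of i "i + 1" n] ring_neq[of n]
    by (auto simp: nbs_def lower_def split: nat.splits)
  with w have "w \<noteq> V n i" by auto
  with w show "w \<in> {w. w \<noteq> V n i \<and> (\<exists>t\<in>T. V n i \<in> t \<and> w \<in> t)}"
    using nbs_in_T by blast
qed (use V_in_T_nbs in blast)

text \<open>The child intervals from \<open>\<tau> n (i - 1)\<close> to \<open>\<tau> n i\<close>
  cover the integers and overlap only in their end points.\<close>

lemma parents_cases: "(\<exists>a. j = \<tau> n a \<and> parents n j = {a, a + 1}) \<or> (j \<notin> range (\<tau> n) \<and> (\<exists>a. parents n j = {a}))"
proof -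
  obtain a where a: "\<tau> n a \<le> j" "j < \<tau> n (a + 1)"
  proof -
    obtain l where l: "\<tau> n 0 \<le> j + l * N (Suc n)" "j + l * N (Suc n) < \<tau> n 0 + N (Suc n)"
      by (rule index_shift)
    have "\<tau> n (0 + (- l) * N n) \<le> j" "j < \<tau> n (0 + (1 - l) * N n)"
      using l unfolding tau_periods by (simp_all add: algebra_simps)
    then show thesis using int_bracket[OF _ _ tau_strict_mono] that by blast
  qed
  show ?thesis
  proof (cases "\<tau> n a = j")
    case True
    have "parents n j = {a, a + 1}" by (auto simp: parents_def simp flip: True)
    with True[symmetric] show ?thesis by blast
  next
    case False
    have le: "\<tau> n (i - 1) \<le> j \<longleftrightarrow> i \<le> a + 1" for i
    proof
      assume "\<tau> n (i - 1) \<le> j"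
      then have "\<tau> n (i - 1) < \<tau> n (a + 1)" using a by linarith
      then show "i \<le> a + 1" by simp
    next
      assume "i \<le> a + 1"
      then have "\<tau> n (i - 1) \<le> \<tau> n a" by simp
      then show "\<tau> n (i - 1) \<le> j" using a by linarith
    qed
    have ge: "j \<le> \<tau> n i \<longleftrightarrow> a + 1 \<le> i" for i
    proof
      assume "j \<le> \<tau> n i"
      then have "\<tau> n a < \<tau> n i" using a False by linarith
      then show "a + 1 \<le> i" by simp
    next
      assume "a + 1 \<le> i"
      then have "\<tau> n (a + 1) \<le> \<tau> n i" by simp
      then show "j \<le> \<tau> n i" using a by linarith
    qed
    have "parents n j = {a + 1}" unfolding parents_def le ge by auto
    moreover have "j \<notin> range (\<tau> n)"
    proof
      assume "j \<in> range (\<tau> n)"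
      then obtain b where "j = \<tau> n b" by auto
      with a False show False by auto
    qed
    ultimately show ?thesis by blast
  qed
qed

lemma card_lower: "card (lower n i) = (if n > 0 \<and> i \<in> range (\<tau> (n - 1)) then 2 else 1)"
proof (cases n)
  case 0
  then show ?thesis by (simp add: lower_def)
next
  case (Suc m)
  from parents_cases[of i m] show ?thesis
  proof
    assume "\<exists>a. i = \<tau> m a \<and> parents m i = {a, a + 1}"
    then obtain a where a: "i = \<tau> m a" "parents m i = {a, a + 1}" by blast
    have "V m a \<noteq> V m (a + 1)" using neighbour_near[of a "a + 1" m] by auto
    then show ?thesis using a by (auto simp: lower_def Suc)
  next
    assume "i \<notin> range (\<tau> m) \<and> (\<exists>a. parents m i = {a})"
    then show ?thesis by (auto simp: lower_def Suc)
  qed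
qed

lemma card_upper: "card (V (Suc n) ` {\<tau> n (i - 1)..\<tau> n i}) = nat (\<tau> n i - \<tau> n (i - 1) + 1)"
proof -
  have "inj_on (V (Suc n)) {\<tau> n (i - 1)..\<tau> n i}"
  proof (rule inj_onI, rule V_near_eq, assumption)
    fix a b assume ab: "a \<in> {\<tau> n (i - 1)..\<tau> n i}" "b \<in> {\<tau> n (i - 1)..\<tau> n i}"
    then have "\<theta> (Suc n) (\<tau> n (i - 1)) \<le> \<theta> (Suc n) a" "\<theta> (Suc n) a \<le> \<theta> (Suc n) (\<tau> n i)"
      "\<theta> (Suc n) (\<tau> n (i - 1)) \<le> \<theta> (Suc n) b" "\<theta> (Suc n) b \<le> \<theta> (Suc n) (\<tau> n i)" by auto
    moreover have "\<theta> n (i - 1) \<le> \<theta> (Suc n) (\<tau> n (i - 1))" "\<theta> (Suc n) (\<tau> n i) \<le> \<theta> n (i + 1)"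
      using tau_between by auto
    moreover have "\<theta> n (i + 1) - \<theta> n (i - 1) < pi"
      using gap_small[of n i] gap_small[of n "i - 1"] by (simp add: field_simps)
    ultimately show "\<bar>\<theta> (Suc n) a - \<theta> (Suc n) b\<bar> < 2 * pi" using pi_gt_zero by linarith
  qed
  then show ?thesis by (simp add: card_image)
qed

lemma finite_parents: "finite (parents n j)"
  using parents_cases[of j n] by auto

lemma finite_lower: "finite (lower n i)"
  by (auto simp: lower_def finite_parents split: nat.splits)

text \<open>The summand 3 consists of the two neighbours on the ring and the additional end point of
  the child interval. The last summand counts the parents, or the centre in ring 0.\<close>

lemma card_nbs:
  "int (card (nbs n i)) = \<tau> n i - \<tau> n (i - 1) + 3 + (if n > 0 \<and> i \<in> range (\<tau> (n - 1)) then 2 else 1)"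
proof -
  have low: "V m j \<notin> lower n i" if "n \<le> m" for m j
    using that by (auto simp: lower_def V_eq_iff split: nat.splits)
  have "card (nbs n i) = card ({V n (i - 1), V n (i + 1)} \<union> V (Suc n) ` {\<tau> n (i - 1)..\<tau> n i}) + card (lower n i)"
    unfolding nbs_def using low finite_lower by (intro card_Un_disjoint) auto
  also have "card ({V n (i - 1), V n (i + 1)} \<union> V (Suc n) ` {\<tau> n (i - 1)..\<tau> n i}) =
      card {V n (i - 1), V n (i + 1)} + card (V (Suc n) ` {\<tau> n (i - 1)..\<tau> n i})"
    using ring_neq[of n "Suc n"] by (intro card_Un_disjoint) auto
  also have "card {V n (i - 1), V n (i + 1)} = 2"
    using neighbour_near[of "i - 1" "i + 1" n] by (auto simp: card_insert_if)
  finally show ?thesis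
    unfolding card_lower card_upper using tau_le_iff[of n "i - 1" i] by simp
qed

text \<open>The condition on \<tau> is the count of \<open>card_nbs\<close> set equal to
  \<open>k\<close> and solved for the increment; \<open>N 0\<close> is the degree of the
  centre.\<close>

lemma regular:
  assumes "N 0 = int k"
    and "\<And>n i. \<tau> n i - \<tau> n (i - 1) = int k - 4 - (if n > 0 \<and> i \<in> range (\<tau> (n - 1)) then 1 else 0)"
  shows "regular_cplx k cplx"
  unfolding regular_cplx_def
proof
  fix v assume "v \<in> \<Union>cplx"
  then obtain t where "t \<in> T" "v \<in> t" by (auto simp: generated_cplx_def)
  then have "v = center \<or> (\<exists>n i. v = V n i)"
    by (cases rule: T_triangle_cases) (auto simp: central_def base_on_def tip_on_def)
  moreover have "finite {w. w \<noteq> center \<and> (\<exists>t\<in>T. center \<in> t \<and> w \<in> t)} \<and>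
      card {w. w \<noteq> center \<and> (\<exists>t\<in>T. center \<in> t \<and> w \<in> t)} = k"
  proof -
    have "{w. w \<noteq> center \<and> (\<exists>t\<in>T. center \<in> t \<and> w \<in> t)} = V 0 ` {0..<N 0}"
    proof (intro set_eqI iffI)
      fix w assume "w \<in> {w. w \<noteq> center \<and> (\<exists>t\<in>T. center \<in> t \<and> w \<in> t)}"
      then obtain t where w: "w \<noteq> center" "t \<in> T" "center \<in> t" "w \<in> t" by auto
      from w(2) obtain i where "w = V 0 i"
        using w by (cases rule: T_triangle_cases) (auto simp: central_def base_on_def tip_on_def)
      moreover obtain l where "0 \<le> i + l * N 0" "i + l * N 0 < 0 + N 0" by (rule index_shift)
      moreover have "V 0 i = V 0 (i + l * N 0)" by (simp only: V_periods)
      ultimately show "w \<in> V 0 ` {0..<N 0}" by simp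
    next
      fix w assume "w \<in> V 0 ` {0..<N 0}"
      then obtain i where "w = V 0 i" by auto
      then show "w \<in> {w. w \<noteq> center \<and> (\<exists>t\<in>T. center \<in> t \<and> w \<in> t)}"
        using central_in_T[of i] by (auto simp: central_def)
    qed
    moreover have "inj_on (V 0) {0..<N 0}"
    proof (rule inj_onI, rule V_near_eq, assumption)
      fix a b assume ab: "a \<in> {0..<N 0}" "b \<in> {0..<N 0}"
      then have "\<theta> 0 a < \<theta> 0 (b + N 0)" "\<theta> 0 b < \<theta> 0 (a + N 0)" by auto
      then show "\<bar>\<theta> 0 a - \<theta> 0 b\<bar> < 2 * pi" unfolding theta_period by linarith
    qed
    ultimately show ?thesis using assms(1) by (simp add: card_image)
  qed
  moreover have "finite {w. w \<noteq> V n i \<and> (\<exists>t\<in>T. V n i \<in> t \<and> w \<in> t)} \<and>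
      card {w. w \<noteq> V n i \<and> (\<exists>t\<in>T. V n i \<in> t \<and> w \<in> t)} = k" for n i
  proof -
    have "int (card (nbs n i)) = int k" unfolding card_nbs assms(2) by simp
    moreover have "finite (nbs n i)" by (simp add: nbs_def finite_lower)
    ultimately show ?thesis unfolding nbs_eq by simp
  qed
  ultimately have "finite {w. w \<noteq> v \<and> (\<exists>t\<in>T. v \<in> t \<and> w \<in> t)} \<and>
      card {w. w \<noteq> v \<and> (\<exists>t\<in>T. v \<in> t \<and> w \<in> t)} = k"
    by blast
  then show "finite {e \<in> edges cplx. v \<in> e} \<and> card {e \<in> edges cplx. v \<in> e} = k"
    using card_edges_at[OF finite_cell refl, of T v] by simp
qed

end

section \<open>Distance estimates, and Euclidean segments as geodesics\<close>

lemma one_minus_cos_le: "1 - cos x \<le> x\<^sup>2 / (2::real)"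
proof -
  have "1 - cos x = 2 * (sin (x / 2))\<^sup>2"
    using cos_double_sin[of "x / 2"] by simp
  also have "(sin (x / 2))\<^sup>2 \<le> (x / 2)\<^sup>2"
    using abs_sin_x_le_abs_x[of "x / 2"] unfolding abs_le_square_iff .
  finally show ?thesis by (simp add: power2_eq_square)
qed

text \<open>The path follows the circle of radius \<open>r\<close> and then a ray; a chord is no
  longer than its arc.\<close>

lemma dist_polar_le:
  assumes "0 \<le> r"
  shows "dist (polar r a) (polar s b) \<le> \<bar>r - s\<bar> + r * \<bar>a - b\<bar>"
proof -
  have c: "cos (b - a) = cos (a - b)"
    by (metis cos_minus minus_diff_eq)
  have "(dist (polar r a) (polar r b))\<^sup>2 = 2 * r\<^sup>2 * (1 - cos (a - b))"
    unfolding dist_norm power2_norm_eq_inner inner_diff_left inner_diff_right inner_polar c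
    by (simp add: power2_eq_square algebra_simps)
  also have "\<dots> \<le> 2 * r\<^sup>2 * ((a - b)\<^sup>2 / 2)"
    by (intro mult_left_mono one_minus_cos_le) simp
  also have "\<dots> = (r * \<bar>a - b\<bar>)\<^sup>2" by (simp add: power_mult_distrib)
  finally have 1: "dist (polar r a) (polar r b) \<le> r * \<bar>a - b\<bar>"
    by (rule power2_le_imp_le) (use assms in simp)
  have "polar r b - polar s b = polar (r - s) b"
    by (simp add: vec_eq_iff forall_2 algebra_simps)
  then have "dist (polar r b) (polar s b) = \<bar>r - s\<bar>"
    by (simp add: dist_norm)
  with 1 show ?thesis
    using dist_triangle[of "polar r a" "polar s b" "polar r b"] by linarith
qed

lemma (in affine_triangles) edge_segment:
  assumes "e \<in> edges cplx"
  obtains u v where "pos u \<noteq> pos v" "affine_extension pos ` closed_cell e = closed_segment (pos u) (pos v)"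
    "\<exists>t\<in>T. u \<in> t \<and> v \<in> t"
proof -
  from assms have e: "e \<in> cplx" "card e = 2" by (auto simp: edges_def)
  then obtain t where t: "t \<in> T" "e \<subseteq> t" by (auto simp: generated_cplx_def)
  obtain u v where uv: "e = {u, v}" "u \<noteq> v" using e(2) by (auto simp: card_2_iff)
  then have "pos u \<noteq> pos v" using pos_inj_cell[OF t(1)] t(2) by (auto dest: inj_onD)
  moreover have "affine_extension pos ` closed_cell e = closed_segment (pos u) (pos v)"
    using image_face[OF e(1)] by (simp add: uv segment_convex_hull)
  ultimately show thesis using that t uv by blast
qed

lemma (in radial_rings) T_in_sector:
  assumes "t \<in> T"
  obtains n i where
      "\<And>y. y \<in> pos ` t \<Longrightarrow> \<exists>r s. y = polar r s \<and> \<theta> n i \<le> s \<and> s \<le> \<theta> n (i + 1) \<and> r \<in> {R n, R (Suc n)}"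
  | i where "\<And>y. y \<in> pos ` t \<Longrightarrow> \<exists>r s. y = polar r s \<and> \<theta> 0 i \<le> s \<and> s \<le> \<theta> 0 (i + 1) \<and> r \<in> {0, R 0}"
  using assms
proof (cases rule: T_cases)
  case (central i)
  then show ?thesis using central_point_sector by (intro that(2)) blast
next
  case (cell n i)
  then show ?thesis using cell_point_sector by (intro that(1)) blast
qed

lemma geodesic_arc_segment:
  fixes p q :: "'a::real_normed_vector"
  assumes "p \<noteq> q"
  shows "geodesic_arc (closed_segment p q)"
proof -
  define L where "L = norm (q - p)"
  define \<gamma> where "\<gamma> t = p + (t / L) *\<^sub>R (q - p)" for t
  have L: "0 < L" using assms by (simp add: L_def)
  have dist: "dist (\<gamma> r) (\<gamma> s) = \<bar>r - s\<bar>" for r s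
  proof -
    have "\<gamma> r - \<gamma> s = ((r - s) / L) *\<^sub>R (q - p)"
      by (simp add: \<gamma>_def diff_divide_distrib scaleR_left_diff_distrib)
    then show ?thesis using L by (simp add: dist_norm L_def)
  qed
  have "inj_on \<gamma> {0..L}" using dist by (metis (no_types) abs_eq_0 dist_self eq_iff_diff_eq_0 inj_onI)
  moreover have "\<gamma> ` {0..L} = closed_segment p q"
  proof (intro set_eqI iffI)
    fix x assume "x \<in> \<gamma> ` {0..L}"
    then obtain t where t: "0 \<le> t" "t \<le> L" "x = \<gamma> t" by auto
    then show "x \<in> closed_segment p q" using L
      by (auto simp: closed_segment_def \<gamma>_def algebra_simps intro!: exI[of _ "t / L"])
  next
    fix x assume "x \<in> closed_segment p q"
    then obtain u where u: "0 \<le> u" "u \<le> 1" "x = (1 - u) *\<^sub>R p + u *\<^sub>R q" by (auto simp: closed_segment_def)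
    then have "x = \<gamma> (u * L)" using L by (simp add: \<gamma>_def algebra_simps)
    moreover have "u * L \<in> {0..L}" using u L by (simp add: mult_left_le_one_le)
    ultimately show "x \<in> \<gamma> ` {0..L}" by blast
  qed
  ultimately show ?thesis
    unfolding geodesic_arc_def using L dist by (intro exI[of _ L] conjI exI[of _ \<gamma>]) (auto intro!: exI[of _ 1])
qed

text \<open>Balls are convex, which is used twice: a ball about a vertex contains the hull with the
  vertices, so a ball about any point of the hull contains the vertices and then the hull.\<close>

lemma diameter_hull_le:
  fixes S :: "'a::euclidean_space set"
  assumes "\<And>y z. y \<in> S \<Longrightarrow> z \<in> S \<Longrightarrow> dist y z \<le> M" "0 \<le> M"
  shows "diameter (convex hull S) \<le> M"
proof (rule diameter_le)
  fix x y assume x: "x \<in> convex hull S" and y: "y \<in> convex hull S"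
  have "convex hull S \<subseteq> cball z M" if "z \<in> S" for z
    by (rule hull_minimal) (use assms that in auto)
  then have "S \<subseteq> cball x M" using x by (force simp: dist_commute)
  then have "convex hull S \<subseteq> cball x M" by (rule hull_minimal) simp
  then show "norm (x - y) \<le> M" using y by (auto simp: dist_norm)
qed (use assms in simp)

section \<open>Prescribed degree at least seven\<close>

text \<open>The two-sided antidifference of \<open>s\<close> vanishing at 0, because ring indices
  run over all integers.\<close>

definition int_sum :: "(int \<Rightarrow> int) \<Rightarrow> int \<Rightarrow> int" where
  "int_sum s i = (if 0 \<le> i then (\<Sum>l\<in>{0..<i}. s l) else - (\<Sum>l\<in>{i..<0}. s l))"

lemma int_sum_0 [simp]: "int_sum s 0 = 0"
  by (simp add: int_sum_def)

lemma int_sum_step: "int_sum s (i + 1) = int_sum s i + s i"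
proof (cases "0 \<le> i")
  case True
  then have "{0..<i + 1} = insert i {0..<i}" by auto
  with True show ?thesis by (simp add: int_sum_def)
next
  case False
  then have "{i..<0} = insert i {i + 1..<0}" by auto
  with False show ?thesis by (simp add: int_sum_def)
qed

lemma int_sum_period:
  assumes "\<And>i. s (i + M) = s i"
  shows "int_sum s (i + M) = int_sum s i + int_sum s M"
proof (induction i rule: int_induct[where k = 0])
  case base
  show ?case by simp
next
  case (step1 i)
  have "int_sum s (i + 1 + M) = int_sum s (i + M) + s (i + M)"
    using int_sum_step[of s "i + M"] by (simp add: algebra_simps)
  with step1 show ?case by (simp add: int_sum_step assms)
next
  case (step2 i)
  have "int_sum s (i + M) = int_sum s (i - 1 + M) + s (i - 1 + M)"
    using int_sum_step[of s "i - 1 + M"] by (simp add: algebra_simps)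
  moreover have "int_sum s i = int_sum s (i - 1) + s (i - 1)"
    using int_sum_step[of s "i - 1"] by simp
  ultimately show ?case using step2 by (simp add: assms)
qed

text \<open>\<open>c i = 1\<close> marks the vertices with two parents. Vertex \<open>i\<close> has \<open>k - 3 - c i\<close> children, the last of
  which is the first one of vertex \<open>i + 1\<close>.\<close>

definition child_of_gap :: "int \<Rightarrow> (int \<Rightarrow> int) \<Rightarrow> int \<Rightarrow> int" where
  "child_of_gap k c i = int_sum (\<lambda>l. k - 4 - c l) (i + 1)"

primrec shared :: "int \<Rightarrow> nat \<Rightarrow> int \<Rightarrow> int" where
  "shared k 0 = (\<lambda>j. 0)"
| "shared k (Suc n) = (\<lambda>j. if j \<in> range (child_of_gap k (shared k n)) then 1 else 0)"

text \<open>Over one period of ring \<open>n\<close> the child index advances by the sum of its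
  increments, and this must be one period of the next ring.\<close>

primrec ring_size :: "int \<Rightarrow> nat \<Rightarrow> int" where
  "ring_size k 0 = k"
| "ring_size k (Suc n) = int_sum (\<lambda>l. k - 4 - shared k n l) (ring_size k n)"

text \<open>A shared child is placed in the middle of its gap. The other children of a vertex start on its own ray
  and are spread evenly up to the next midpoint, so that all gaps are at least halved.\<close>

definition refine :: "(int \<Rightarrow> int) \<Rightarrow> (int \<Rightarrow> real) \<Rightarrow> int \<Rightarrow> real" where
  "refine \<tau> \<theta> j = (let a = (THE a. \<tau> (a - 1) \<le> j \<and> j < \<tau> a) in
     if j = \<tau> (a - 1) then (\<theta> (a - 1) + \<theta> a) / 2
     else \<theta> a + of_int (j - \<tau> (a - 1) - 1) / of_int (\<tau> a - \<tau> (a - 1) - 1) * ((\<theta> (a + 1) - \<theta> a) / 2))"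

primrec angle :: "int \<Rightarrow> nat \<Rightarrow> int \<Rightarrow> real" where
  "angle k 0 = (\<lambda>i. of_int i * (2 * pi / of_int k))"
| "angle k (Suc n) = refine (child_of_gap k (shared k n)) (angle k n)"

lemma child_of_gap_diff: "child_of_gap k c i - child_of_gap k c (i - 1) = k - 4 - c i"
  using int_sum_step[of "\<lambda>l. k - 4 - c l" i] by (simp add: child_of_gap_def)

lemma refine_at:
  assumes "strict_mono \<tau>" "\<tau> (a - 1) \<le> j" "j < \<tau> a"
  shows "refine \<tau> \<theta> j = (if j = \<tau> (a - 1) then (\<theta> (a - 1) + \<theta> a) / 2
     else \<theta> a + of_int (j - \<tau> (a - 1) - 1) / of_int (\<tau> a - \<tau> (a - 1) - 1) * ((\<theta> (a + 1) - \<theta> a) / 2))"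
proof -
  have "(THE a. \<tau> (a - 1) \<le> j \<and> j < \<tau> a) = a"
  proof (rule the_equality)
    fix b assume b: "\<tau> (b - 1) \<le> j \<and> j < \<tau> b"
    have "\<tau> (b - 1) < \<tau> a" "\<tau> (a - 1) < \<tau> b" using b assms by linarith+
    then have "b - 1 < a" "a - 1 < b" by (simp_all only: strict_mono_less[OF assms(1)])
    then show "b = a" by simp
  qed (use assms in simp)
  then show ?thesis by (simp only: refine_def Let_def)
qed

text \<open>Each new step is either the half gap from a midpoint to the next old ray, or one of
  \<open>L\<close> equal parts of the half gap that follows this ray.\<close>

lemma refine_gap:
  assumes "\<And>a. 2 \<le> \<tau> a - \<tau> (a - 1)" "\<And>a. \<theta> a < \<theta> (a + 1)" "\<And>a. \<theta> (a + 1) - \<theta> a \<le> d"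
    and "\<tau> (a - 1) \<le> j" "j < \<tau> a"
  shows "refine \<tau> \<theta> j < refine \<tau> \<theta> (j + 1)" "refine \<tau> \<theta> (j + 1) - refine \<tau> \<theta> j \<le> d / 2"
proof -
  have mono: "strict_mono \<tau>"
  proof (rule strict_mono_intI)
    show "\<tau> i < \<tau> (i + 1)" for i using assms(1)[of "i + 1"] by simp
  qed
  \<comment> \<open>\<open>L\<close> counts the steps from the ray of \<open>a\<close> to the next
    midpoint. It is at least 1 because the child index advances by at least 2.\<close>
  define L where "L = of_int (\<tau> a - \<tau> (a - 1) - 1 :: int) / (1 :: real)"
  define \<delta> where "\<delta> = of_int (j - \<tau> (a - 1) - 1) / (1 :: real)"
  define g where "g = (\<theta> (a + 1) - \<theta> a) / 2"
  have L: "1 \<le> L" using assms(1)[of a] by (simp add: L_def)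
  have g: "0 < g" "g \<le> d / 2" using assms(2,3)[of a] by (simp_all add: g_def)
  have "g / L \<le> g / 1" using L g by (intro divide_left_mono) auto
  then have gL: "0 < g / L" "g / L \<le> d / 2"
    using L g by (simp, metis div_by_1 order_trans)
  show "refine \<tau> \<theta> j < refine \<tau> \<theta> (j + 1)" "refine \<tau> \<theta> (j + 1) - refine \<tau> \<theta> j \<le> d / 2"
  proof (atomize (full), cases "j = \<tau> (a - 1)")
    case True
    have r0: "refine \<tau> \<theta> j = (\<theta> (a - 1) + \<theta> a) / 2"
      using refine_at[OF mono assms(4,5)] True by simp
    have "refine \<tau> \<theta> (j + 1) = \<theta> a"
      using refine_at[OF mono, of a "j + 1"] assms(1)[of a] True by simp
    with r0 show "refine \<tau> \<theta> j < refine \<tau> \<theta> (j + 1) \<and> refine \<tau> \<theta> (j + 1) - refine \<tau> \<theta> j \<le> d / 2"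
      using assms(2,3)[of "a - 1"] by (simp add: field_simps)
  next
    case False
    have r0: "refine \<tau> \<theta> j = \<theta> a + \<delta> / L * g"
      using refine_at[OF mono assms(4,5)] False by (simp add: \<delta>_def L_def g_def)
    have r1: "refine \<tau> \<theta> (j + 1) = \<theta> a + (\<delta> + 1) / L * g"
    \<comment> \<open>At the last step \<open>j + 1\<close> belongs to the next index interval, and
      the midpoint placed there has to agree with the end of the linear formula.\<close>
    proof (cases "j + 1 = \<tau> a")
      case True
      have "refine \<tau> \<theta> (j + 1) = (\<theta> a + \<theta> (a + 1)) / 2"
        using refine_at[OF mono, of "a + 1" "j + 1"] assms(1)[of "a + 1"] True by simp
      moreover have "\<delta> + 1 = L" by (simp add: \<delta>_def L_def flip: True)
      ultimately show ?thesis using L by (simp add: g_def field_simps)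
    next
      case False
      then show ?thesis
        using refine_at[OF mono, of a "j + 1"] assms(4,5) by (simp add: \<delta>_def L_def g_def)
    qed
    have "refine \<tau> \<theta> (j + 1) = refine \<tau> \<theta> j + g / L"
      unfolding r0 r1 by (simp add: add_divide_distrib algebra_simps)
    with gL show "refine \<tau> \<theta> j < refine \<tau> \<theta> (j + 1) \<and> refine \<tau> \<theta> (j + 1) - refine \<tau> \<theta> j \<le> d / 2"
      by simp
  qed
qed

section \<open>Periodicity and angular gaps for degree at least seven\<close>

context
  fixes k :: int
  assumes k: "7 \<le> k"
begin

abbreviation "tau n \<equiv> child_of_gap k (shared k n)"

lemma shared_cases: "shared k n j = 0 \<or> shared k n j = 1"
  by (cases n) auto

lemma tau_diff: "tau n i - tau n (i - 1) = k - 4 - shared k n i"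
  by (rule child_of_gap_diff)

text \<open>Here \<open>7 \<le> k\<close> enters: even a vertex with two parents has room for a
  child on its own ray besides a shared one.\<close>

lemma tau_diff_ge: "2 \<le> tau n i - tau n (i - 1)"
  using tau_diff[of n i] shared_cases[of n i] k by auto

lemma tau_mono: "strict_mono (tau n)"
proof (rule strict_mono_intI)
  show "tau n i < tau n (i + 1)" for i using tau_diff_ge[of n "i + 1"] by simp
qed

text \<open>The two periodicities alternate: that of \<open>shared\<close> in ring \<open>n\<close>
  yields that of \<open>tau n\<close>, whose range determines \<open>shared\<close> in ring
  \<open>n + 1\<close>.\<close>

lemma shared_period: "shared k n (i + ring_size k n) = shared k n i"
  and tau_period: "tau n (i + ring_size k n) = tau n i + ring_size k (Suc n)"
proof -
  have step: "tau n (i + ring_size k n) = tau n i + ring_size k (Suc n)"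
    if "\<And>i. shared k n (i + ring_size k n) = shared k n i" for n i
    using int_sum_period[of "\<lambda>l. k - 4 - shared k n l" "ring_size k n" "i + 1"] that
    by (simp add: child_of_gap_def algebra_simps)
  have *: "shared k n (i + ring_size k n) = shared k n i" for n i
  proof (induction n arbitrary: i)
    case (Suc n)
    note tau = step[of n, OF Suc.IH]
    have "j + ring_size k (Suc n) \<in> range (tau n) \<longleftrightarrow> j \<in> range (tau n)" for j
    proof
      assume "j + ring_size k (Suc n) \<in> range (tau n)"
      then obtain a where "j + ring_size k (Suc n) = tau n a" by auto
      then have "j = tau n (a - ring_size k n)" using tau[of "a - ring_size k n"] by simp
      then show "j \<in> range (tau n)" by (metis rangeI)
    next
      assume "j \<in> range (tau n)"
      then obtain a where "j = tau n a" by auto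
      then have "j + ring_size k (Suc n) = tau n (a + ring_size k n)" using tau[of a] by simp
      then show "j + ring_size k (Suc n) \<in> range (tau n)" by (metis rangeI)
    qed
    then show ?case by (simp del: ring_size.simps)
  qed simp
  show "shared k n (i + ring_size k n) = shared k n i" by (rule *)
  show "tau n (i + ring_size k n) = tau n i + ring_size k (Suc n)" by (rule step[OF *])
qed

lemma tau_bracket: obtains a where "tau n (a - 1) \<le> j" "j < tau n a"
proof -
  have lin: "i \<le> tau n i - tau n 0" if "0 \<le> i" for i
    using that
  proof (induction i rule: int_ge_induct)
    case (step i)
    then show ?case using tau_diff_ge[of n "i + 1"] by simp
  qed simp
  have lin': "tau n i - tau n 0 \<le> i" if "i \<le> 0" for i
    using that
  proof (induction i rule: int_le_induct)
    case (step i)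
    then show ?case using tau_diff_ge[of n i] by simp
  qed simp
  \<comment> \<open>\<open>tau n\<close> moves at least as fast as its argument, so going this far
    from 0 in both directions brackets \<open>j\<close>.\<close>
  define m where "m = \<bar>j\<bar> + \<bar>tau n 0\<bar> + 1"
  have m: "0 \<le> m" "- m \<le> 0" "j + tau n 0 \<le> m" "- m \<le> j - tau n 0" "j - tau n 0 < m"
    by (simp_all add: m_def)
  have "j < tau n m" using lin[OF m(1)] m(5) by linarith
  moreover have "tau n (- m) \<le> j" using lin'[OF m(2)] m(4) by linarith
  ultimately obtain a where "tau n a \<le> j" "j < tau n (a + 1)"
    using int_bracket[OF _ _ tau_mono] by blast
  then show thesis using that[of "a + 1"] by simp
qed

lemma angle_step: "angle k n i < angle k n (i + 1)"
  and angle_gap: "angle k n (i + 1) - angle k n i \<le> 2 * pi / of_int k / 2 ^ n"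
proof -
  have "angle k n i < angle k n (i + 1) \<and> angle k n (i + 1) - angle k n i \<le> 2 * pi / of_int k / 2 ^ n"
  proof (induction n arbitrary: i)
    case 0
    have "0 < 2 * pi / of_int k" using k by simp
    moreover have "angle k 0 (i + 1) = angle k 0 i + 2 * pi / of_int k"
      by (simp only: angle.simps of_int_add of_int_1 distrib_right mult_1)
    ultimately show ?case by (simp del: angle.simps)
  next
    case (Suc n)
    obtain a where a: "tau n (a - 1) \<le> i" "i < tau n a" by (rule tau_bracket)
    show ?case
      using refine_gap[of "tau n" "angle k n" "2 * pi / of_int k / 2 ^ n", OF tau_diff_ge _ _ a] Suc
      by (simp add: mult.commute)
  qed
  then show "angle k n i < angle k n (i + 1)" "angle k n (i + 1) - angle k n i \<le> 2 * pi / of_int k / 2 ^ n"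
    by blast+
qed

lemma angle_tau: "angle k (Suc n) (tau n i) = (angle k n i + angle k n (i + 1)) / 2"
  using refine_at[OF tau_mono, of n "i + 1" "tau n i"] tau_diff_ge[of n "i + 1"] by simp

text \<open>This supplies the nesting of directions that \<open>radial_rings\<close> asks
  for.\<close>

lemma angle_old: "angle k (Suc n) (tau n (i - 1) + 1) = angle k n i"
  using refine_at[OF tau_mono, of n i "tau n (i - 1) + 1"] tau_diff_ge[of n i] by simp

lemma angle_period: "angle k n (i + ring_size k n) = angle k n i + 2 * pi"
proof (induction n arbitrary: i)
  case 0
  then show ?case using k by (simp add: field_simps)
next
  case (Suc n)
  obtain a where a: "tau n (a - 1) \<le> i" "i < tau n a" by (rule tau_bracket)
  have p: "tau n (a + ring_size k n - 1) = tau n (a - 1) + ring_size k (Suc n)"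
      "tau n (a + ring_size k n) = tau n a + ring_size k (Suc n)"
    using tau_period[of n "a - 1"] tau_period[of n a] by (simp_all add: algebra_simps)
  have q: "angle k n (a + ring_size k n - 1) = angle k n (a - 1) + 2 * pi"
      "angle k n (a + ring_size k n) = angle k n a + 2 * pi"
      "angle k n (a + ring_size k n + 1) = angle k n (a + 1) + 2 * pi"
    using Suc[of "a - 1"] Suc[of a] Suc[of "a + 1"] by (simp_all add: algebra_simps)
  have "refine (tau n) (angle k n) (i + ring_size k (Suc n)) = refine (tau n) (angle k n) i + 2 * pi"
    using refine_at[OF tau_mono a, of "angle k n"]
      refine_at[OF tau_mono, of n "a + ring_size k n" "i + ring_size k (Suc n)" "angle k n"] a
    unfolding p q by (simp add: algebra_simps del: ring_size.simps)
  then show ?case by (simp del: ring_size.simps)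
qed

lemma angle_gap_small: "angle k n (i + 1) - angle k n i \<le> pi / 3"
proof -
  have "2 * pi / of_int k / 2 ^ n \<le> 2 * pi / of_int k / 1"
    using k by (intro divide_left_mono) auto
  also have "\<dots> \<le> 2 * pi / 6 / 1" using k by (intro divide_right_mono divide_left_mono) auto
  finally show ?thesis using angle_gap[of n i] by simp
qed

interpretation euclid: radial_rings "\<lambda>x. x" 0 "\<lambda>n i. polar (real n + 1) (angle k n i)" "ring_size k" tau "angle k" "\<lambda>n. real n + 1"
proof
  show "strict_mono (\<lambda>n. real n + 1)" by (rule strict_monoI) simp
  show "angle k n (i + 1) - angle k n i < pi / 2" for n i
    using angle_gap_small[of n i] pi_gt_zero by linarith
  show "tau n i < tau n (i + 1)" for n i using tau_diff_ge[of n "i + 1"] by simp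
  show "angle k n i \<le> angle k (Suc n) (tau n i)" "angle k (Suc n) (tau n i) \<le> angle k n (i + 1)" for n i
    using angle_step[of n i] unfolding angle_tau by simp_all
  show "\<exists>j. angle k (Suc n) j = angle k n i" for n i using angle_old by blast
  show "\<forall>\<^sub>F n in sequentially. \<forall>i. real m + 1 \<le> (real n + 1) * cos (angle k n (i + 1) - angle k n i)" for m
    unfolding eventually_sequentially
  proof (intro exI allI impI)
    \<comment> \<open>Gaps are at most \<open>pi / 3\<close>, so the cosine is at least one half and
      doubling the radius suffices.\<close>
    fix n i assume n: "2 * m + 2 \<le> n"
    have "cos (pi / 3) \<le> cos (angle k n (i + 1) - angle k n i)"
      using angle_gap_small[of n i] angle_step[of n i] pi_gt_zero by (intro cos_monotone_0_pi_le) auto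
    then have "(real n + 1) * (1 / 2) \<le> (real n + 1) * cos (angle k n (i + 1) - angle k n i)"
      by (intro mult_left_mono) (simp_all add: cos_60)
    moreover have "real m + 1 \<le> (real n + 1) * (1 / 2)" using n by simp
    ultimately show "real m + 1 \<le> (real n + 1) * cos (angle k n (i + 1) - angle k n i)" by linarith
  qed
qed (simp_all add: angle_step angle_period tau_period del: ring_size.simps angle.simps)

text \<open>The bound is 1 for the radial step plus 4 for the angular one: the radius is at most
  \<open>n + 2\<close>, the gap at most \<open>2 / 2 ^ n\<close>.\<close>

lemma euclid_edge_bound:
  assumes "t \<in> euclid.T" "y \<in> t" "z \<in> t"
  shows "dist y z \<le> 5"
proof -
  have gap: "a * (angle k n (i + 1) - angle k n i) \<le> 4" if "0 \<le> a" "a \<le> real n + 2" for n i a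
  proof -
    have "2 * pi / of_int k \<le> 2 * 4 / 7" using k pi_less_4 by (intro frac_le) auto
    then have "2 * pi / of_int k / 2 ^ n \<le> 2 / 2 ^ n" by (intro divide_right_mono) auto
    then have g: "angle k n (i + 1) - angle k n i \<le> 2 / 2 ^ n" using angle_gap[of n i] by linarith
    have "real n + 2 \<le> 2 * 2 ^ n" by (induction n) auto
    then have "a * (angle k n (i + 1) - angle k n i) \<le> (2 * 2 ^ n) * (2 / 2 ^ n)"
      using g that angle_step[of n i] by (intro mult_mono) auto
    then show ?thesis by simp
  qed
  have yz: "y \<in> (\<lambda>x. x) ` t" "z \<in> (\<lambda>x. x) ` t" using assms by auto
  from assms(1) show ?thesis
  proof (cases rule: euclid.T_in_sector)
    case (1 n i)
    obtain r s where y: "y = polar r s" "angle k n i \<le> s" "s \<le> angle k n (i + 1)" "r \<in> {real n + 1, real (Suc n) + 1}"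
      using 1[OF yz(1)] by blast
    obtain r' s' where z: "z = polar r' s'" "angle k n i \<le> s'" "s' \<le> angle k n (i + 1)" "r' \<in> {real n + 1, real (Suc n) + 1}"
      using 1[OF yz(2)] by blast
    have r: "0 \<le> r" "r \<le> real n + 2" "\<bar>r - r'\<bar> \<le> 1" using y(4) z(4) by auto
    have "r * \<bar>s - s'\<bar> \<le> r * (angle k n (i + 1) - angle k n i)"
      using y z r by (intro mult_left_mono) auto
    then show ?thesis using dist_polar_le[OF r(1), of s r' s'] gap[OF r(1,2), of i] r(3) unfolding y(1) z(1) by linarith
  next
    case (2 i)
    obtain r s where y: "y = polar r s" "angle k 0 i \<le> s" "s \<le> angle k 0 (i + 1)" "r \<in> {0, real 0 + 1}"
      using 2[OF yz(1)] by blast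
    obtain r' s' where z: "z = polar r' s'" "angle k 0 i \<le> s'" "s' \<le> angle k 0 (i + 1)" "r' \<in> {0, real 0 + 1}"
      using 2[OF yz(2)] by blast
    have r: "0 \<le> r" "r \<le> real 0 + 2" "\<bar>r - r'\<bar> \<le> 1" using y(4) z(4) by auto
    have "r * \<bar>s - s'\<bar> \<le> r * (angle k 0 (i + 1) - angle k 0 i)"
      using y z r by (intro mult_left_mono) auto
    then show ?thesis using dist_polar_le[OF r(1), of s r' s'] gap[OF r(1,2), of i] r(3) unfolding y(1) z(1) by linarith
  qed
qed

lemma euclid_\<Omega>: "euclid.\<Omega> = UNIV"
proof -
  have "\<exists>m. norm x < real m + 1" for x :: "real^2"
    using reals_Archimedean2[of "norm x"] by (metis less_add_one less_trans)
  then show ?thesis by (auto simp: euclid.\<Omega>_def)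
qed

lemma euclidean_triangulation:
  "\<exists>(K :: (real^2) set set) (h :: (real^2 \<Rightarrow> real) \<Rightarrow> real^2).
      geometric_triangulation K h \<and> regular_cplx (nat k) K \<and> bounded_triangles K h"
proof (intro exI conjI)
  let ?h = "affine_extension (\<lambda>x::real^2. x)"
  show "geometric_triangulation euclid.cplx ?h"
    unfolding geometric_triangulation_def space_triangulation_def
  proof (intro conjI ballI)
    show "simplicial_cplx euclid.cplx" by (rule euclid.simplicial_cplx)
    show "locally_finite_cplx euclid.cplx" by (rule euclid.locally_finite_cplx)
    show "\<exists>g. homeomorphism (geom_realization euclid.cplx) UNIV ?h g"
      using euclid.homeomorphism_realization unfolding euclid_\<Omega> by blast
    show "geodesic_arc (?h ` closed_cell e)" if "e \<in> edges euclid.cplx" for e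
      using euclid.edge_segment[OF that] geodesic_arc_segment by metis
  qed
  show "regular_cplx (nat k) euclid.cplx"
  proof (rule euclid.regular)
    show "tau n i - tau n (i - 1) = int (nat k) - 4 - (if 0 < n \<and> i \<in> range (tau (n - 1)) then 1 else 0)" for n i
      unfolding tau_diff using k by (cases n) auto
  qed (use k in simp)
  show "bounded_triangles euclid.cplx ?h"
    unfolding bounded_triangles_def
  proof (intro exI ballI)
    fix t assume "t \<in> triangles euclid.cplx"
    then obtain t' where t: "t \<in> euclid.cplx" "t' \<in> euclid.T" "t \<subseteq> t'"
      by (auto simp: triangles_def generated_cplx_def)
    have "diameter (convex hull t) \<le> 5"
      using euclid_edge_bound[OF t(2)] t(3) by (intro diameter_hull_le) auto
    then show "diameter (?h ` closed_cell t) \<le> 5"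
      using euclid.image_face[OF t(1)] by simp
  qed
qed

end

section \<open>Geometry of the Klein model\<close>

lemma klein_inverse: "norm x < 1 \<Longrightarrow> klein_coords (of_klein_coords x) = x"
  by (simp add: of_klein_coords_inverse)

lemma norm_klein_coords: "norm (klein_coords p) < 1"
  using klein_coords[of p] by simp

lemma one_minus_inner_pos: "norm x < 1 \<Longrightarrow> 0 < 1 - x \<bullet> (x::real^2)"
  using klein_coords_pos[of "of_klein_coords x"] by (simp add: klein_inverse)

lemma klein_cosh_ge_one: "1 \<le> klein_cosh (klein_coords p) (klein_coords q)"
  by (intro klein_cosh_ge_1 klein_coords_pos)

lemma cosh_dist: "cosh (dist p q) = klein_cosh (klein_coords p) (klein_coords q)"
  using klein_cosh_ge_one[of p q] by (simp add: dist_hyperbolic_plane_def cosh_arcosh_real)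

text \<open>This gives the continuity of \<open>klein_coords\<close>. In the formula
  \<open>klein_cosh_sq\<close> for the square of the \<open>sinh\<close>, omitting a nonnegative
  square and a denominator at most 1 leaves the Euclidean distance.\<close>

lemma dist_klein_coords_le: "dist (klein_coords p) (klein_coords q) \<le> sinh (dist p q)"
proof -
  let ?x = "klein_coords p" and ?y = "klein_coords q"
  let ?a = "1 - ?x \<bullet> ?x" and ?b = "1 - ?y \<bullet> ?y"
  have pos: "0 < ?a" "0 < ?b" by (rule klein_coords_pos)+
  have "(dist ?x ?y)\<^sup>2 = (?x - ?y) \<bullet> (?x - ?y)"
    by (simp add: dist_norm power2_norm_eq_inner)
  also have "\<dots> \<le> ((?x - ?y) \<bullet> (?x - ?y)) / ?a"
    using pos by (simp add: le_divide_eq mult_left_le)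
  also have "\<dots> = (?b * ((?x - ?y) \<bullet> (?x - ?y))) / (?a * ?b)"
    using pos by simp
  also have "\<dots> \<le> (?b * ((?x - ?y) \<bullet> (?x - ?y)) + ((?x - ?y) \<bullet> ?y)\<^sup>2) / (?a * ?b)"
    using pos by (intro divide_right_mono) auto
  also have "\<dots> = (cosh (dist p q))\<^sup>2 - 1"
    unfolding cosh_dist klein_cosh_sq[OF pos] ..
  also have "\<dots> = (sinh (dist p q))\<^sup>2"
    by (simp add: sinh_square_eq)
  finally show ?thesis
    by (rule power2_le_imp_le) simp
qed

lemma continuous_on_klein_coords: "continuous_on UNIV klein_coords"
  unfolding continuous_on_def
proof
  fix p :: hyperbolic_plane
  have "((\<lambda>q. dist q p) \<longlongrightarrow> dist p p) (at p)"
    by (intro tendsto_intros)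
  then have "((\<lambda>q. sinh (dist q p)) \<longlongrightarrow> sinh (dist p p)) (at p)"
    by (rule tendsto_sinh)
  then have lim: "((\<lambda>q. sinh (dist q p)) \<longlongrightarrow> 0) (at p)" by simp
  have "((\<lambda>q. dist (klein_coords q) (klein_coords p)) \<longlongrightarrow> 0) (at p)"
    by (rule tendsto_sandwich[OF _ _ tendsto_const lim]) (auto simp: dist_klein_coords_le)
  then show "(klein_coords \<longlongrightarrow> klein_coords p) (at p within UNIV)"
    by (subst tendsto_dist_iff) simp
qed

lemma continuous_on_of_klein_coords: "continuous_on (ball 0 1) of_klein_coords"
  unfolding continuous_on_def
proof
  fix x :: "real^2" assume x: "x \<in> ball 0 1"
  have px: "0 < 1 - x \<bullet> x" using x by (intro one_minus_inner_pos) simp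
  have "((\<lambda>y. (1 - y \<bullet> x) / (sqrt (1 - y \<bullet> y) * sqrt (1 - x \<bullet> x))) \<longlongrightarrow>
      (1 - x \<bullet> x) / (sqrt (1 - x \<bullet> x) * sqrt (1 - x \<bullet> x))) (at x within ball 0 1)"
    by (intro tendsto_intros) (use px in auto)
  then have lim: "((\<lambda>y. klein_cosh y x) \<longlongrightarrow> 1) (at x within ball 0 1)"
    using px by (simp add: klein_cosh_def)
  have in_ball: "\<forall>\<^sub>F y in at x within ball 0 1. norm y < 1"
    by (auto simp: eventually_at_filter)
  have "((\<lambda>y. arcosh (klein_cosh y x)) \<longlongrightarrow> arcosh 1) (at x within ball 0 1)"
  \<comment> \<open>The limit 1 is the end point of the domain of \<open>arcosh\<close>, so the
    arguments must be known to stay at or above it.\<close>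
  proof (rule tendsto_arcosh_strong[OF lim])
    show "\<forall>\<^sub>F y in at x within ball 0 1. 1 \<le> klein_cosh y x"
      using in_ball by eventually_elim (rule klein_cosh_ge_1[OF one_minus_inner_pos px])
  qed simp
  then have "((\<lambda>y. arcosh (klein_cosh y x)) \<longlongrightarrow> 0) (at x within ball 0 1)" by simp
  moreover have "\<forall>\<^sub>F y in at x within ball 0 1. arcosh (klein_cosh y x) = dist (of_klein_coords y) (of_klein_coords x)"
    using in_ball by eventually_elim (use x in \<open>simp add: dist_hyperbolic_plane_def klein_inverse\<close>)
  ultimately have "((\<lambda>y. dist (of_klein_coords y) (of_klein_coords x)) \<longlongrightarrow> 0) (at x within ball 0 1)"
    by (rule Lim_transform_eventually)
  then show "(of_klein_coords \<longlongrightarrow> of_klein_coords x) (at x within ball 0 1)"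
    by (subst tendsto_dist_iff) simp
qed

lemma homeomorphism_klein: "homeomorphism (ball 0 1) UNIV of_klein_coords klein_coords"
  by (rule homeomorphismI)
    (auto simp: continuous_on_klein_coords continuous_on_of_klein_coords klein_inverse klein_coords_inverse
      norm_klein_coords)

text \<open>In hyperboloid coordinates the geodesic from \<open>x\<close> to \<open>y\<close> is
  \<open>(sinh (L - t) X + sinh t Y) / sinh L\<close>; projecting to the Klein disc gives the segment.\<close>

lemma sinh_product_identity:
  fixes L r s :: real
  shows "sinh (L - r) * sinh (L - s) + sinh r * sinh s +
      cosh L * (sinh (L - r) * sinh s + sinh r * sinh (L - s)) = (sinh L)\<^sup>2 * cosh (r - s)"
proof -
  have "sinh (L - r) * sinh (L - s) + sinh r * sinh s +
      cosh L * (sinh (L - r) * sinh s + sinh r * sinh (L - s)) =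
      (sinh L)\<^sup>2 * cosh r * cosh s + sinh r * sinh s - (cosh L)\<^sup>2 * sinh r * sinh s"
    by (simp add: sinh_diff power2_eq_square algebra_simps)
  also have "\<dots> = (sinh L)\<^sup>2 * cosh (r - s)"
    unfolding cosh_square_eq by (simp add: cosh_diff algebra_simps)
  finally show ?thesis .
qed

text \<open>On the hyperboloid let \<open>X = (x, 1) / a\<close> and \<open>Y = (y, 1) / b\<close>.
  Before division by \<open>sinh L\<close>, the geodesic has the coefficients \<alpha> and \<beta>
  with respect to \<open>(x, 1)\<close> and \<open>(y, 1)\<close>, and \<open>w\<close> is its last
  coordinate; dividing by \<open>w\<close> projects it to \<open>c\<close>.\<close>

lemma geodesic_arc_klein_segment:
  assumes "p \<noteq> q"
  shows "geodesic_arc (of_klein_coords ` closed_segment (klein_coords p) (klein_coords q))"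
proof -
  define x y where "x = klein_coords p" and "y = klein_coords q"
  define L where "L = dist p q"
  define a b where "a = sqrt (1 - x \<bullet> x)" and "b = sqrt (1 - y \<bullet> y)"
  define \<alpha> \<beta> where "\<alpha> t = sinh (L - t) / a" and "\<beta> t = sinh t / b" for t
  define w where "w t = \<alpha> t + \<beta> t" for t
  define c where "c t = (\<beta> t / w t) *\<^sub>R y + (\<alpha> t / w t) *\<^sub>R x" for t
  have L: "0 < L" using assms by (simp add: L_def)
  have ab: "0 < a" "0 < b" "a\<^sup>2 = 1 - x \<bullet> x" "b\<^sup>2 = 1 - y \<bullet> y"
    using klein_coords_pos[of p] klein_coords_pos[of q] by (simp_all add: a_def b_def x_def y_def)
  have C: "1 - x \<bullet> y = cosh L * (a * b)"
    using ab unfolding L_def cosh_dist by (simp add: klein_cosh_def a_def b_def x_def y_def)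
  have nonneg: "0 \<le> \<alpha> t" "0 \<le> \<beta> t" "0 < w t" if "t \<in> {0..L}" for t
  proof -
    show 1: "0 \<le> \<alpha> t" "0 \<le> \<beta> t" using that ab by (simp_all add: \<alpha>_def \<beta>_def)
    have "0 < \<alpha> t \<or> 0 < \<beta> t" using that ab L by (cases "t = 0") (simp_all add: \<alpha>_def \<beta>_def)
    with 1 show "0 < w t" by (auto simp: w_def)
  qed
  \<comment> \<open>Up to scaling this is the Lorentz product of two lifted points. The case
    \<open>r = s\<close> gives the roots in \<open>klein_cosh\<close>, and the quotient reduces to
    \<open>cosh (r - s)\<close>.\<close>
  have form: "1 - c r \<bullet> c s = (sinh L)\<^sup>2 * cosh (r - s) / (w r * w s)" if "r \<in> {0..L}" "s \<in> {0..L}" for r s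
  proof -
    note n = nonneg[OF that(1)] nonneg[OF that(2)]
    have cw: "w t *\<^sub>R c t = \<beta> t *\<^sub>R y + \<alpha> t *\<^sub>R x" if "t \<in> {0..L}" for t
      using nonneg(3)[OF that] by (simp add: c_def scaleR_add_right)
    have "w r * w s * (1 - c r \<bullet> c s) = w r * w s - (w r *\<^sub>R c r) \<bullet> (w s *\<^sub>R c s)"
      by (simp add: algebra_simps)
    also have "\<dots> = \<alpha> r * \<alpha> s * a\<^sup>2 + \<beta> r * \<beta> s * b\<^sup>2 + (\<alpha> r * \<beta> s + \<beta> r * \<alpha> s) * (1 - x \<bullet> y)"
      unfolding cw[OF that(1)] cw[OF that(2)] ab(3,4)
      by (simp add: w_def inner_add_left inner_add_right inner_commute algebra_simps)
    also have "\<dots> = (\<alpha> r * a) * (\<alpha> s * a) + (\<beta> r * b) * (\<beta> s * b)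
        + cosh L * ((\<alpha> r * a) * (\<beta> s * b) + (\<beta> r * b) * (\<alpha> s * a))"
      unfolding C by (simp add: algebra_simps power2_eq_square)
    also have "\<dots> = (sinh L)\<^sup>2 * cosh (r - s)"
      using ab by (simp add: \<alpha>_def \<beta>_def sinh_product_identity)
    finally have eq: "w r * w s * (1 - c r \<bullet> c s) = (sinh L)\<^sup>2 * cosh (r - s)" .
    show ?thesis unfolding eq[symmetric] using n by simp
  qed
  have seg: "c t \<in> closed_segment x y" if "t \<in> {0..L}" for t
  proof -
    have "\<beta> t / w t + \<alpha> t / w t = 1"
      using nonneg[OF that] by (simp add: w_def flip: add_divide_distrib)
    then have "\<alpha> t / w t = 1 - \<beta> t / w t" by linarith
    then have "c t = (1 - \<beta> t / w t) *\<^sub>R x + (\<beta> t / w t) *\<^sub>R y"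
      unfolding c_def by (simp only: add.commute)
    moreover have "\<beta> t / w t \<le> 1" "0 \<le> \<beta> t / w t"
      using nonneg[OF that] by (simp_all add: w_def divide_le_eq)
    ultimately show ?thesis unfolding closed_segment_def by blast
  qed
  have segball: "closed_segment x y \<subseteq> ball 0 1"
    by (rule closed_segment_subset) (auto simp: x_def y_def norm_klein_coords)
  have ball: "norm (c t) < 1" if "t \<in> {0..L}" for t
    using seg[OF that] segball by auto
  define \<gamma> where "\<gamma> t = of_klein_coords (c t)" for t
  have dist: "dist (\<gamma> r) (\<gamma> s) = \<bar>r - s\<bar>" if rs: "r \<in> {0..L}" "s \<in> {0..L}" for r s
  proof -
    have sL: "0 < sinh L" using L by simp
    have root: "sqrt (1 - c t \<bullet> c t) = sinh L / w t" if "t \<in> {0..L}" for t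
      using form[OF that that] sL nonneg(3)[OF that] by (simp add: real_sqrt_divide power2_eq_square[symmetric])
    have "klein_cosh (c r) (c s) = cosh (r - s)"
      unfolding klein_cosh_def root[OF rs(1)] root[OF rs(2)] form[OF rs]
      using sL nonneg(3)[OF rs(1)] nonneg(3)[OF rs(2)] by (simp add: power2_eq_square)
    also have "\<dots> = cosh \<bar>r - s\<bar>" by (simp add: abs_if)
    finally have "klein_cosh (c r) (c s) = cosh \<bar>r - s\<bar>" .
    then have "dist (\<gamma> r) (\<gamma> s) = arcosh (cosh \<bar>r - s\<bar>)"
      by (simp only: \<gamma>_def dist_hyperbolic_plane_def klein_inverse[OF ball[OF rs(1)]] klein_inverse[OF ball[OF rs(2)]])
    then show ?thesis by (simp only: arcosh_cosh_real abs_ge_zero)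
  qed
  have inj: "inj_on \<gamma> {0..L}"
  proof
    fix r s assume "r \<in> {0..L}" "s \<in> {0..L}" "\<gamma> r = \<gamma> s"
    with dist[of r s] show "r = s" by simp
  qed
  have image: "c ` {0..L} = closed_segment x y"
  proof
    show "c ` {0..L} \<subseteq> closed_segment x y" using seg by blast
    \<comment> \<open>The weight of \<open>y\<close> runs continuously from 0 to 1, so every point
      of the segment is reached.\<close>
    show "closed_segment x y \<subseteq> c ` {0..L}"
    proof
      fix z assume "z \<in> closed_segment x y"
      then obtain u where u: "0 \<le> u" "u \<le> 1" "z = (1 - u) *\<^sub>R x + u *\<^sub>R y" by (auto simp: closed_segment_def)
      have "continuous_on {0..L} (\<lambda>t. \<beta> t / w t)"
        unfolding \<alpha>_def \<beta>_def w_def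
        by (intro continuous_intros) (use nonneg(3) ab in \<open>force simp: \<alpha>_def \<beta>_def w_def\<close>)+
      moreover have "\<beta> 0 / w 0 = 0" "\<beta> L / w L = 1"
        using nonneg(3)[of L] L ab by (simp_all add: \<beta>_def w_def \<alpha>_def)
      ultimately obtain t where t: "t \<in> {0..L}" "\<beta> t / w t = u"
        using IVT'[of "\<lambda>t. \<beta> t / w t" 0 u L] u L by auto
      have "\<alpha> t / w t = 1 - \<beta> t / w t"
        using nonneg[OF t(1)] by (simp add: w_def field_simps)
      then have "c t = z" unfolding c_def u(3) t(2) by simp
      with t show "z \<in> c ` {0..L}" by blast
    qed
  qed
  have "\<gamma> ` {0..L} = of_klein_coords ` closed_segment x y"
    unfolding image[symmetric] by (auto simp: \<gamma>_def)
  then show ?thesis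
    unfolding geodesic_arc_def x_def[symmetric] y_def[symmetric] using L inj dist
    by (intro exI[of _ L] conjI exI[of _ \<gamma>]) (auto intro!: exI[of _ 1])
qed

text \<open>Membership in such a hyperbolic ball compares an affine function of \<open>x\<close>
  with a nonnegative multiple of \<open>sqrt (1 - x \<bullet> x)\<close>, which is concave since its
  graph is a hemisphere.\<close>

lemma klein_cosh_ball_convex:
  assumes "norm p < 1" "0 \<le> c"
  shows "convex {x. norm x < 1 \<and> klein_cosh p x \<le> c}"
proof (rule convexI)
  fix x y and u v :: real
  assume x: "x \<in> {x. norm x < 1 \<and> klein_cosh p x \<le> c}" and y: "y \<in> {x. norm x < 1 \<and> klein_cosh p x \<le> c}"
    and uv: "0 \<le> u" "0 \<le> v" "u + v = 1"
  define sp where "sp = sqrt (1 - p \<bullet> p)"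
  have sp: "0 < sp" using one_minus_inner_pos[OF assms(1)] by (simp add: sp_def)
  define h where "h z = sqrt (1 - z \<bullet> z)" for z :: "real^2"
  have h: "0 < h z" "(h z)\<^sup>2 = 1 - z \<bullet> z" if "norm z < 1" for z
    using one_minus_inner_pos[OF that] by (simp_all add: h_def)
  have iff: "klein_cosh p z \<le> c \<longleftrightarrow> 1 - p \<bullet> z \<le> c * sp * h z" if "norm z < 1" for z
    using sp h(1)[OF that] by (simp add: klein_cosh_def divide_le_eq h_def sp_def mult_ac)
  let ?z = "u *\<^sub>R x + v *\<^sub>R y"
  have z: "norm ?z < 1"
    using convexD[OF convex_ball, of x 0 1 y u v] x y uv by simp
  \<comment> \<open>Points of the graph of \<open>h\<close> are unit vectors, so their convex
    combinations stay in the closed unit ball. This is the concavity of \<open>h\<close>.\<close>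
  have unit: "norm (z, h z) = 1" if "norm z < 1" for z
    using h(2)[OF that] by (simp add: norm_Pair power2_norm_eq_inner)
  have "norm (u *\<^sub>R (x, h x)) = u" "norm (v *\<^sub>R (y, h y)) = v"
    using unit[of x] unit[of y] x y uv by (simp_all del: scaleR_Pair)
  then have "norm (u *\<^sub>R (x, h x) + v *\<^sub>R (y, h y)) \<le> 1"
    using norm_triangle_ineq[of "u *\<^sub>R (x, h x)" "v *\<^sub>R (y, h y)"] uv by linarith
  then have "norm (?z, u * h x + v * h y) \<le> 1"
    using uv by simp
  then have "(norm (?z, u * h x + v * h y))\<^sup>2 \<le> 1"
    by (simp add: power_le_one)
  then have "(u * h x + v * h y)\<^sup>2 \<le> (h ?z)\<^sup>2"
    using h(2)[OF z] by (simp add: norm_Pair power2_norm_eq_inner)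
  then have conc: "u * h x + v * h y \<le> h ?z"
    by (rule power2_le_imp_le) (use h(1)[OF z] in simp)
  have "1 - p \<bullet> ?z = (u + v) - p \<bullet> ?z" by (simp add: uv(3))
  also have "\<dots> = u * (1 - p \<bullet> x) + v * (1 - p \<bullet> y)"
    by (simp add: inner_add_right algebra_simps)
  also have "\<dots> \<le> u * (c * sp * h x) + v * (c * sp * h y)"
    using x y uv iff by (intro add_mono mult_left_mono) auto
  also have "\<dots> = c * sp * (u * h x + v * h y)" by (simp add: algebra_simps)
  also have "\<dots> \<le> c * sp * h ?z"
    using conc sp assms(2) by (intro mult_left_mono) auto
  finally show "?z \<in> {x. norm x < 1 \<and> klein_cosh p x \<le> c}"
    using z iff[OF z] by simp
qed

text \<open>The two-stage argument of \<open>diameter_hull_le\<close> works here because hyperbolic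
  balls are convex in Klein coordinates.\<close>

lemma klein_hull_diameter_le:
  assumes S: "\<And>x. x \<in> S \<Longrightarrow> norm x < 1"
    and c: "\<And>x y. x \<in> S \<Longrightarrow> y \<in> S \<Longrightarrow> klein_cosh x y \<le> c" "1 \<le> c"
  shows "diameter (of_klein_coords ` (convex hull S)) \<le> arcosh c"
proof -
  have in_ball: "norm x < 1" if "x \<in> convex hull S" for x
  proof -
    have "convex hull S \<subseteq> ball 0 1" by (rule hull_minimal) (use S in auto)
    with that show ?thesis by auto
  qed
  have le: "klein_cosh x y \<le> c" if x: "x \<in> convex hull S" and y: "y \<in> convex hull S" for x y
  proof -
    have "convex hull S \<subseteq> {x. norm x < 1 \<and> klein_cosh z x \<le> c}" if "z \<in> S" for z
      by (rule hull_minimal) (use S c that in \<open>auto intro: klein_cosh_ball_convex\<close>)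
    then have "S \<subseteq> {z. norm z < 1 \<and> klein_cosh x z \<le> c}"
      using x S by (auto simp: klein_cosh_commute[of x])
    then have "convex hull S \<subseteq> {z. norm z < 1 \<and> klein_cosh x z \<le> c}"
      by (rule hull_minimal) (use in_ball[OF x] c in \<open>auto intro: klein_cosh_ball_convex\<close>)
    with y show ?thesis by auto
  qed
  have d: "dist p q \<le> arcosh c" if "p \<in> of_klein_coords ` (convex hull S)" "q \<in> of_klein_coords ` (convex hull S)" for p q
  proof -
    obtain x y where xy: "x \<in> convex hull S" "y \<in> convex hull S" "p = of_klein_coords x" "q = of_klein_coords y"
      using \<open>p \<in> _\<close> \<open>q \<in> _\<close> by blast
    have "1 \<le> klein_cosh x y"
      using in_ball xy by (intro klein_cosh_ge_1 one_minus_inner_pos) auto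
    then have "arcosh (klein_cosh x y) \<le> arcosh c"
      using le[OF xy(1,2)] arcosh_less_iff_real[of c "klein_cosh x y"] c(2) by (simp flip: not_less)
    then show ?thesis using xy in_ball by (simp add: dist_hyperbolic_plane_def klein_inverse)
  qed
  have "0 \<le> arcosh c" using c by (simp add: arcosh_nonneg_real)
  then show ?thesis
    unfolding diameter_def using d by (auto intro!: cSUP_least)
qed

section \<open>Degree six in the hyperbolic plane\<close>

text \<open>With \<open>2 ^ l \<le> m < 2 ^ Suc l\<close>, the first \<open>m - 2 ^ l\<close> of the \<open>2 ^ l\<close> equal gaps of the unit interval
  are halved. Passing from \<open>m\<close> to \<open>m + 1\<close> halves the next gap.\<close>

definition dyadic :: "nat \<Rightarrow> nat \<Rightarrow> int \<Rightarrow> real" where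
  "dyadic l m x = max (of_int x / 2 ^ Suc l) (1 - of_int (int m - x) / 2 ^ l)"

definition fraction :: "nat \<Rightarrow> int \<Rightarrow> real" where
  "fraction m = dyadic (floor_log m) m"

lemma floor_log_bounds: "0 < m \<Longrightarrow> 2 ^ floor_log m \<le> m" "m < 2 ^ Suc (floor_log m)"
  using floor_log_exp2_le[of m] floor_log_exp2_gt[of m] by auto

lemma real_floor_log_bounds:
  assumes "0 < m"
  shows "2 ^ floor_log m \<le> real m" "real m < 2 ^ Suc (floor_log m)"
proof -
  have "real (2 ^ floor_log m) \<le> real m" "real m < real (2 ^ Suc (floor_log m))"
    using floor_log_bounds[of m] assms by (simp_all only: of_nat_le_iff of_nat_less_iff)
  then show "2 ^ floor_log m \<le> real m" "real m < 2 ^ Suc (floor_log m)" by simp_all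
qed

text \<open>Short steps come before long ones, so the subdivision points form a convex sequence, the
  maximum of two linear ones. Each of its steps lies between the two slopes.\<close>

lemma dyadic_step: "dyadic l m x < dyadic l m (x + 1)" "dyadic l m (x + 1) - dyadic l m x \<le> 1 / 2 ^ l"
proof -
  have 1: "of_int (x + 1) / 2 ^ Suc l = of_int x / 2 ^ Suc l + 1 / (2 ^ Suc l :: real)"
    by (simp add: add_divide_distrib)
  have 2: "1 - of_int (int m - (x + 1)) / 2 ^ l = 1 - of_int (int m - x) / 2 ^ l + 1 / (2 ^ l :: real)"
    by (simp add: diff_divide_distrib add_divide_distrib)
  have "0 < 1 / (2 ^ Suc l :: real)" "1 / (2 ^ Suc l :: real) \<le> 1 / 2 ^ l" "0 < 1 / (2 ^ l :: real)"
    by (simp_all add: field_simps)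
  then show "dyadic l m x < dyadic l m (x + 1)" "dyadic l m (x + 1) - dyadic l m x \<le> 1 / 2 ^ l"
    unfolding dyadic_def 1 2 by linarith+
qed

lemma dyadic_between: "dyadic l m x \<le> dyadic l (Suc m) (x + 1)" "dyadic l (Suc m) x \<le> dyadic l m x"
proof -
  have "of_int x / 2 ^ Suc l \<le> (of_int (x + 1) / 2 ^ Suc l :: real)"
    by (intro divide_right_mono) auto
  moreover have "int (Suc m) - (x + 1) = int m - x" by simp
  ultimately show "dyadic l m x \<le> dyadic l (Suc m) (x + 1)"
    unfolding dyadic_def by (metis max.mono order_refl)
  have "1 - of_int (int (Suc m) - x) / 2 ^ l \<le> (1 - of_int (int m - x) / 2 ^ l :: real)"
    by (intro diff_left_mono divide_right_mono) auto
  then show "dyadic l (Suc m) x \<le> dyadic l m x"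
    unfolding dyadic_def by (metis max.mono order_refl)
qed

text \<open>Over the denominator \<open>2 ^ Suc l\<close> the two branches are integers
  \<open>A\<close> and \<open>B\<close>. Passing to \<open>Suc m\<close> turns
  \<open>max A B\<close> into \<open>max A (B - 2)\<close> at \<open>x\<close> and into
  \<open>max (A + 1) B\<close> at \<open>x + 1\<close>. The former keeps the old value if
  \<open>B \<le> A\<close>, the latter if \<open>A < B\<close>.\<close>

lemma dyadic_nested: "dyadic l (Suc m) x = dyadic l m x \<or> dyadic l (Suc m) (x + 1) = dyadic l m x"
proof -
  define A where "A = x"
  define B where "B = 2 ^ Suc l - 2 * (int m - x)"
  have A: "of_int x / 2 ^ Suc l = (of_int A / 2 ^ Suc l :: real)" by (simp add: A_def)
  have B: "1 - of_int (int m - x) / 2 ^ l = (of_int B / 2 ^ Suc l :: real)"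
    by (simp add: B_def field_simps)
  have A1: "of_int (x + 1) / 2 ^ Suc l = (of_int (A + 1) / 2 ^ Suc l :: real)" by (simp add: A_def)
  have B1: "1 - of_int (int (Suc m) - (x + 1)) / 2 ^ l = (of_int B / 2 ^ Suc l :: real)"
    by (simp add: B_def field_simps)
  have B2: "1 - of_int (int (Suc m) - x) / 2 ^ l = (of_int (B - 2) / 2 ^ Suc l :: real)"
    by (simp add: B_def field_simps)
  have le: "(of_int p / 2 ^ Suc l :: real) \<le> of_int q / 2 ^ Suc l \<longleftrightarrow> p \<le> q" for p q
    by (simp add: divide_le_cancel)
  show ?thesis
  proof (cases "B \<le> A")
    case True
    then show ?thesis unfolding dyadic_def A B B2 max_def le by auto
  next
    case False
    then show ?thesis unfolding dyadic_def A B A1 B1 max_def le by auto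
  qed
qed

text \<open>At a power of two the formulas for the two adjacent levels agree.\<close>

lemma fraction_Suc:
  assumes "0 < m" "0 \<le> x" "x \<le> int (Suc m)"
  shows "fraction (Suc m) x = dyadic (floor_log m) (Suc m) x"
proof (cases "Suc m = 2 ^ Suc (floor_log m)")
  \<comment> \<open>The new level attains its maximum in the second branch, the old level in the
    first; both equal \<open>x / 2 ^ Suc l\<close>.\<close>
  case True
  define l where "l = floor_log m"
  have l: "floor_log (Suc m) = Suc l" using True by (metis floor_log_power l_def)
  have m: "real (Suc m) = 2 * 2 ^ l" using arg_cong[OF True, of real] by (simp add: l_def)
  have x: "0 \<le> real_of_int x" "real_of_int x \<le> 2 * 2 ^ l" using assms m by linarith+
  have e: "real_of_int (int (Suc m) - x) = 2 * 2 ^ l - of_int x" using m by simp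
  have "1 - of_int (int (Suc m) - x) / 2 ^ Suc l = (of_int x / 2 ^ Suc l :: real)"
    unfolding e by (simp add: field_simps)
  moreover have "of_int x / 2 ^ Suc (Suc l) \<le> (of_int x / 2 ^ Suc l :: real)"
    using x by (simp add: field_simps)
  ultimately have "fraction (Suc m) x = of_int x / 2 ^ Suc l"
    unfolding fraction_def dyadic_def l by (simp add: max_def)
  moreover have "1 - of_int (int (Suc m) - x) / 2 ^ l \<le> (of_int x / 2 ^ Suc l :: real)"
    unfolding e using x by (simp add: field_simps)
  then have "dyadic l (Suc m) x = of_int x / 2 ^ Suc l"
    unfolding dyadic_def by (simp add: max_def)
  ultimately show ?thesis by (simp add: l_def)
next
  case False
  have "2 ^ floor_log m \<le> Suc m" "Suc m < 2 * 2 ^ floor_log m"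
    using floor_log_bounds[of m] assms False by auto
  then have "floor_log (Suc m) = floor_log m"
    using assms by (intro floor_log_eqI) auto
  then show ?thesis by (simp add: fraction_def)
qed

lemma fraction_ends:
  assumes "0 < m"
  shows "fraction m 0 = 0" "fraction m (int m) = 1"
proof -
  let ?L = "2 ^ floor_log m :: real"
  have "1 - real m / ?L \<le> 0" "real m / (2 * ?L) \<le> 1"
    using real_floor_log_bounds[OF assms] by (simp_all add: field_simps)
  then show "fraction m 0 = 0" "fraction m (int m) = 1"
    by (simp_all add: fraction_def dyadic_def max_def)
qed

lemma fraction_step: "fraction m x < fraction m (x + 1)"
  by (simp add: fraction_def dyadic_step)

lemma fraction_gap: "0 < m \<Longrightarrow> fraction m (x + 1) - fraction m x \<le> 2 / real m"
proof -
  assume m: "0 < m"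
  have "fraction m (x + 1) - fraction m x \<le> 1 / 2 ^ floor_log m"
    unfolding fraction_def by (rule dyadic_step)
  also have "\<dots> \<le> 2 / real m"
    using real_floor_log_bounds[OF m] m by (simp add: field_simps)
  finally show ?thesis .
qed

lemma fraction_gap_le_1: "fraction m (x + 1) - fraction m x \<le> 1"
proof -
  have "fraction m (x + 1) - fraction m x \<le> 1 / 2 ^ floor_log m"
    unfolding fraction_def by (rule dyadic_step)
  also have "\<dots> \<le> 1" by (simp add: divide_le_eq)
  finally show ?thesis .
qed

lemma fraction_refine:
  assumes "0 < m" "0 \<le> x" "x < int m"
  shows "fraction m x \<le> fraction (Suc m) (x + 1)" "fraction (Suc m) (x + 1) \<le> fraction m (x + 1)"
    "fraction (Suc m) x = fraction m x \<or> fraction (Suc m) (x + 1) = fraction m x"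
  using fraction_Suc[OF assms(1), of x] fraction_Suc[OF assms(1), of "x + 1"] assms
    dyadic_between[of "floor_log m" m x] dyadic_between(2)[of "floor_log m" m "x + 1"] dyadic_nested[of "floor_log m" m x]
  by (simp_all add: fraction_def)

text \<open>Ring \<open>n\<close> has \<open>6 (n + 1)\<close> vertices, six of them on fixed rays. The complex is the triangular lattice.\<close>

definition hex_angle :: "nat \<Rightarrow> int \<Rightarrow> real" where
  "hex_angle n i = pi / 3 * (of_int (i div int (Suc n)) + fraction (Suc n) (i mod int (Suc n)))"

text \<open>A side of the hexagon with \<open>n + 1\<close> gaps faces a side with
  \<open>n + 2\<close> gaps in the next layer. The child of gap \<open>x\<close> on a side is vertex
  \<open>x + 1\<close> on the same side; the quotient accounts for the vertices gained on earlier
  sides.\<close>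

definition hex_child :: "nat \<Rightarrow> int \<Rightarrow> int" where
  "hex_child n i = i + i div int (Suc n) + 1"

text \<open>The hyperbolic radius \<rho> satisfies \<open>tanh \<rho> = klein_radius n\<close>,
  hence \<open>cosh \<rho> = n + 2\<close>, so the length of the circle grows linearly like its
  number of vertices. The shift by 2 keeps ring 0 away from the centre.\<close>

definition klein_radius :: "nat \<Rightarrow> real" where
  "klein_radius n = sqrt (1 - 1 / (real n + 2)\<^sup>2)"

lemma sector_index: obtains s x where "i = s * int (Suc n) + x" "0 \<le> x" "x < int (Suc n)"
  using that[of "i div int (Suc n)" "i mod int (Suc n)"] div_mult_mod_eq[of i "int (Suc n)"]
  by (simp del: of_nat_Suc)

lemma hex_angle_at:
  assumes "0 \<le> x" "x \<le> int (Suc n)"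
  shows "hex_angle n (s * int (Suc n) + x) = pi / 3 * (of_int s + fraction (Suc n) x)"
proof (cases "x = int (Suc n)")
  case True
  have "s * int (Suc n) + int (Suc n) = (s + 1) * int (Suc n)" by (simp add: algebra_simps)
  then show ?thesis unfolding True hex_angle_def
    by (simp del: of_nat_Suc add: fraction_ends)
next
  case False
  then show ?thesis unfolding hex_angle_def using assms
    by (simp del: of_nat_Suc)
qed

lemma hex_child_at:
  assumes "0 \<le> x" "x < int (Suc n)"
  shows "hex_child n (s * int (Suc n) + x) = s * int (Suc (Suc n)) + (x + 1)"
proof -
  have "(s * int (Suc n) + x) div int (Suc n) = s"
    using assms by (simp del: of_nat_Suc)
  then show ?thesis unfolding hex_child_def by (simp add: algebra_simps)
qed

lemma hex_angle_step:
  "hex_angle n i < hex_angle n (i + 1)"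
  "hex_angle n (i + 1) - hex_angle n i \<le> pi / 3"
  "hex_angle n (i + 1) - hex_angle n i \<le> 3 / real (Suc n)"
proof -
  obtain s x where i: "i = s * int (Suc n) + x" "0 \<le> x" "x < int (Suc n)" by (rule sector_index)
  have e: "hex_angle n i = pi / 3 * (of_int s + fraction (Suc n) x)"
    "hex_angle n (i + 1) = pi / 3 * (of_int s + fraction (Suc n) (x + 1))"
    unfolding i(1) using i hex_angle_at[of x n s] hex_angle_at[of "x + 1" n s]
    by (simp_all add: add.assoc del: of_nat_Suc)
  let ?d = "fraction (Suc n) (x + 1) - fraction (Suc n) x"
  have d: "hex_angle n (i + 1) - hex_angle n i = pi / 3 * ?d"
    unfolding e by (simp add: right_diff_distrib distrib_left)
  have pos: "0 < ?d" using fraction_step[of "Suc n" x] by simp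
  have "0 < pi / 3 * ?d" using pos by simp
  then show "hex_angle n i < hex_angle n (i + 1)" using d by linarith
  have "pi / 3 * ?d \<le> pi / 3 * 1"
    using fraction_gap_le_1[of "Suc n" x] by (intro mult_left_mono) auto
  then show "hex_angle n (i + 1) - hex_angle n i \<le> pi / 3" unfolding d by simp
  \<comment> \<open>By \<open>pi < 4\<close> and \<open>fraction_gap\<close> the factor is
    \<open>8 / 3\<close>, rounded up to 3.\<close>
  have "pi / 3 * ?d \<le> (4 / 3) * (2 / real (Suc n))"
    using fraction_gap[of "Suc n" x] pos pi_less_4 by (intro mult_mono) auto
  also have "\<dots> \<le> 3 / real (Suc n)" by (simp add: field_simps)
  finally show "hex_angle n (i + 1) - hex_angle n i \<le> 3 / real (Suc n)" unfolding d .
qed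

lemma hex_angle_period: "hex_angle n (i + 6 * int (Suc n)) = hex_angle n i + 2 * pi"
  unfolding hex_angle_def by (simp del: of_nat_Suc add: distrib_left)

lemma hex_child_period: "hex_child n (i + 6 * int (Suc n)) = hex_child n i + 6 * int (Suc (Suc n))"
proof -
  have "(i + 6 * int (Suc n)) div int (Suc n) = i div int (Suc n) + 6"
    by (simp del: of_nat_Suc)
  then show ?thesis unfolding hex_child_def by simp
qed

text \<open>Multiples of \<open>Suc n\<close> are the corners of the hexagon. Going past a corner
  enters a new side, where the next layer has gained a vertex.\<close>

lemma hex_child_diff: "hex_child n i - hex_child n (i - 1) = (if int (Suc n) dvd i then 2 else 1)"
proof -
  obtain s x where i: "i - 1 = s * int (Suc n) + x" "0 \<le> x" "x < int (Suc n)" by (rule sector_index)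
  have c: "hex_child n (i - 1) = s * int (Suc (Suc n)) + (x + 1)"
    unfolding i(1) by (rule hex_child_at) (use i in auto)
  have eq: "i = s * int (Suc n) + (x + 1)" using i(1) by simp
  show ?thesis
  proof (cases "x + 1 = int (Suc n)")
    case True
    have i': "i = (s + 1) * int (Suc n) + 0" unfolding eq True by (simp add: algebra_simps)
    have "hex_child n i = (s + 1) * int (Suc (Suc n)) + (0 + 1)"
      unfolding i' by (rule hex_child_at) auto
    moreover have "int (Suc n) dvd i" unfolding i' by simp
    ultimately show ?thesis unfolding c True by (simp add: algebra_simps)
  next
    case False
    then have x: "0 < x + 1" "x + 1 < int (Suc n)" using i by auto
    have "hex_child n i = s * int (Suc (Suc n)) + (x + 1 + 1)"
      unfolding eq by (rule hex_child_at) (use x in auto)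
    moreover have "\<not> int (Suc n) dvd i"
      unfolding eq using x zdvd_not_zless[OF x] by (simp add: dvd_add_right_iff del: of_nat_Suc)
    ultimately show ?thesis unfolding c by simp
  qed
qed

text \<open>Children fill the positions \<open>x + 1\<close> of each side and miss only its corner.
  So a corner has one parent fewer, which balances its additional child in
  \<open>hex_child_diff\<close>.\<close>

lemma hex_child_range: "i \<in> range (hex_child n) \<longleftrightarrow> \<not> int (Suc (Suc n)) dvd i"
proof
  assume "i \<in> range (hex_child n)"
  then obtain j where j: "i = hex_child n j" by auto
  obtain s x where jx: "j = s * int (Suc n) + x" "0 \<le> x" "x < int (Suc n)" by (rule sector_index)
  have i: "i = s * int (Suc (Suc n)) + (x + 1)"
    unfolding j jx(1) by (rule hex_child_at) (use jx in auto)
  have x: "0 < x + 1" "x + 1 < int (Suc (Suc n))" using jx by auto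
  show "\<not> int (Suc (Suc n)) dvd i"
    unfolding i using zdvd_not_zless[OF x] by (simp add: dvd_add_right_iff del: of_nat_Suc)
next
  assume nd: "\<not> int (Suc (Suc n)) dvd i"
  obtain s x where ix: "i = s * int (Suc (Suc n)) + x" "0 \<le> x" "x < int (Suc (Suc n))" by (rule sector_index)
  have "x \<noteq> 0" using nd ix(1) by auto
  then have "hex_child n (s * int (Suc n) + (x - 1)) = s * int (Suc (Suc n)) + (x - 1 + 1)"
    using ix by (intro hex_child_at) auto
  then have "i = hex_child n (s * int (Suc n) + (x - 1))" using ix(1) by simp
  then show "i \<in> range (hex_child n)" by blast
qed

section \<open>Ring radii and the triangulation of the hyperbolic plane\<close>

lemma klein_radius: "0 < klein_radius n" "klein_radius n < 1" "1 - (klein_radius n)\<^sup>2 = 1 / (real n + 2)\<^sup>2"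
proof -
  have "1 < (real n + 2)\<^sup>2" by (simp add: one_less_power)
  then have "0 < 1 - 1 / (real n + 2)\<^sup>2" "0 < 1 / (real n + 2)\<^sup>2" by (simp_all add: field_simps)
  then show "0 < klein_radius n" "klein_radius n < 1" "1 - (klein_radius n)\<^sup>2 = 1 / (real n + 2)\<^sup>2"
    by (simp_all add: klein_radius_def)
qed

lemma klein_radius_mono: "strict_mono klein_radius"
proof (rule strict_monoI)
  fix m n :: nat assume "m < n"
  then have "(real m + 2)\<^sup>2 < (real n + 2)\<^sup>2" by (intro power_strict_mono) auto
  then have "1 / (real n + 2)\<^sup>2 < 1 / (real m + 2)\<^sup>2" by (intro divide_strict_left_mono) auto
  then show "klein_radius m < klein_radius n" by (simp add: klein_radius_def)
qed

lemma klein_radius_tendsto: "klein_radius \<longlonglongrightarrow> 1"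
proof -
  have "(\<lambda>n. 1 / (real n + 2)\<^sup>2) \<longlonglongrightarrow> 0"
    by real_asymp
  then have "(\<lambda>n. sqrt (1 - 1 / (real n + 2)\<^sup>2)) \<longlonglongrightarrow> sqrt (1 - 0)"
    by (intro tendsto_intros)
  then show ?thesis by (simp add: klein_radius_def[abs_def])
qed

text \<open>The radii have the finite limit 1, so a fixed bound on the gaps does not suffice here.
  The gaps tend to zero, and the quadratic lower bound for the cosine makes the product tend to 1,
  above the fixed radius of ring \<open>m\<close>.\<close>

lemma klein_radius_exhaust:
  "\<forall>\<^sub>F n in sequentially. \<forall>i. klein_radius m \<le> klein_radius n * cos (hex_angle n (i + 1) - hex_angle n i)"
proof -
  have "(\<lambda>n. 1 - (3 / real (Suc n))\<^sup>2 / 2) \<longlonglongrightarrow> 1" by real_asymp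
  from tendsto_mult[OF klein_radius_tendsto this]
  have "(\<lambda>n. klein_radius n * (1 - (3 / real (Suc n))\<^sup>2 / 2)) \<longlonglongrightarrow> 1" by simp
  then have "\<forall>\<^sub>F n in sequentially. klein_radius m < klein_radius n * (1 - (3 / real (Suc n))\<^sup>2 / 2)"
    using klein_radius(2) by (rule order_tendstoD)
  then show ?thesis
  proof eventually_elim
    case (elim n)
    show ?case
    proof
      fix i
      let ?g = "hex_angle n (i + 1) - hex_angle n i"
      have "?g\<^sup>2 \<le> (3 / real (Suc n))\<^sup>2"
        using hex_angle_step(1,3)[of n i] by (intro power_mono) auto
      then have "1 - (3 / real (Suc n))\<^sup>2 / 2 \<le> cos ?g"
        using one_minus_cos_le[of ?g] by linarith
      then have "klein_radius n * (1 - (3 / real (Suc n))\<^sup>2 / 2) \<le> klein_radius n * cos ?g"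
        using klein_radius(1)[of n] by (intro mult_left_mono) auto
      with elim show "klein_radius m \<le> klein_radius n * cos ?g" by linarith
    qed
  qed
qed

lemma norm_klein_vertex: "norm (polar (klein_radius n) t) < 1"
  using klein_radius(1,2)[of n] by simp

interpretation hex: radial_rings klein_coords "of_klein_coords 0"
  "\<lambda>n i. of_klein_coords (polar (klein_radius n) (hex_angle n i))" "\<lambda>n. 6 * int (Suc n)"
  hex_child hex_angle klein_radius
proof
  show "inj klein_coords" by (rule injI) (simp add: klein_coords_inject)
  show "klein_coords (of_klein_coords 0) = 0" by (simp add: klein_inverse)
  show "klein_coords (of_klein_coords (polar (klein_radius n) (hex_angle n i))) = polar (klein_radius n) (hex_angle n i)" for n i
    by (rule klein_inverse[OF norm_klein_vertex])
  show "hex_angle n (i + 1) - hex_angle n i < pi / 2" for n i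
    using hex_angle_step(2)[of n i] pi_gt_zero by linarith
  show "hex_child n i < hex_child n (i + 1)" for n i
    using hex_child_diff[of n "i + 1"] by (simp split: if_splits)
  show "hex_angle n i \<le> hex_angle (Suc n) (hex_child n i)"
    "hex_angle (Suc n) (hex_child n i) \<le> hex_angle n (i + 1)" "\<exists>j. hex_angle (Suc n) j = hex_angle n i" for n i
  proof -
    obtain s x where i: "i = s * int (Suc n) + x" "0 \<le> x" "x < int (Suc n)" by (rule sector_index)
    have e: "hex_angle n i = pi / 3 * (of_int s + fraction (Suc n) x)"
      "hex_angle n (i + 1) = pi / 3 * (of_int s + fraction (Suc n) (x + 1))"
      "hex_angle (Suc n) (hex_child n i) = pi / 3 * (of_int s + fraction (Suc (Suc n)) (x + 1))"
      "hex_angle (Suc n) (s * int (Suc (Suc n)) + x) = pi / 3 * (of_int s + fraction (Suc (Suc n)) x)"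
      using i hex_angle_at[of x n s] hex_angle_at[of "x + 1" n s] hex_child_at[of x n s]
        hex_angle_at[of "x + 1" "Suc n" s] hex_angle_at[of x "Suc n" s]
      by (simp_all add: add.assoc del: of_nat_Suc)
    note f = fraction_refine[of "Suc n" x, OF _ i(2,3)]
    show "hex_angle n i \<le> hex_angle (Suc n) (hex_child n i)" "hex_angle (Suc n) (hex_child n i) \<le> hex_angle n (i + 1)"
      unfolding e using f(1,2) by (auto intro!: mult_left_mono)
    show "\<exists>j. hex_angle (Suc n) j = hex_angle n i"
      using f(3) e by (metis zero_less_Suc)
  qed
qed (simp_all add: klein_radius klein_radius_mono hex_angle_step hex_angle_period hex_child_period
    klein_radius_exhaust del: of_nat_Suc)

lemma hex_\<Omega>: "hex.\<Omega> = ball 0 1"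
proof -
  have "\<exists>m. norm x < klein_radius m" if "norm x < 1" for x :: "real^2"
    using order_tendstoD(1)[OF klein_radius_tendsto that] by (auto simp: eventually_sequentially)
  moreover have "norm x < 1" if "norm x < klein_radius m" for x :: "real^2" and m
    using that klein_radius(2)[of m] by linarith
  ultimately show ?thesis by (auto simp: hex.\<Omega>_def)
qed

lemma klein_cosh_polar:
  "klein_cosh (polar r s) (polar r' s') = (1 - r * r' * cos (s' - s)) / (sqrt (1 - r\<^sup>2) * sqrt (1 - r'\<^sup>2))"
  by (simp add: klein_cosh_def inner_polar power2_eq_square)

text \<open>For \<open>a = n + 1\<close> the numerator of \<open>klein_cosh\<close> is of order
  \<open>1 / a ^ 2\<close>: a radial part \<open>1 - r * r'\<close> and an angular part from gaps of
  at most \<open>3 / a\<close>. The denominator has the same order, its roots being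
  \<open>1 / (a + 1)\<close> or \<open>1 / (a + 2)\<close>.\<close>

lemma hex_edge_bound:
  assumes "t \<in> hex.T" "y \<in> klein_coords ` t" "z \<in> klein_coords ` t"
  shows "klein_cosh y z \<le> 50"
  using assms(1)
proof (cases rule: hex.T_in_sector)
  case (1 n i)
  obtain r s where y: "y = polar r s" "hex_angle n i \<le> s" "s \<le> hex_angle n (i + 1)" "r \<in> {klein_radius n, klein_radius (Suc n)}"
    using 1[OF assms(2)] by blast
  obtain r' s' where z: "z = polar r' s'" "hex_angle n i \<le> s'" "s' \<le> hex_angle n (i + 1)" "r' \<in> {klein_radius n, klein_radius (Suc n)}"
    using 1[OF assms(3)] by blast
  define a where "a = real n + 1"
  have a: "1 \<le> a" by (simp add: a_def)
  have le: "klein_radius n \<le> klein_radius (Suc n)"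
    using klein_radius_mono by (simp add: strict_mono_less_eq)
  have r: "klein_radius n \<le> q" "0 < q" "q < 1" "1 / (a + 2) \<le> sqrt (1 - q\<^sup>2)"
    if "q \<in> {klein_radius n, klein_radius (Suc n)}" for q
  proof -
    show "klein_radius n \<le> q" "0 < q" "q < 1" using that klein_radius le by auto
    have "sqrt (1 - q\<^sup>2) = 1 / (a + 1) \<or> sqrt (1 - q\<^sup>2) = 1 / (a + 2)"
      using that klein_radius(3)[of n] klein_radius(3)[of "Suc n"]
      by (auto simp: a_def real_sqrt_divide add.commute)
    moreover have "1 / (a + 2) \<le> 1 / (a + 1)" using a by (intro divide_left_mono) auto
    ultimately show "1 / (a + 2) \<le> sqrt (1 - q\<^sup>2)" by auto
  qed
  note ry = r[OF y(4)] and rz = r[OF z(4)]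
  have rr: "1 - r * r' \<le> 1 / (a + 1)\<^sup>2"
  proof -
    have "klein_radius n * klein_radius n \<le> r * r'"
      using ry rz klein_radius(1)[of n] by (intro mult_mono) auto
    then show ?thesis using klein_radius(3)[of n] by (simp add: power2_eq_square a_def add.commute)
  qed
  have "\<bar>s' - s\<bar> \<le> 3 / a"
    using y z hex_angle_step(3)[of n i] by (simp add: a_def add.commute)
  then have "(s' - s)\<^sup>2 \<le> (3 / a)\<^sup>2" by (metis abs_ge_zero power2_abs power_mono)
  then have cos: "1 - cos (s' - s) \<le> (3 / a)\<^sup>2 / 2"
    using one_minus_cos_le[of "s' - s"] by linarith
  have "1 - r * r' * cos (s' - s) = (1 - r * r') + (r * r') * (1 - cos (s' - s))"
    by (simp add: algebra_simps)
  also have "(r * r') * (1 - cos (s' - s)) \<le> 1 * ((3 / a)\<^sup>2 / 2)"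
    using cos ry rz by (intro mult_mono mult_le_one) auto
  finally have num: "1 - r * r' * cos (s' - s) \<le> 1 / (a + 1)\<^sup>2 + (3 / a)\<^sup>2 / 2"
    using rr by linarith
  have "klein_cosh y z = (1 - r * r' * cos (s' - s)) / (sqrt (1 - r\<^sup>2) * sqrt (1 - r'\<^sup>2))"
    unfolding y(1) z(1) by (rule klein_cosh_polar)
  also have "\<dots> \<le> (1 / (a + 1)\<^sup>2 + (3 / a)\<^sup>2 / 2) / ((1 / (a + 2)) * (1 / (a + 2)))"
    using num a ry(4) rz(4) power_le_one[of r 2] power_le_one[of r' 2] ry(2,3) rz(2,3)
    by (intro frac_le mult_mono) auto
  also have "\<dots> = ((a + 2) / (a + 1))\<^sup>2 + 9 / 2 * ((a + 2) / a)\<^sup>2"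
    using a by (simp add: power2_eq_square field_simps)
  \<comment> \<open>The quotients decrease in \<open>a\<close> and \<open>a\<close> is at least 1;
    the resulting value \<open>4 + 81 / 2\<close> is below 50.\<close>
  also have "\<dots> \<le> 2\<^sup>2 + 9 / 2 * 3\<^sup>2"
    using a by (intro add_mono mult_left_mono power_mono) (auto simp: divide_le_eq)
  finally show ?thesis by simp
next
  case (2 i)
  obtain r s where y: "y = polar r s" "r \<in> {0, klein_radius 0}" using 2[OF assms(2)] by blast
  obtain r' s' where z: "z = polar r' s'" "r' \<in> {0, klein_radius 0}" using 2[OF assms(3)] by blast
  have r: "0 \<le> q" "q < 1" "1 / 2 \<le> sqrt (1 - q\<^sup>2)" if "q \<in> {0, klein_radius 0}" for q
  proof -
    show "0 \<le> q" "q < 1" using that klein_radius[of 0] by auto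
    show "1 / 2 \<le> sqrt (1 - q\<^sup>2)"
      by (rule real_le_rsqrt) (use that klein_radius(3)[of 0] in \<open>auto simp: power2_eq_square\<close>)
  qed
  note ry = r[OF y(2)] and rz = r[OF z(2)]
  have "\<bar>r * r' * cos (s' - s)\<bar> \<le> 1"
    unfolding abs_mult using ry rz by (intro mult_le_one) auto
  then have num: "1 - r * r' * cos (s' - s) \<le> 2" by linarith
  have "klein_cosh y z = (1 - r * r' * cos (s' - s)) / (sqrt (1 - r\<^sup>2) * sqrt (1 - r'\<^sup>2))"
    unfolding y(1) z(1) by (rule klein_cosh_polar)
  also have "\<dots> \<le> 2 / ((1 / 2) * (1 / 2))"
    using num ry(3) rz(3) power_le_one[of r 2] power_le_one[of r' 2] ry(1,2) rz(1,2)
    by (intro frac_le mult_mono) auto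
  finally show ?thesis by simp
qed

lemma hyperbolic_triangulation:
  "\<exists>(K :: hyperbolic_plane set set) (h :: (hyperbolic_plane \<Rightarrow> real) \<Rightarrow> hyperbolic_plane).
      geometric_triangulation K h \<and> regular_cplx 6 K \<and> bounded_triangles K h"
proof (intro exI conjI)
  let ?h = "of_klein_coords \<circ> affine_extension klein_coords"
  show "geometric_triangulation hex.cplx ?h"
    unfolding geometric_triangulation_def space_triangulation_def
  proof (intro conjI ballI)
    show "simplicial_cplx hex.cplx" by (rule hex.simplicial_cplx)
    show "locally_finite_cplx hex.cplx" by (rule hex.locally_finite_cplx)
    show "\<exists>g. homeomorphism (geom_realization hex.cplx) UNIV ?h g"
      using homeomorphism_compose[OF hex.homeomorphism_realization[unfolded hex_\<Omega>] homeomorphism_klein] by blast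
    fix e assume "e \<in> edges hex.cplx"
    then obtain u v where "klein_coords u \<noteq> klein_coords v"
      "affine_extension klein_coords ` closed_cell e = closed_segment (klein_coords u) (klein_coords v)"
      by (rule hex.edge_segment)
    then show "geodesic_arc (?h ` closed_cell e)"
      using geodesic_arc_klein_segment[of u v] unfolding image_comp[symmetric] by auto
  qed
  show "regular_cplx 6 hex.cplx"
  proof (rule hex.regular)
    show "hex_child n i - hex_child n (i - 1) = int 6 - 4 - (if 0 < n \<and> i \<in> range (hex_child (n - 1)) then 1 else 0)" for n i
      \<comment> \<open>In ring 0 every index is a multiple of 1, which fits the centre as the only
        lower neighbour.\<close>
      unfolding hex_child_diff using hex_child_range[of i "n - 1"] by (cases n) auto
  qed simp
  show "bounded_triangles hex.cplx ?h"
    unfolding bounded_triangles_def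
  proof (intro exI ballI)
    fix t assume "t \<in> triangles hex.cplx"
    then obtain t' where t: "t \<in> hex.cplx" "t' \<in> hex.T" "t \<subseteq> t'"
      by (auto simp: triangles_def generated_cplx_def)
    have "diameter (of_klein_coords ` (convex hull (klein_coords ` t))) \<le> arcosh 50"
      using hex_edge_bound[OF t(2)] t(3) norm_klein_coords by (intro klein_hull_diameter_le) auto
    then show "diameter (?h ` closed_cell t) \<le> arcosh 50"
      unfolding image_comp[symmetric] hex.image_face[OF t(1)] .
  qed
qed

theorem theorem1p1:
  "(\<exists>(K :: hyperbolic_plane set set) (h :: (hyperbolic_plane \<Rightarrow> real) \<Rightarrow> hyperbolic_plane).
      geometric_triangulation K h \<and> regular_cplx 6 K \<and> bounded_triangles K h) \<and>
   (\<forall>k\<ge>7. \<exists>(K :: (real^2) set set) (h :: (real^2 \<Rightarrow> real) \<Rightarrow> real^2).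
      geometric_triangulation K h \<and> regular_cplx k K \<and> bounded_triangles K h)"
proof (intro conjI allI impI)
  show "\<exists>(K :: hyperbolic_plane set set) (h :: (hyperbolic_plane \<Rightarrow> real) \<Rightarrow> hyperbolic_plane).
      geometric_triangulation K h \<and> regular_cplx 6 K \<and> bounded_triangles K h"
    by (rule hyperbolic_triangulation)
  fix k :: nat assume "7 \<le> k"
  then show "\<exists>(K :: (real^2) set set) (h :: (real^2 \<Rightarrow> real) \<Rightarrow> real^2).
      geometric_triangulation K h \<and> regular_cplx k K \<and> bounded_triangles K h"
    using euclidean_triangulation[of "int k"] by simp
qed

end
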